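(* Let $f(Z)=\sum_{i=1}^d \alpha_i Z^i\in\mathbb{R}[Z]$ be any polynomial of degree $d\ge 3$, and let $a,q$ be integers with $q\ge 1$, $\gcd(a,q)=1$ and $$\left|\alpha_d-\frac aq\right|<\frac1{q^2}.$$ Let $m$ and $\ell$ be positive integers and let $k\in\{0,\ldots,m-1\}$. Then $$|U_f(r,\ell,k,m)|\le r2^{r}\left(\ell^{\widetilde\eta_1(d)}q^{-\widetilde\eta_1(d)}+\ell^{\widetilde\vartheta(d)}2^{-\widetilde\zeta_1(d)r}+2^{-\widetilde\zeta_2(d)r}+2^{-\widetilde\zeta_3(d)r}q^{\widetilde\eta_2(d)}\right)^{1/2}$$ as $r\to\infty$ (that is, for all sufficiently large $r$), where $$\widetilde\eta_1(d)=\frac1{d^2-2d+4},\qquad \widetilde\eta_2(d)=\frac1{d^2-2d+3},\qquad \widetilde\vartheta(d)=\frac1{d^2-d+2},$$ $$\widetilde\zeta_1(d)=\frac{d-2}{d^2-d+2},\qquad \widetilde\zeta_2(d)=\frac1{d^2-3d+5},\qquad \widetilde\zeta_3(d)=\frac{d-1}{d^2-2d+3}.$$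
   Context: Let $\mathbf{e}(z)=\exp(2\pi i z)$, and let $\sigma(n)$ denote the sum of the binary digits of the nonnegative integer $n$. For positive integers $r,m$ and $k\in\{0,\ldots,m-1\}$ put $$\mathcal{E}_{k,m}(r)=\{0\le n<2^r:\ \sigma(n)\equiv k \pmod m\},\qquad U_f(r,\ell,k,m)=\sum_{n\in\mathcal{E}_{k,m}(r)}\mathbf{e}(\ell f(n)).$$ "Sufficiently large" means $r\ge r_0$ for some $r_0$ depending only on $d$ and $m$ (and not on $f,a,q,\ell,k$). *)

theory Defs
  imports
    Complex_Main
    "HOL-Computational_Algebra.Polynomial"
    "HOL-Number_Theory.Cong"
begin

definition e :: "real \<Rightarrow> complex" where
  "e z = exp (2 * complex_of_real pi * \<i> * complex_of_real z)"

fun bin_digit_sum :: "nat \<Rightarrow> nat" where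
  "bin_digit_sum n = (if n = 0 then 0 else n mod 2 + bin_digit_sum (n div 2))"

declare bin_digit_sum.simps [simp del]

definition digit_class :: "nat \<Rightarrow> nat \<Rightarrow> nat \<Rightarrow> nat set" where
  "digit_class k m r = {n. n < 2 ^ r \<and> [bin_digit_sum n = k] (mod m)}"

definition weyl_sum :: "real poly \<Rightarrow> nat \<Rightarrow> nat \<Rightarrow> nat \<Rightarrow> nat \<Rightarrow> complex" where
  "weyl_sum f r l k m = (\<Sum>n\<in>digit_class k m r. e (real l * poly f (real n)))"

definition eta1 :: "nat \<Rightarrow> real" where
  "eta1 d = 1 / (real d ^ 2 - 2 * real d + 4)"

definition eta2 :: "nat \<Rightarrow> real" where
  "eta2 d = 1 / (real d ^ 2 - 2 * real d + 3)"

definition vartheta :: "nat \<Rightarrow> real" where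
  "vartheta d = 1 / (real d ^ 2 - real d + 2)"

definition zeta1 :: "nat \<Rightarrow> real" where
  "zeta1 d = (real d - 2) / (real d ^ 2 - real d + 2)"

definition zeta2 :: "nat \<Rightarrow> real" where
  "zeta2 d = 1 / (real d ^ 2 - 3 * real d + 5)"

definition zeta3 :: "nat \<Rightarrow> real" where
  "zeta3 d = (real d - 1) / (real d ^ 2 - 2 * real d + 3)"

end

(* Splitting n = 2^s x + y separates the digit sums: sigma(n) = sigma(x) + sigma(y). Cauchy-Schwarz over x
   removes the digit condition on x and leaves Weyl sums over complete intervals of the differences
   l f(2^s x + y1) - l f(2^s x + y2), which are polynomials in x of degree d - 1 whose leading coefficient
   inherits a lower bound for its distance to rationals from the approximation a / q of alpha_d.
   With T the bracket of the theorem, 2^s of size 1 / T is the optimal choice.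

   The exponents require Vinogradov's mean value theorem at the critical exponent in degree k = d - 2. It follows
   from l^2 decoupling for the moment curve over the p-adic numbers, for one fixed prime p > k. The decoupling
   is proved as by Guo, Li, Yung and Zorin-Kranich: induction on the degree, a broad-narrow
   reduction to bilinear estimates, and bootstrapping of these by Hoelder's inequality and decoupling in lower
   degrees. The mean value theorem gives bounds for Weyl sums of degree k + 1 by shifting short windows and the
   large sieve in the top coefficient. *)

theory Submission
  imports Defs "HOL-Analysis.Analysis"
begin

section \<open>Convexity inequalities\<close>

text \<open>Over the p-adic integers the uncertainty principle is exact: an arc is a residue class,
  there are no tails, and frequency support near an arc becomes the algebraic identity
  \<open>covar\<close>. The obstacle in the bilinear part is that a scale cannot be refined freely:
  degree \<open>l\<close> decoupling sees the curve only up to an error of order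
  \<open>l + 1\<close>, and it must leave the modulus of the other factor unchanged. Hoelder's
  inequality links the levels \<open>l\<close>, \<open>k - l\<close> and \<open>l - 1\<close>; the
  gain, summed over the levels, grows linearly with the number of rounds, so any positive exponent
  can be lowered by a fixed amount. The exponents of the theorem come from
  \<open>E = 2 * sK k + 2\<close>, which is d^2 - 3d + 4 for k = d - 2; the 2 pays for the loss
  \<open>Y^\<epsilon>\<close> of the mean value theorem. With \<open>T\<close> the bracket, Weyl
  sums of length about 2^r T must beat the trivial bound by the factor \<open>T\<close>, up to a
  logarithm. This needs \<open>Z\<close> at least of order T^-E, and \<open>eta1\<close>,
  \<open>zeta2\<close> and the pair \<open>eta2\<close>, \<open>zeta3\<close> express it for the
  three constraints on \<open>Z\<close>. The factor \<open>r\<close> absorbs the logarithm and all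
  constants.\<close>

lemma weighted_am_gm_pow:
  fixes u v :: real
  assumes "0 \<le> u" "0 \<le> v" "0 < m + n"
  shows "u ^ m * v ^ n \<le> ((m * u + n * v) / (real m + real n)) ^ (m + n)"
proof (cases "u = 0 \<or> v = 0")
  case True
  then show ?thesis using assms
    by (cases "m = 0"; cases "n = 0") (auto simp: power_0_left intro!: zero_le_power divide_nonneg_nonneg)
next
  case False
  then have uv: "u > 0" "v > 0" using assms by auto
  have mn: "real m + real n > 0" using assms(3) by linarith
  have "u powr (m / (m + n)) * v powr (n / (m + n)) \<le> (m / (m + n)) * u + (n / (m + n)) * v"
    using uv mn by (intro Youngs_inequality_0) (auto simp: add_divide_distrib[symmetric])
  then have "(u powr (m / (m + n)) * v powr (n / (m + n))) ^ (m + n) \<le> ((m * u + n * v) / (real m + real n)) ^ (m + n)"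
    by (intro power_mono) (auto simp: add_divide_distrib)
  also have "(u powr (m / (m + n)) * v powr (n / (m + n))) ^ (m + n) = u ^ m * v ^ n"
    using uv mn by (simp add: power_mult_distrib powr_realpow[symmetric] powr_powr del: powr_realpow')
  finally show ?thesis by simp
qed

text \<open>Integer exponents and no roots: later estimates are compared after raising them to a
  common power. Once the two sums are normalised to 1, the inequality is
  \<open>weighted_am_gm_pow\<close> summed over \<open>A\<close>; a vanishing sum cannot be
  normalised and is treated first.\<close>

lemma holder_pow:
  fixes h f g :: "'a \<Rightarrow> real"
  assumes fin: "finite A" and mn: "0 < m + n"
    and nn: "\<And>x. x \<in> A \<Longrightarrow> 0 \<le> f x" "\<And>x. x \<in> A \<Longrightarrow> 0 \<le> g x" "\<And>x. x \<in> A \<Longrightarrow> 0 \<le> h x"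
    and le: "\<And>x. x \<in> A \<Longrightarrow> h x ^ (m + n) \<le> f x ^ m * g x ^ n"
  shows "(\<Sum>x\<in>A. h x) ^ (m + n) \<le> (\<Sum>x\<in>A. f x) ^ m * (\<Sum>x\<in>A. g x) ^ n"
proof -
  define F where "F = (\<Sum>x\<in>A. f x)"
  define G where "G = (\<Sum>x\<in>A. g x)"
  have F0: "F \<ge> 0" and G0: "G \<ge> 0" unfolding F_def G_def using nn by (auto intro: sum_nonneg)
  have hz: "(\<Sum>x\<in>A. h x) = 0" if "(m > 0 \<and> F = 0) \<or> (n > 0 \<and> G = 0)"
  proof -
    have "h x = 0" if x: "x \<in> A" for x
    proof -
      have "f x ^ m * g x ^ n = 0"
        using \<open>(m > 0 \<and> F = 0) \<or> (n > 0 \<and> G = 0)\<close>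
      proof
        assume "m > 0 \<and> F = 0"
        then have "f x = 0" unfolding F_def using nn fin x by (metis sum_nonneg_eq_0_iff)
        then show ?thesis using \<open>m > 0 \<and> F = 0\<close> by simp
      next
        assume "n > 0 \<and> G = 0"
        then have "g x = 0" unfolding G_def using nn fin x by (metis sum_nonneg_eq_0_iff)
        then show ?thesis using \<open>n > 0 \<and> G = 0\<close> by simp
      qed
      then have "h x ^ (m + n) \<le> 0" using le[OF x] by linarith
      then show ?thesis using nn(3)[OF x] mn by (metis power_eq_0_iff order_antisym zero_le_power)
    qed
    then show ?thesis by simp
  qed
  show ?thesis
  proof (cases "(m > 0 \<and> F = 0) \<or> (n > 0 \<and> G = 0)")
    case True
    have "(\<Sum>x\<in>A. h x) ^ (m + n) = 0" using hz[OF True] mn by (simp add: zero_power)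
    moreover have "0 \<le> F ^ m * G ^ n" using F0 G0 by simp
    ultimately show ?thesis unfolding F_def G_def by (rule ord_eq_le_trans)
  next
    case False
    define K where "K = F ^ m * G ^ n"
    have mn': "real m + real n > 0" using mn by linarith
    have "F ^ m > 0" using False F0 by (cases "m = 0") auto
    moreover have "G ^ n > 0" using False G0 by (cases "n = 0") auto
    ultimately have K0: "K > 0" unfolding K_def by simp
    define k where "k = root (m + n) K"
    have k0: "k > 0" and kK: "k ^ (m + n) = K" unfolding k_def using K0 mn by auto
    \<comment> \<open>A factor with exponent 0 is replaced by 0: its sum may vanish, and its weight
      in the weighted mean is 0.\<close>
    define f' where "f' = (\<lambda>x. if m = 0 then 0 else f x / F)"
    define g' where "g' = (\<lambda>x. if n = 0 then 0 else g x / G)"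
    have hx: "h x \<le> k * ((m * f' x + n * g' x) / (real m + real n))" if x: "x \<in> A" for x
    proof -
      have f'0: "f' x \<ge> 0" and g'0: "g' x \<ge> 0" unfolding f'_def g'_def using nn x F0 G0 by auto
      have "h x ^ (m + n) \<le> f x ^ m * g x ^ n" using le[OF x] .
      also have "\<dots> = K * (f' x ^ m * g' x ^ n)"
        using False by (auto simp: K_def f'_def g'_def power_divide)
      also have "\<dots> \<le> K * ((m * f' x + n * g' x) / (real m + real n)) ^ (m + n)"
        using K0 f'0 g'0 mn by (intro mult_left_mono weighted_am_gm_pow) auto
      also have "\<dots> = (k * ((m * f' x + n * g' x) / (real m + real n))) ^ (m + n)"
        unfolding power_mult_distrib kK ..
      finally show ?thesis
        using k0 f'0 g'0 mn by (subst (asm) power_mono_iff) (auto intro!: mult_nonneg_nonneg divide_nonneg_nonneg nn x)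
    qed
    have "(\<Sum>x\<in>A. h x) \<le> (\<Sum>x\<in>A. k * ((m * f' x + n * g' x) / (real m + real n)))"
      by (intro sum_mono hx)
    also have "\<dots> = k * ((m * (\<Sum>x\<in>A. f' x) + n * (\<Sum>x\<in>A. g' x)) / (real m + real n))"
      by (simp only: sum_distrib_left[symmetric] sum.distrib sum_divide_distrib[symmetric])
    also have "m * (\<Sum>x\<in>A. f' x) = m" unfolding f'_def using False
      by (cases "m = 0") (auto simp: sum_divide_distrib[symmetric] F_def)
    also have "n * (\<Sum>x\<in>A. g' x) = n" unfolding g'_def using False
      by (cases "n = 0") (auto simp: sum_divide_distrib[symmetric] G_def)
    also have "(real m + real n) / (real m + real n) = 1" using mn' by simp
    finally have "(\<Sum>x\<in>A. h x) \<le> k" by simp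
    then have "(\<Sum>x\<in>A. h x) ^ (m + n) \<le> k ^ (m + n)"
      by (intro power_mono sum_nonneg nn)
    then show ?thesis unfolding kK K_def F_def G_def .
  qed
qed

lemma convex_on_power_nonneg: "convex_on {0::real..} (\<lambda>x. x ^ s)"
proof (cases "even s")
  case True
  then show ?thesis using convex_on_subset[OF convex_power_even[OF True], of "{0..}"] by simp
next
  case False
  then show ?thesis by (rule convex_power_odd)
qed

text \<open>Minkowski's inequality from the convexity of the power \<open>s\<close>: with
  \<open>N i\<close> the norm of \<open>a i\<close> and \<open>T\<close> the sum of these norms, the
  sum over \<open>i\<close> is at each point the convex combination of the values
  \<open>a i x * T / N i\<close> with weights \<open>N i / T\<close>. Indices of norm 0 are
  discarded because they have no such representation.\<close>

lemma minkowski_root: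
  fixes a :: "'c \<Rightarrow> 'a \<Rightarrow> real"
  assumes fin: "finite A" "finite I" and s: "0 < s"
    and nn: "\<And>i x. i \<in> I \<Longrightarrow> x \<in> A \<Longrightarrow> 0 \<le> a i x"
  shows "(\<Sum>x\<in>A. (\<Sum>i\<in>I. a i x) ^ s) \<le> (\<Sum>i\<in>I. root s (\<Sum>x\<in>A. a i x ^ s)) ^ s"
proof -
  define N where "N = (\<lambda>i. root s (\<Sum>x\<in>A. a i x ^ s))"
  define I' where "I' = {i\<in>I. N i \<noteq> 0}"
  have finI': "finite I'" unfolding I'_def using fin by auto
  have N0: "N i \<ge> 0" if "i \<in> I" for i unfolding N_def using that nn s
    by (intro real_root_ge_zero sum_nonneg zero_le_power) auto
  have Ns: "N i ^ s = (\<Sum>x\<in>A. a i x ^ s)" if "i \<in> I" for i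
    unfolding N_def using s nn that by (intro real_root_pow_pos2 sum_nonneg zero_le_power) auto
  have z: "a i x = 0" if "i \<in> I" "N i = 0" "x \<in> A" for i x
  proof -
    have "(\<Sum>x\<in>A. a i x ^ s) = 0" using Ns[OF that(1)] that(2) s by (simp add: zero_power)
    then have "a i x ^ s = 0" using that fin nn by (subst (asm) sum_nonneg_eq_0_iff) auto
    then show ?thesis by simp
  qed
  have sI': "(\<Sum>i\<in>I. a i x) = (\<Sum>i\<in>I'. a i x)" if "x \<in> A" for x
    by (rule sum.mono_neutral_right) (use fin z that in \<open>auto simp: I'_def\<close>)
  have sN': "(\<Sum>i\<in>I. N i) = (\<Sum>i\<in>I'. N i)"
    by (rule sum.mono_neutral_right) (use fin in \<open>auto simp: I'_def\<close>)
  show ?thesis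
  proof (cases "I' = {}")
    case True
    have "(\<Sum>x\<in>A. (\<Sum>i\<in>I. a i x) ^ s) = 0" using sI' True s by (simp add: zero_power)
    then show ?thesis using N0 unfolding N_def[symmetric] by (auto intro!: zero_le_power sum_nonneg)
  next
    case False
    have Np: "N i > 0" if "i \<in> I'" for i using that N0[of i] by (auto simp: I'_def)
    define T where "T = (\<Sum>i\<in>I'. N i)"
    have T0: "T > 0" unfolding T_def using finI' False Np by (intro sum_pos) auto
    have pt: "(\<Sum>i\<in>I. a i x) ^ s \<le> (\<Sum>i\<in>I'. (N i / T) * (a i x * T / N i) ^ s)" if x: "x \<in> A" for x
    proof -
      have "(\<Sum>i\<in>I'. (N i / T) *\<^sub>R (a i x * T / N i)) ^ s \<le> (\<Sum>i\<in>I'. (N i / T) * (a i x * T / N i) ^ s)"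
      proof (rule convex_on_sum[where C = "{0..}"])
        show "convex_on {0::real..} (\<lambda>x. x ^ s)" by (rule convex_on_power_nonneg)
        show "(\<Sum>i\<in>I'. N i / T) = 1" using T0 by (simp add: sum_divide_distrib[symmetric] T_def)
      qed (use finI' False Np T0 nn x in \<open>auto simp: I'_def less_imp_le\<close>)
      also have "(\<Sum>i\<in>I'. (N i / T) *\<^sub>R (a i x * T / N i)) = (\<Sum>i\<in>I'. a i x)"
      proof (intro sum.cong refl)
        fix i assume "i \<in> I'"
        from Np[OF this] show "(N i / T) *\<^sub>R (a i x * T / N i) = a i x" using T0 by simp
      qed
      finally show ?thesis using sI'[OF x] by simp
    qed
    have "(\<Sum>x\<in>A. (\<Sum>i\<in>I. a i x) ^ s) \<le> (\<Sum>x\<in>A. \<Sum>i\<in>I'. (N i / T) * (a i x * T / N i) ^ s)"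
      by (intro sum_mono pt)
    also have "\<dots> = (\<Sum>i\<in>I'. \<Sum>x\<in>A. (N i / T) * (a i x * T / N i) ^ s)"
      by (rule sum.swap)
    also have "\<dots> = (\<Sum>i\<in>I'. (N i / T) * (T / N i) ^ s * (\<Sum>x\<in>A. a i x ^ s))"
    proof (rule sum.cong[OF refl])
      fix i
      have "(N i / T) * (a i x * T / N i) ^ s = (N i / T) * (T / N i) ^ s * a i x ^ s" for x
        by (simp add: power_mult_distrib power_divide)
      then show "(\<Sum>x\<in>A. (N i / T) * (a i x * T / N i) ^ s) = (N i / T) * (T / N i) ^ s * (\<Sum>x\<in>A. a i x ^ s)"
        by (simp only: sum_distrib_left)
    qed
    also have "\<dots> = (\<Sum>i\<in>I'. (N i / T) * T ^ s)"
    proof (intro sum.cong refl)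
      fix i assume i: "i \<in> I'"
      then have "(\<Sum>x\<in>A. a i x ^ s) = N i ^ s" using Ns by (auto simp: I'_def)
      then show "(N i / T) * (T / N i) ^ s * (\<Sum>x\<in>A. a i x ^ s) = (N i / T) * T ^ s"
        using Np[OF i] by (simp add: power_divide)
    qed
    also have "\<dots> = T ^ s" using T0 by (simp add: sum_distrib_right[symmetric] sum_divide_distrib[symmetric] T_def)
    finally show ?thesis using sN' unfolding T_def N_def by simp
  qed
qed

section \<open>Decoupling for the moment curve over the p-adic integers\<close>

definition pols :: "nat \<Rightarrow> int \<Rightarrow> int poly set" where
  "pols k q = {x. degree x \<le> k \<and> (\<forall>i. coeff x i \<in> {0..<q})}"

definition mean :: "nat \<Rightarrow> int \<Rightarrow> (int poly \<Rightarrow> real) \<Rightarrow> real" where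
  "mean k q F = (\<Sum>x\<in>pols k q. F x) / card (pols k q)"

text \<open>Functions live on all integer polynomials, so that shifts need no reduction. A periodic
  one descends to coefficients modulo \<open>q\<close>, and its average over the representatives
  \<open>pols k q\<close> is translation invariant.\<close>

definition periodic :: "nat \<Rightarrow> int \<Rightarrow> (int poly \<Rightarrow> 'a) \<Rightarrow> bool" where
  "periodic k q F \<longleftrightarrow> (\<forall>x u. degree u \<le> k \<longrightarrow> F (x + smult q u) = F x)"

lemma finite_pols [simp]: "finite (pols k q)"
proof -
  have "coeff ` pols k q \<subseteq> {f. \<forall>i. (i \<in> {..k} \<longrightarrow> f i \<in> {0..<q}) \<and> (i \<notin> {..k} \<longrightarrow> f i = 0)}"
    by (auto simp: pols_def coeff_eq_0)
  moreover have "finite {f. \<forall>i. (i \<in> {..k} \<longrightarrow> f i \<in> {0..<q}) \<and> (i \<notin> {..k} \<longrightarrow> f i = (0::int))}"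
    by (rule finite_set_of_finite_funs) auto
  ultimately have "finite (coeff ` pols k q)" by (rule finite_subset)
  then show ?thesis by (rule finite_imageD) (auto simp: inj_on_def poly_eqI)
qed

lemma zero_in_pols: "q > 0 \<Longrightarrow> 0 \<in> pols k q"
  by (auto simp: pols_def)

lemma card_pols_pos: "q > 0 \<Longrightarrow> card (pols k q) > 0"
  using zero_in_pols finite_pols by (metis card_gt_0_iff empty_iff)

lemma sum_pols_shift:
  fixes F :: "int poly \<Rightarrow> 'a::comm_monoid_add"
  assumes q: "q > 0" and F: "periodic k q F" and v: "degree v \<le> k"
  shows "(\<Sum>x\<in>pols k q. F (x + v)) = (\<Sum>x\<in>pols k q. F x)"
proof -
  define R where "R = map_poly (\<lambda>c::int. c mod q)"
  have cR: "coeff (R x) i = coeff x i mod q" for x i unfolding R_def by (simp add: coeff_map_poly)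
  have dR: "degree (R x) \<le> k" if "degree x \<le> k" for x
    by (rule degree_le) (use that in \<open>auto simp: cR coeff_eq_0\<close>)
  have R: "R x \<in> pols k q" if "degree x \<le> k" for x
    using dR[OF that] q by (auto simp: pols_def cR)
  have eq: "R x + smult q (map_poly (\<lambda>c. c div q) x) = x" for x
    by (rule poly_eqI) (simp add: cR coeff_map_poly)
  have FR: "F (R x) = F x" if "degree x \<le> k" for x
  proof -
    have "degree (map_poly (\<lambda>c. c div q) x) \<le> k"
      by (rule degree_le) (use that in \<open>auto simp: coeff_map_poly coeff_eq_0\<close>)
    then show ?thesis using F eq[of x] unfolding periodic_def by metis
  qed
  have id: "R x = x" if "x \<in> pols k q" for x
    by (rule poly_eqI) (use that in \<open>auto simp: cR pols_def\<close>)
  have RR: "R (R (x - v) + v) = R x" "R (R (x + v) - v) = R x" for x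
    by (rule poly_eqI, simp add: cR mod_simps)+
  have d: "degree (x + v) \<le> k" "degree (x - v) \<le> k" if "x \<in> pols k q" for x
    using that v by (auto simp: pols_def intro: degree_add_le degree_diff_le)
  show ?thesis
    by (rule sum.reindex_bij_witness[where i = "\<lambda>x. R (x - v)" and j = "\<lambda>x. R (x + v)"])
       (auto simp: RR id FR d intro!: R)
qed

lemma mean_shift:
  "q > 0 \<Longrightarrow> periodic k q F \<Longrightarrow> degree v \<le> k \<Longrightarrow> mean k q (\<lambda>x. F (x + v)) = mean k q F"
  unfolding mean_def by (simp add: sum_pols_shift)

lemma mean_mono: "(\<And>x. F x \<le> G x) \<Longrightarrow> mean k q F \<le> mean k q G"
  unfolding mean_def by (intro divide_right_mono sum_mono) auto

lemma mean_nonneg: "(\<And>x. 0 \<le> F x) \<Longrightarrow> 0 \<le> mean k q F"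
  unfolding mean_def by (intro divide_nonneg_nonneg sum_nonneg) auto

lemma mean_cmult: "mean k q (\<lambda>x. c * F x) = c * mean k q F"
  unfolding mean_def by (simp add: sum_distrib_left)

lemma mean_multc: "mean k q (\<lambda>x. F x * c) = mean k q F * c"
  unfolding mean_def by (simp add: sum_distrib_right)

lemma mean_add: "mean k q (\<lambda>x. F x + G x) = mean k q F + mean k q G"
  unfolding mean_def by (simp add: sum.distrib add_divide_distrib)

lemma mean_sum: "mean k q (\<lambda>x. \<Sum>i\<in>I. F i x) = (\<Sum>i\<in>I. mean k q (F i))"
  unfolding mean_def by (subst sum.swap) (simp add: sum_divide_distrib)

lemma mean_const: "q > 0 \<Longrightarrow> mean k q (\<lambda>x. c) = c"
  unfolding mean_def sum_constant using card_pols_pos[of q k] by (metis nonzero_mult_div_cancel_left of_nat_0_less_iff less_numeral_extra(3))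

lemma mean_swap: "mean k q (\<lambda>x. mean l r (F x)) = mean l r (\<lambda>z. mean k q (\<lambda>x. F x z))"
  unfolding mean_def by (subst (2) sum_divide_distrib[symmetric], subst sum_divide_distrib[symmetric], subst sum.swap) simp

lemma sum_eq_card_mean: "q > 0 \<Longrightarrow> (\<Sum>x\<in>pols k q. F x) = real (card (pols k q)) * mean k q F"
  unfolding mean_def using card_pols_pos[of q k] by (metis mult.commute nonzero_eq_divide_eq of_nat_0_less_iff less_numeral_extra(3))

lemma mean_minkowski:
  assumes "finite I" "0 < s" and nn: "\<And>i x. i \<in> I \<Longrightarrow> 0 \<le> a i x" and q: "q > 0"
  shows "mean k q (\<lambda>x. (\<Sum>i\<in>I. a i x) ^ s) \<le> (\<Sum>i\<in>I. root s (mean k q (\<lambda>x. a i x ^ s))) ^ s"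
proof -
  let ?n = "real (card (pols k q))"
  have n: "?n > 0" using card_pols_pos[OF q] by simp
  have "(\<Sum>x\<in>pols k q. (\<Sum>i\<in>I. a i x) ^ s) \<le> (\<Sum>i\<in>I. root s (\<Sum>x\<in>pols k q. a i x ^ s)) ^ s"
    using assms by (intro minkowski_root) auto
  also have "\<dots> = (\<Sum>i\<in>I. root s ?n * root s (mean k q (\<lambda>x. a i x ^ s))) ^ s"
    unfolding real_root_mult[symmetric] sum_eq_card_mean[OF q] ..
  also have "\<dots> = ?n * (\<Sum>i\<in>I. root s (mean k q (\<lambda>x. a i x ^ s))) ^ s"
    using n \<open>0 < s\<close> by (simp add: sum_distrib_left[symmetric] power_mult_distrib)
  finally show ?thesis using n by (simp add: mean_def field_simps)
qed

lemma mean_holder: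
  assumes mn: "0 < m + n" and q: "q > 0"
    and nn: "\<And>x. 0 \<le> f x" "\<And>x. 0 \<le> g x" "\<And>x. 0 \<le> h x"
    and le: "\<And>x. h x ^ (m + n) \<le> f x ^ m * g x ^ n"
  shows "mean k q h ^ (m + n) \<le> mean k q f ^ m * mean k q g ^ n"
proof -
  let ?n = "real (card (pols k q))"
  have n: "?n > 0" using card_pols_pos[OF q] by simp
  have "sum h (pols k q) ^ (m + n) \<le> sum f (pols k q) ^ m * sum g (pols k q) ^ n"
    using assms by (intro holder_pow) auto
  then have "sum h (pols k q) ^ (m + n) / ?n ^ (m + n) \<le> (sum f (pols k q) ^ m * sum g (pols k q) ^ n) / ?n ^ (m + n)"
    using n by (intro divide_right_mono) auto
  then show ?thesis unfolding mean_def power_divide power_add by (simp only: times_divide_times_eq)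
qed

lemma periodic_comp: "periodic k q F \<Longrightarrow> periodic k q (\<lambda>x. g (F x))"
  unfolding periodic_def by simp

lemma periodic_comp2: "periodic k q F \<Longrightarrow> periodic k q G \<Longrightarrow> periodic k q (\<lambda>x. g (F x) (G x))"
  unfolding periodic_def by simp

lemma mean_average:
  assumes q: "q > 0" "r > 0" and H: "periodic k q H" and d: "\<And>z. degree (\<Phi> z) \<le> k"
  shows "mean k q H = mean k q (\<lambda>x. mean l r (\<lambda>z. H (x + \<Phi> z)))"
proof -
  have "mean k q (\<lambda>x. mean l r (\<lambda>z. H (x + \<Phi> z))) = mean l r (\<lambda>z. mean k q (\<lambda>x. H (x + \<Phi> z)))"
    by (rule mean_swap)
  also have "\<dots> = mean l r (\<lambda>z. mean k q H)" using mean_shift[OF q(1) H d] by simp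
  finally show ?thesis using q by (simp add: mean_const)
qed

section \<open>The additive character, covariant functions and the decoupling inequality\<close>

lemma e_add: "e (x + y) = e x * e y"
  unfolding e_def by (simp add: exp_add[symmetric] algebra_simps)

lemma norm_e [simp]: "norm (e x) = 1"
proof -
  have "e x = cis (2 * pi * x)" unfolding e_def cis_conv_exp by (simp add: mult_ac)
  then show ?thesis by simp
qed

lemma e_0 [simp]: "e 0 = 1" unfolding e_def by simp

lemma e_int [simp]: "e (of_int n) = 1"
proof -
  have "e (of_int n) = cis (2 * pi * n)" unfolding e_def cis_conv_exp by (simp add: mult_ac)
  also have "\<dots> = 1" using cis_multiple_2pi[of "of_int n"] by (simp add: mult_ac)
  finally show ?thesis .
qed

lemma e_cong:
  fixes a b q :: int
  assumes "q dvd a - b" "q \<noteq> 0"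
  shows "e (of_int a / of_int q) = e (of_int b / of_int q)"
proof -
  from assms obtain m where "a = b + q * m" by (metis add.commute diff_add_cancel dvdE)
  then have "real_of_int a / real_of_int q = real_of_int b / real_of_int q + real_of_int m"
    using assms by (simp add: field_simps)
  then show ?thesis by (simp add: e_add)
qed

text \<open>Functions on polynomials of degree at most \<open>k\<close> modulo \<open>p\<^bsup>M\<^esup>\<close> stand for functions on \<open>\<int>\<^sub>p\<^bsup>k+1\<^esup>\<close> at
  resolution \<open>M\<close>. The model is \<open>f x = e (x(c') / p\<^bsup>M\<^esup>)\<close> with \<open>c' \<equiv> c\<close> modulo \<open>p\<^bsup>j\<^esup>\<close>: then \<open>f\<close> has its frequency on
  the arc of the moment curve of length \<open>p\<^bsup>-j\<^esup>\<close> at \<open>c\<close>. Covariance expresses frequency support in the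
  anisotropic neighbourhood of this arc without Fourier analysis.\<close>

definition covar :: "int \<Rightarrow> nat \<Rightarrow> nat \<Rightarrow> nat \<Rightarrow> int \<Rightarrow> (int poly \<Rightarrow> complex) \<Rightarrow> bool" where
  "covar p k M j c f \<longleftrightarrow> (\<forall>x v. degree v \<le> k \<longrightarrow> [:p ^ M:] dvd (pcompose v [:c, p ^ j:] - [:poly v c:]) \<longrightarrow>
     f (x + v) = e (of_int (poly v c) / of_int (p ^ M)) * f x)"

lemma dvd_pcompose: "[:a:] dvd f \<Longrightarrow> [:a:] dvd pcompose f (g :: 'a :: comm_ring_1 poly)"
  by (metis dvd_def pcompose_const pcompose_mult)

text \<open>An arc lies in every coarser arc around a nearby centre. With
  \<open>c = c' + p ^ i * m\<close>, substituting \<open>m + p ^ (j - i) * S\<close> for the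
  variable \<open>S\<close> turns \<open>c' + p ^ i * S\<close> into \<open>c + p ^ j * S\<close>,
  so a shift that is tested on the coarse arc is also admissible on the fine one.\<close>

lemma covar_mono:
  assumes p: "p \<noteq> 0" and f: "covar p k M j c f" and ij: "i \<le> j" and c: "p ^ i dvd c - c'"
  shows "covar p k M i c' f"
  unfolding covar_def
proof (intro allI impI)
  fix x v assume v: "degree v \<le> k" and d: "[:p ^ M:] dvd (pcompose v [:c', p ^ i:] - [:poly v c':])"
  from c obtain m where m: "c = c' + p ^ i * m" by (metis add.commute diff_add_cancel dvdE)
  have "pcompose [:c', p ^ i:] [:m, p ^ (j - i):] = [:c, p ^ j:]"
    using ij by (simp add: pcompose_pCons m power_add[symmetric])
  moreover have "[:p ^ M:] dvd pcompose (pcompose v [:c', p ^ i:] - [:poly v c':]) [:m, p ^ (j - i):]"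
    by (rule dvd_pcompose[OF d])
  ultimately have d2: "[:p ^ M:] dvd pcompose v [:c, p ^ j:] - [:poly v c':]"
    by (simp add: pcompose_diff pcompose_assoc[symmetric])
  then have "p ^ M dvd coeff (pcompose v [:c, p ^ j:] - [:poly v c':]) 0"
    unfolding const_poly_dvd_iff by blast
  also have "coeff (pcompose v [:c, p ^ j:] - [:poly v c':]) 0 = poly v c - poly v c'"
    unfolding poly_0_coeff_0[symmetric] by (simp add: poly_pcompose)
  finally have d3: "p ^ M dvd poly v c - poly v c'" .
  then have "[:p ^ M:] dvd [:poly v c - poly v c':]" by simp
  from dvd_diff[OF d2 this] have "[:p ^ M:] dvd pcompose v [:c, p ^ j:] - [:poly v c:]"
    by (simp only: diff_diff_eq add_pCons) simp
  then have "f (x + v) = e (of_int (poly v c) / of_int (p ^ M)) * f x" using f v unfolding covar_def by blast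
  also have "e (of_int (poly v c) / of_int (p ^ M)) = e (of_int (poly v c') / of_int (p ^ M))"
    by (rule e_cong[OF d3]) (use p in simp)
  finally show "f (x + v) = e (of_int (poly v c') / of_int (p ^ M)) * f x" .
qed

lemma covar_sum: "(\<And>i. i \<in> I \<Longrightarrow> covar p k M j c (f i)) \<Longrightarrow> covar p k M j c (\<lambda>x. \<Sum>i\<in>I. f i x)"
  unfolding covar_def by (auto simp: sum_distrib_left intro!: sum.cong)

lemma covar_zero: "covar p k M j c (\<lambda>x. 0)"
  unfolding covar_def by simp

lemma covar_norm:
  "covar p k M j c f \<Longrightarrow> degree v \<le> k \<Longrightarrow> [:p ^ M:] dvd (pcompose v [:c, p ^ j:] - [:poly v c:]) \<Longrightarrow>
    norm (f (x + v)) = norm (f x)"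
  unfolding covar_def by (simp add: norm_mult)

lemma covar_periodic:
  assumes "covar p k M j c f" "p \<noteq> 0"
  shows "periodic k (p ^ M) f"
  unfolding periodic_def
proof (intro allI impI)
  fix x u :: "int poly" assume u: "degree u \<le> k"
  have "[:p ^ M:] dvd pcompose (smult (p ^ M) u) [:c, p ^ j:] - [:poly (smult (p ^ M) u) c:]"
    by (simp add: const_poly_dvd_iff pcompose_smult coeff_pCons split: nat.split)
  then have "f (x + smult (p ^ M) u) = e (of_int (poly (smult (p ^ M) u) c) / of_int (p ^ M)) * f x"
    using assms u unfolding covar_def by (metis degree_smult_le le_trans)
  also have "of_int (poly (smult (p ^ M) u) c) / of_int (p ^ M) = (of_int (poly u c) :: real)"
    using assms by simp
  finally show "f (x + smult (p ^ M) u) = f x" by simp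
qed

definition sK :: "nat \<Rightarrow> nat" where "sK k = k * (k + 1) div 2"

lemma sK_pos: "k > 0 \<Longrightarrow> sK k > 0"
  unfolding sK_def by (cases k) auto

lemma two_sK: "2 * sK k = k * (k + 1)"
  unfolding sK_def by simp

definition moment :: "nat \<Rightarrow> int \<Rightarrow> nat \<Rightarrow> (int poly \<Rightarrow> complex) \<Rightarrow> real" where
  "moment k q s f = mean k q (\<lambda>x. norm (f x) ^ (2 * s))"

lemma moment_nonneg [simp]: "0 \<le> moment k q s f"
  unfolding moment_def by (rule mean_nonneg) simp

text \<open>The decoupling inequality at the critical exponent \<open>2 sK k = k (k + 1)\<close>, raised to that power.\<close>

definition dec :: "int \<Rightarrow> nat \<Rightarrow> nat \<Rightarrow> real \<Rightarrow> bool" where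
  "dec p k j D \<longleftrightarrow> (\<forall>M f. k * j \<le> M \<longrightarrow> (\<forall>c\<in>{0..<p ^ j}. covar p k M j c (f c)) \<longrightarrow>
     moment k (p ^ M) (sK k) (\<lambda>x. \<Sum>c\<in>{0..<p ^ j}. f c x) \<le>
     D * (\<Sum>c\<in>{0..<p ^ j}. root (sK k) (moment k (p ^ M) (sK k) (f c))) ^ sK k)"

text \<open>Decoupling in degree \<open>l\<close> is used fibrewise. The average over
  \<open>x\<close> is also an average over the translates \<open>x + \<Phi> z\<close>; along each of
  them \<open>W\<close> is constant and the \<open>F c\<close> are covariant for the curve of degree
  \<open>l\<close>. Minkowski's inequality with exponent \<open>sK l\<close> then moves the average
  over \<open>x\<close> inside the sum over \<open>c\<close>.\<close>

lemma dec_transfer: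
  fixes F :: "int \<Rightarrow> int poly \<Rightarrow> complex" and W :: "int poly \<Rightarrow> real"
  assumes p: "p > 1" and D: "dec p l i D" "D \<ge> 0" and l: "l \<ge> 1" and M': "l * i \<le> M'"
    and \<Phi>: "\<And>z. degree (\<Phi> z) \<le> k"
    and W: "periodic k (p ^ M) W" "\<And>x. W x \<ge> 0" "\<And>x z. W (x + \<Phi> z) = W x"
    and F: "\<And>c. c \<in> {0..<p ^ i} \<Longrightarrow> periodic k (p ^ M) (F c)"
      "\<And>c x. c \<in> {0..<p ^ i} \<Longrightarrow> covar p l M' i c (\<lambda>z. F c (x + \<Phi> z))"
  shows "mean k (p ^ M) (\<lambda>x. norm (\<Sum>c\<in>{0..<p ^ i}. F c x) ^ (2 * sK l) * W x) \<le>
    D * (\<Sum>c\<in>{0..<p ^ i}. root (sK l) (mean k (p ^ M) (\<lambda>x. norm (F c x) ^ (2 * sK l) * W x))) ^ sK l"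
proof -
  let ?s = "sK l" let ?I = "{0..<p ^ i}" let ?q = "p ^ M" let ?r = "p ^ M'"
  have s: "?s > 0" using sK_pos l by simp
  have q: "?q > 0" "?r > 0" using p by auto
  define G where "G = (\<lambda>c x. mean l ?r (\<lambda>z. norm (F c (x + \<Phi> z)) ^ (2 * ?s) * W (x + \<Phi> z)))"
  have G0: "G c x \<ge> 0" for c x unfolding G_def by (intro mean_nonneg mult_nonneg_nonneg W) auto
  have per: "periodic k ?q (\<lambda>x. \<Sum>c\<in>?I. F c x)"
    using F(1) unfolding periodic_def by (auto intro!: sum.cong)
  have "mean k ?q (\<lambda>x. norm (\<Sum>c\<in>?I. F c x) ^ (2 * ?s) * W x) =
     mean k ?q (\<lambda>x. mean l ?r (\<lambda>z. norm (\<Sum>c\<in>?I. F c (x + \<Phi> z)) ^ (2 * ?s) * W (x + \<Phi> z)))"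
    by (rule mean_average[OF q _ \<Phi>]) (rule periodic_comp2[OF per W(1)])
  also have "\<dots> \<le> mean k ?q (\<lambda>x. D * (\<Sum>c\<in>?I. root ?s (G c x)) ^ ?s)"
  proof (rule mean_mono)
    fix x
    have "mean l ?r (\<lambda>z. norm (\<Sum>c\<in>?I. F c (x + \<Phi> z)) ^ (2 * ?s) * W (x + \<Phi> z)) =
      moment l ?r ?s (\<lambda>z. \<Sum>c\<in>?I. F c (x + \<Phi> z)) * W x"
      by (simp add: W mean_multc moment_def)
    also have "\<dots> \<le> (D * (\<Sum>c\<in>?I. root ?s (moment l ?r ?s (\<lambda>z. F c (x + \<Phi> z)))) ^ ?s) * W x"
      using D(1)[unfolded dec_def, rule_format, OF M', of "\<lambda>c z. F c (x + \<Phi> z)"] F(2)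
      by (intro mult_right_mono W) blast
    also have "\<dots> = D * (\<Sum>c\<in>?I. root ?s (moment l ?r ?s (\<lambda>z. F c (x + \<Phi> z))) * root ?s (W x)) ^ ?s"
      using W(2)[of x] s by (simp add: sum_distrib_right[symmetric] power_mult_distrib)
    also have "\<dots> = D * (\<Sum>c\<in>?I. root ?s (G c x)) ^ ?s"
      by (simp add: G_def W mean_multc moment_def real_root_mult)
    finally show "mean l ?r (\<lambda>z. norm (\<Sum>c\<in>?I. F c (x + \<Phi> z)) ^ (2 * ?s) * W (x + \<Phi> z))
      \<le> D * (\<Sum>c\<in>?I. root ?s (G c x)) ^ ?s" .
  qed
  also have "\<dots> = D * mean k ?q (\<lambda>x. (\<Sum>c\<in>?I. root ?s (G c x)) ^ ?s)" by (rule mean_cmult)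
  also have "\<dots> \<le> D * (\<Sum>c\<in>?I. root ?s (mean k ?q (\<lambda>x. root ?s (G c x) ^ ?s))) ^ ?s"
    using s q G0 by (intro mult_left_mono[OF mean_minkowski] D(2)) (auto intro: real_root_ge_zero)
  also have "(\<lambda>c. mean k ?q (\<lambda>x. root ?s (G c x) ^ ?s)) = (\<lambda>c. mean k ?q (G c))"
    using s G0 by (intro ext) (simp add: real_root_pow_pos2)
  also have "(\<Sum>c\<in>?I. root ?s (mean k ?q (G c))) =
    (\<Sum>c\<in>?I. root ?s (mean k ?q (\<lambda>x. norm (F c x) ^ (2 * ?s) * W x)))"
  proof (intro sum.cong refl arg_cong[where f = "root ?s"])
    fix c assume "c \<in> ?I"
    then have "periodic k ?q (\<lambda>x. norm (F c x) ^ (2 * ?s) * W x)"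
      by (intro periodic_comp2[OF F(1) W(1)])
    from mean_average[OF q this \<Phi>] show "mean k ?q (G c) = mean k ?q (\<lambda>x. norm (F c x) ^ (2 * ?s) * W x)"
      unfolding G_def by simp
  qed
  finally show ?thesis .
qed

section \<open>Subarcs, linear substitutions and affine rescaling\<close>

definition cls :: "int \<Rightarrow> nat \<Rightarrow> nat \<Rightarrow> int \<Rightarrow> int set" where
  "cls p j a c0 = {c \<in> {0..<p ^ j}. p ^ a dvd c - c0}"

lemma finite_cls [simp]: "finite (cls p j a c0)"
  by (rule finite_subset[of _ "{0..<p ^ j}"]) (auto simp: cls_def)

lemma cls_subset: "cls p j a c0 \<subseteq> {0..<p ^ j}"
  unfolding cls_def by auto

lemma sum_cls_split:
  fixes g :: "int \<Rightarrow> 'a::comm_monoid_add"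
  assumes p: "p > 0" and a: "a \<le> a'" "a' \<le> j"
  shows "(\<Sum>c\<in>cls p j a c0. g c) = (\<Sum>J\<in>cls p a' a c0. \<Sum>c\<in>cls p j a' J. g c)"
proof -
  have pa: "p ^ a dvd p ^ a'" "p ^ a' > 0" using a p by (auto intro: le_imp_power_dvd)
  have d: "p ^ a dvd c mod p ^ a' - c0 \<longleftrightarrow> p ^ a dvd c - c0" for c
  proof -
    have "p ^ a dvd c - c mod p ^ a'" using pa by (metis dvd_trans dvd_minus_mod)
    then have "p ^ a dvd (c mod p ^ a' - c0) + (c - c mod p ^ a') \<longleftrightarrow> p ^ a dvd c mod p ^ a' - c0"
      by (rule dvd_add_left_iff)
    then show ?thesis by simp
  qed
  have "(\<Sum>c\<in>cls p j a c0. g c) = (\<Sum>J\<in>cls p a' a c0. sum g {c \<in> cls p j a c0. c mod p ^ a' = J})"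
    by (rule sum.group[symmetric, OF finite_cls finite_cls]) (use pa d in \<open>auto simp: cls_def\<close>)
  also have "\<dots> = (\<Sum>J\<in>cls p a' a c0. \<Sum>c\<in>cls p j a' J. g c)"
  proof (intro sum.cong refl)
    fix J assume J: "J \<in> cls p a' a c0"
    have "c mod p ^ a' = J \<longleftrightarrow> p ^ a' dvd c - J" for c
      using J by (auto simp: cls_def mod_eq_dvd_iff[symmetric])
    moreover have "p ^ a dvd c - c0" if "p ^ a' dvd c - J" for c
    proof -
      have "p ^ a dvd c - J" using that pa by (metis dvd_trans)
      moreover have "p ^ a dvd J - c0" using J by (auto simp: cls_def)
      ultimately have "p ^ a dvd (c - J) + (J - c0)" by (rule dvd_add)
      then show ?thesis by simp
    qed
    ultimately show "{c \<in> cls p j a c0. c mod p ^ a' = J} = cls p j a' J"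
      by (auto simp: cls_def)
  qed
  finally show ?thesis .
qed

lemma pcompose_power: "pcompose (f ^ n) g = pcompose f g ^ n" for f g :: "'a::comm_ring_1 poly"
  by (induction n) (simp_all add: pcompose_mult pcompose_1)

lemma smult_sum_right: "(\<Sum>i\<in>I. smult a (f i)) = smult a (\<Sum>i\<in>I. f i)"
  by (induction I rule: infinite_finite_induct) (simp_all add: smult_add_right)

lemma pcompose_as_sum:
  fixes v g :: "'a::comm_ring_1 poly"
  assumes "degree v \<le> k"
  shows "pcompose v g = (\<Sum>i\<le>k. smult (coeff v i) (g ^ i))"
proof -
  have "pcompose v g = (\<Sum>i\<le>degree v. smult (coeff v i) (g ^ i))"
    unfolding pcompose_altdef by (simp add: poly_altdef coeff_map_poly degree_map_poly)
  also have "\<dots> = (\<Sum>i\<le>k. smult (coeff v i) (g ^ i))"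
    by (rule sum.mono_neutral_left) (use assms in \<open>auto simp: coeff_eq_0\<close>)
  finally show ?thesis .
qed

lemma dvd_pcompose_minus_const:
  fixes v :: "int poly"
  assumes "\<And>m. 1 \<le> m \<Longrightarrow> q dvd coeff (pcompose v [:c, P:]) m"
  shows "[:q:] dvd pcompose v [:c, P:] - [:poly v c:]"
  unfolding const_poly_dvd_iff
proof
  fix n
  have "coeff (pcompose v [:c, P:]) 0 = poly v c"
    unfolding poly_0_coeff_0[symmetric] by (simp add: poly_pcompose)
  then show "q dvd coeff (pcompose v [:c, P:] - [:poly v c:]) n"
    using assms[of n] by (cases n) auto
qed

lemma smult_const_dvd: "[:a:] dvd f \<Longrightarrow> [:b * a:] dvd smult b (f :: int poly)"
  by (auto simp: const_poly_dvd_iff intro: mult_dvd_mono)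

text \<open>If \<open>\<Phi>\<close> carries one curve to the other modulo \<open>p ^ M\<close>, it
  carries the phases to each other. The factor \<open>p ^ (M - M')\<close> accounts for the two
  resolutions: it turns the denominator \<open>p ^ M\<close> into \<open>p ^ M'\<close>.\<close>

lemma covar_pull:
  fixes f :: "int poly \<Rightarrow> complex"
  assumes p: "p \<noteq> 0" and f: "covar p k M j c f" and M': "M' \<le> M"
    and add: "\<And>u v. \<Phi> (u + v) = \<Phi> u + \<Phi> v" and deg: "\<And>v. degree (\<Phi> v) \<le> k"
    and \<Phi>: "\<And>v. degree v \<le> l \<Longrightarrow>
      [:p ^ M:] dvd pcompose (\<Phi> v) [:c, p ^ j:] - smult (p ^ (M - M')) (pcompose v [:c', p ^ i:])"
  shows "covar p l M' i c' (\<lambda>z. f (x + \<Phi> z))"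
  unfolding covar_def
proof (intro allI impI)
  fix z v assume v: "degree v \<le> l" and d: "[:p ^ M':] dvd pcompose v [:c', p ^ i:] - [:poly v c':]"
  let ?N = "p ^ (M - M')"
  have "coeff (pcompose (\<Phi> v) [:c, p ^ j:] - smult ?N (pcompose v [:c', p ^ i:])) 0
      = poly (\<Phi> v) c - ?N * poly v c'"
    unfolding poly_0_coeff_0[symmetric] by (simp add: poly_pcompose)
  with \<Phi>[OF v] have d0: "p ^ M dvd poly (\<Phi> v) c - ?N * poly v c'"
    unfolding const_poly_dvd_iff by metis
  have "?N * p ^ M' = p ^ M" using M' by (simp add: power_add[symmetric])
  with smult_const_dvd[OF d, of ?N]
  have "[:p ^ M:] dvd smult ?N (pcompose v [:c', p ^ i:]) - [:?N * poly v c':]"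
    by (simp add: smult_diff_right)
  from dvd_add[OF \<Phi>[OF v] this]
  have "[:p ^ M:] dvd pcompose (\<Phi> v) [:c, p ^ j:] - [:?N * poly v c':]"
    by (simp only: diff_add_cancel add_diff_eq)
  moreover from d0 have "[:p ^ M:] dvd [:poly (\<Phi> v) c - ?N * poly v c':]" by simp
  ultimately have "[:p ^ M:] dvd (pcompose (\<Phi> v) [:c, p ^ j:] - [:?N * poly v c':])
      - [:poly (\<Phi> v) c - ?N * poly v c':]" by (rule dvd_diff)
  then have D: "[:p ^ M:] dvd pcompose (\<Phi> v) [:c, p ^ j:] - [:poly (\<Phi> v) c:]"
    by (simp only: diff_diff_eq add_pCons) simp
  have "f (x + \<Phi> (z + v)) = f ((x + \<Phi> z) + \<Phi> v)" by (simp add: add add.assoc)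
  also have "\<dots> = e (of_int (poly (\<Phi> v) c) / of_int (p ^ M)) * f (x + \<Phi> z)"
    using f deg D unfolding covar_def by blast
  also have "e (of_int (poly (\<Phi> v) c) / of_int (p ^ M)) = e (of_int (?N * poly v c') / of_int (p ^ M))"
    by (rule e_cong[OF d0]) (use p in simp)
  also have "of_int (?N * poly v c') / of_int (p ^ M) = (of_int (poly v c') / of_int (p ^ M') :: real)"
    using p M' by (simp add: field_simps power_add[symmetric])
  finally show "f (x + \<Phi> (z + v)) = e (of_int (poly v c') / of_int (p ^ M')) * f (x + \<Phi> z)" .
qed

lemma bij_betw_cls:
  assumes p: "p > 1" and b: "b \<le> j"
  shows "bij_betw (\<lambda>c'. c0 mod p ^ b + p ^ b * c') {0..<p ^ (j - b)} (cls p j b c0)"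
proof (rule bij_betw_byWitness[where f' = "\<lambda>c. c div p ^ b"])
  have pb: "p ^ b > 0" using p by simp
  have pj: "p ^ j = p ^ b * p ^ (j - b)" using b by (simp add: power_add[symmetric])
  have "p ^ b \<noteq> 0" using pb by linarith
  then show "\<forall>c'\<in>{0..<p ^ (j - b)}. (c0 mod p ^ b + p ^ b * c') div p ^ b = c'"
    by (intro ballI) (subst div_mult_self2, simp_all)
  have r: "0 \<le> c0 mod p ^ b" "c0 mod p ^ b < p ^ b" using pb by auto
  show "\<forall>c\<in>cls p j b c0. c0 mod p ^ b + p ^ b * (c div p ^ b) = c"
  proof
    fix c assume "c \<in> cls p j b c0"
    then have "c mod p ^ b = c0 mod p ^ b" by (simp add: cls_def mod_eq_dvd_iff)
    then show "c0 mod p ^ b + p ^ b * (c div p ^ b) = c" by (metis mod_mult_div_eq)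
  qed
  show "(\<lambda>c'. c0 mod p ^ b + p ^ b * c') ` {0..<p ^ (j - b)} \<subseteq> cls p j b c0"
  proof
    fix c assume "c \<in> (\<lambda>c'. c0 mod p ^ b + p ^ b * c') ` {0..<p ^ (j - b)}"
    then obtain c' where c'0: "c = c0 mod p ^ b + p ^ b * c'" "c' \<in> {0..<p ^ (j - b)}" by blast
    then have c': "c = c0 mod p ^ b + p ^ b * c'" "0 \<le> c'" "c' + 1 \<le> p ^ (j - b)" by simp_all
    have "p ^ b * (c' + 1) \<le> p ^ j" unfolding pj using c' pb by (intro mult_left_mono) auto
    then have "c < p ^ j" using c'(1) r by (simp add: algebra_simps)
    moreover have "0 \<le> c" using c' r pb by simp
    moreover have "p ^ b dvd c - c0" unfolding c'(1) by (simp add: mod_eq_dvd_iff[symmetric])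
    ultimately show "c \<in> cls p j b c0" by (simp add: cls_def)
  qed
  show "(\<lambda>c. c div p ^ b) ` cls p j b c0 \<subseteq> {0..<p ^ (j - b)}"
  proof
    fix y assume "y \<in> (\<lambda>c. c div p ^ b) ` cls p j b c0"
    then obtain c where c: "y = c div p ^ b" "0 \<le> c" "c < p ^ b * p ^ (j - b)"
      by (auto simp: cls_def pj)
    have "p ^ b * y = c - c mod p ^ b" unfolding c(1) by (rule minus_mod_eq_mult_div[symmetric])
    moreover have "0 \<le> c mod p ^ b" using pb by (rule pos_mod_sign)
    ultimately have "p ^ b * y < p ^ b * p ^ (j - b)" using c(3) by linarith
    then have "y < p ^ (j - b)" using pb by (simp add: mult_less_cancel_left_pos)
    moreover have "0 \<le> y" using c pb by (simp add: pos_imp_zdiv_nonneg_iff)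
    ultimately show "y \<in> {0..<p ^ (j - b)}" by simp
  qed
qed

text \<open>An affine change of variable maps the arc of length p^-b at \<open>c0\<close> to the
  whole curve, after which only \<open>j - b\<close> scales are left. It uses up
  \<open>k * b\<close> of the resolution, which \<open>k * j \<le> M\<close> affords.\<close>

lemma dec_rescale:
  fixes f :: "int \<Rightarrow> int poly \<Rightarrow> complex"
  assumes p: "p > 1" and k: "k \<ge> 1" and D: "dec p k (j - b) D" "D \<ge> 0" and b: "b \<le> j" and M: "k * j \<le> M"
    and f: "\<And>c. c \<in> {0..<p ^ j} \<Longrightarrow> covar p k M j c (f c)"
  shows "moment k (p ^ M) (sK k) (\<lambda>x. \<Sum>c\<in>cls p j b c0. f c x) \<le>
    D * (\<Sum>c\<in>cls p j b c0. root (sK k) (moment k (p ^ M) (sK k) (f c))) ^ sK k"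
proof -
  define r where "r = c0 mod p ^ b"
  define \<phi> where "\<phi> = (\<lambda>c'. r + p ^ b * c')"
  have bij: "bij_betw \<phi> {0..<p ^ (j - b)} (cls p j b c0)"
    unfolding \<phi>_def r_def by (rule bij_betw_cls[OF p b])
  have re: "(\<Sum>c\<in>cls p j b c0. g c) = (\<Sum>c'\<in>{0..<p ^ (j - b)}. g (\<phi> c'))"
    for g :: "int \<Rightarrow> 'a::comm_monoid_add"
    by (rule sum.reindex_bij_betw[OF bij, symmetric])
  \<comment> \<open>This is \<open>z\<close> evaluated at \<open>(S - r) / p ^ b\<close>, multiplied
    by \<open>p ^ (k * b)\<close> to keep the coefficients integral.\<close>
  define \<Phi> where "\<Phi> = (\<lambda>z. \<Sum>i\<le>k. smult (coeff z i * p ^ ((k - i) * b)) ([:-r, 1:] ^ i))"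
  have deg: "degree (\<Phi> z) \<le> k" for z
    unfolding \<Phi>_def by (intro degree_sum_le) (auto intro!: order_trans[OF degree_smult_le] order_trans[OF degree_power_le])
  have add: "\<Phi> (u + v) = \<Phi> u + \<Phi> v" for u v
    unfolding \<Phi>_def by (simp add: sum.distrib[symmetric] smult_add_left[symmetric] algebra_simps)
  have comp: "pcompose (\<Phi> v) [:\<phi> c', p ^ j:] = smult (p ^ (k * b)) (pcompose v [:c', p ^ (j - b):])"
    if v: "degree v \<le> k" for v c'
  proof -
    have 1: "pcompose ([:-r, 1:] ^ i) [:\<phi> c', p ^ j:] = smult (p ^ (b * i)) ([:c', p ^ (j - b):] ^ i)" for i
    proof -
      have "pcompose [:-r, 1:] [:\<phi> c', p ^ j:] = smult (p ^ b) [:c', p ^ (j - b):]"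
        using b by (simp add: pcompose_pCons \<phi>_def power_add[symmetric])
      then have "pcompose ([:-r, 1:] ^ i) [:\<phi> c', p ^ j:] = (smult (p ^ b) [:c', p ^ (j - b):]) ^ i"
        by (simp only: pcompose_power)
      then show ?thesis by (simp only: smult_power power_mult)
    qed
    have "pcompose (\<Phi> v) [:\<phi> c', p ^ j:] =
      (\<Sum>i\<le>k. smult (coeff v i * p ^ ((k - i) * b)) (smult (p ^ (b * i)) ([:c', p ^ (j - b):] ^ i)))"
      unfolding \<Phi>_def by (simp add: pcompose_sum pcompose_smult 1)
    also have "\<dots> = (\<Sum>i\<le>k. smult (p ^ (k * b)) (smult (coeff v i) ([:c', p ^ (j - b):] ^ i)))"
    proof (intro sum.cong refl)
      fix i assume "i \<in> {..k}"
      then have "(k - i) * b + b * i = k * b" by (simp add: algebra_simps diff_mult_distrib)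
      then have "p ^ ((k - i) * b) * p ^ (b * i) = p ^ (k * b)" by (simp only: power_add[symmetric])
      then show "smult (coeff v i * p ^ ((k - i) * b)) (smult (p ^ (b * i)) ([:c', p ^ (j - b):] ^ i)) =
        smult (p ^ (k * b)) (smult (coeff v i) ([:c', p ^ (j - b):] ^ i))"
        by (simp only: smult_smult mult.assoc) (simp only: mult.commute)
    qed
    also have "\<dots> = smult (p ^ (k * b)) (pcompose v [:c', p ^ (j - b):])"
      unfolding pcompose_as_sum[OF v] by (rule smult_sum_right)
    finally show ?thesis .
  qed
  have kb: "k * b \<le> M" "k * (j - b) \<le> M - k * b"
    using M b by (auto simp: diff_mult_distrib2 intro: order_trans[OF mult_le_mono2[OF b]])
  have "mean k (p ^ M) (\<lambda>x. norm (\<Sum>c'\<in>{0..<p ^ (j - b)}. f (\<phi> c') x) ^ (2 * sK k) * 1) \<le>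
    D * (\<Sum>c'\<in>{0..<p ^ (j - b)}. root (sK k) (mean k (p ^ M) (\<lambda>x. norm (f (\<phi> c') x) ^ (2 * sK k) * 1))) ^ sK k"
  proof (rule dec_transfer[OF p D k kb(2) deg])
    fix c' assume c': "c' \<in> {0..<p ^ (j - b)}"
    then have "\<phi> c' \<in> {0..<p ^ j}" using bij cls_subset by (meson bij_betwE subsetD)
    from f[OF this] have F: "covar p k M j (\<phi> c') (f (\<phi> c'))" .
    then show "periodic k (p ^ M) (f (\<phi> c'))" by (rule covar_periodic) (use p in simp)
    show "covar p k (M - k * b) (j - b) c' (\<lambda>z. f (\<phi> c') (x + \<Phi> z))" for x
      by (rule covar_pull[OF _ F _ add deg]) (use p kb in \<open>simp_all add: comp\<close>)
  qed (auto simp: periodic_def)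
  then show ?thesis unfolding re moment_def by simp
qed

section \<open>Hermite interpolation at two points modulo a prime power\<close>

lemma inverse_mod_prime_power:
  fixes p n :: int
  assumes "prime p" "\<not> p dvd n"
  obtains n' where "p ^ N dvd n * n' - 1"
proof -
  have "coprime (p ^ N) n" using assms by (simp add: prime_imp_coprime)
  then have "coprime n (p ^ N)" by (simp add: coprime_commute)
  then obtain n' where "[n * n' = 1] (mod p ^ N)" using cong_solve_coprime_int by blast
  then show ?thesis using that by (simp add: cong_iff_dvd_diff)
qed

text \<open>Integrating \<open>i S\<^bsup>i-1\<^esup> (1 + S/e)\<^bsup>r-1\<^esup>\<close> gives a polynomial that starts with \<open>S\<^bsup>i\<^esup>\<close> at \<open>0\<close> and is
  constant to order \<open>r\<close> at \<open>-e\<close>; the primes \<open>p > k\<close> make the integration possible modulo \<open>p\<^bsup>N\<^esup>\<close>.\<close>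

lemma two_point_poly_aux:
  fixes p e :: int
  assumes p: "prime p" "p > int k" and lr: "i - 1 + r \<le> k" and i: "1 \<le> i" and r: "1 \<le> r" and e: "\<not> p dvd e"
  obtains w where "degree w \<le> k"
    "\<And>m. m < i \<Longrightarrow> p ^ N dvd coeff w m" "p ^ N dvd coeff w i - 1"
    "\<And>m. 1 \<le> m \<Longrightarrow> m < r \<Longrightarrow> p ^ N dvd coeff (pcompose w [:-e, 1:]) m"
proof -
  define Q where "Q = p ^ N"
  obtain es where es: "Q dvd e * es - 1" unfolding Q_def using inverse_mod_prime_power[OF p(1) e] by blast
  have ndvd: "\<not> p dvd int n" if "1 \<le> n" "n \<le> k" for n
    using that p by (intro zdvd_not_zless) auto
  have "\<exists>n'. p ^ N dvd int n * n' - 1" if "1 \<le> n" "n \<le> k" for n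
    using inverse_mod_prime_power[OF p(1) ndvd[OF that]] by blast
  then obtain iv where iv: "\<And>n. 1 \<le> n \<Longrightarrow> n \<le> k \<Longrightarrow> Q dvd int n * iv n - 1" unfolding Q_def by metis
  define g where "g = smult (int i) (monom 1 (i - 1) * [:1, es:] ^ (r - 1))"
  have dg: "degree g \<le> k - 1"
  proof -
    have "degree (monom (1::int) (i - 1) * [:1, es:] ^ (r - 1)) \<le> (i - 1) + (r - 1)"
      by (intro order_trans[OF degree_mult_le] add_mono degree_monom_le order_trans[OF degree_power_le]) auto
    also have "\<dots> \<le> k - 1" using lr r by linarith
    finally show ?thesis unfolding g_def by (intro order_trans[OF degree_smult_le])
  qed
  have k: "k \<ge> 1" using lr r by linarith
  define w where "w = (\<Sum>n\<in>{1..k}. monom (coeff g (n - 1) * iv n) n)"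
  have cw: "coeff w m = (if 1 \<le> m \<and> m \<le> k then coeff g (m - 1) * iv m else 0)" for m
    unfolding w_def by (simp add: coeff_sum)
  have dw: "degree w \<le> k" by (rule degree_le) (auto simp: cw)
  have cg: "coeff g m = 0" if "m < i - 1" for m using that by (simp add: g_def coeff_monom_mult)
  have cgi: "coeff g (i - 1) = int i" 
    by (simp add: g_def coeff_monom_mult poly_0_coeff_0[symmetric])
  have 1: "Q dvd coeff w m" if "m < i" for m
    using that cg[of "m - 1"] by (cases "m = 0") (auto simp: cw)
  have 2: "Q dvd coeff w i - 1"
  proof -
    have ik: "i \<le> k" using lr r i by linarith
    show ?thesis using iv[OF i ik] unfolding cw cgi using i ik by simp
  qed
  have diff: "[:Q:] dvd pderiv w - g"
    unfolding const_poly_dvd_iff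
  proof
    fix n
    show "Q dvd coeff (pderiv w - g) n"
    proof (cases "n < k")
      case True
      have "coeff (pderiv w - g) n = coeff g n * (int (Suc n) * iv (Suc n) - 1)"
        using True by (simp add: coeff_pderiv cw algebra_simps)
      then show ?thesis using iv[of "Suc n"] True by simp
    next
      case False
      then have "coeff g n = 0" using dg k by (intro coeff_eq_0) linarith
      then show ?thesis using False by (simp add: coeff_pderiv cw)
    qed
  qed
  let ?L = "[:-e, 1:]"
  have "[:Q:] dvd pcompose [:1, es:] ?L - [:0, es:]"
    using es by (simp add: pcompose_pCons const_poly_dvd_iff coeff_pCons dvd_diff_commute algebra_simps split: nat.split)
  also have "pcompose [:1, es:] ?L - [:0, es:] dvd pcompose [:1, es:] ?L ^ (r - 1) - [:0, es:] ^ (r - 1)"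
    unfolding power_diff_sumr2 by simp
  finally have d1: "[:Q:] dvd pcompose [:1, es:] ?L ^ (r - 1) - [:0, es:] ^ (r - 1)" .
  define h where "h = smult (int i) (pcompose (monom 1 (i - 1)) ?L)"
  have pg: "pcompose g ?L = h * pcompose [:1, es:] ?L ^ (r - 1)"
    by (simp add: g_def h_def pcompose_smult pcompose_mult pcompose_power)
  have "[:Q:] dvd pcompose (pderiv w - g) ?L" by (rule dvd_pcompose[OF diff])
  moreover have "[:Q:] dvd h * (pcompose [:1, es:] ?L ^ (r - 1) - [:0, es:] ^ (r - 1))"
    by (rule dvd_mult[OF d1])
  ultimately have "[:Q:] dvd pcompose (pderiv w - g) ?L + h * (pcompose [:1, es:] ?L ^ (r - 1) - [:0, es:] ^ (r - 1))"
    by (rule dvd_add)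
  also have "pcompose (pderiv w - g) ?L + h * (pcompose [:1, es:] ?L ^ (r - 1) - [:0, es:] ^ (r - 1))
     = pderiv (pcompose w ?L) - h * [:0, es:] ^ (r - 1)"
    by (simp add: pcompose_diff pg pderiv_pcompose pderiv_pCons right_diff_distrib)
  finally have d2: "[:Q:] dvd pderiv (pcompose w ?L) - h * [:0, es:] ^ (r - 1)" .
  have e3: "h * [:0, es:] ^ (r - 1) = monom (es ^ (r - 1)) (r - 1) * h"
  proof -
    have "[:0, es:] = monom es 1" by (simp add: monom_altdef)
    then show ?thesis by (simp add: monom_power mult.commute)
  qed
  have 3: "Q dvd coeff (pcompose w ?L) m" if m: "1 \<le> m" "m < r" for m
  proof -
    have "coeff (h * [:0, es:] ^ (r - 1)) (m - 1) = 0" unfolding e3 coeff_monom_mult using m by auto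
    with d2 have "Q dvd coeff (pderiv (pcompose w ?L)) (m - 1)"
      unfolding const_poly_dvd_iff by (metis coeff_diff diff_zero)
    then have "p ^ N dvd int m * coeff (pcompose w ?L) m" using m by (simp add: coeff_pderiv Q_def)
    moreover have "coprime (p ^ N) (int m)"
      using ndvd[of m] m lr i p(1) by (simp add: prime_imp_coprime)
    ultimately show ?thesis unfolding Q_def using coprime_dvd_mult_right_iff by blast
  qed
  show ?thesis using that[of w] dw 1 2 3 unfolding Q_def by blast
qed

text \<open>There are \<open>l + 1\<close> conditions at 0 and \<open>r - 1\<close> at
  \<open>-e\<close>, where the value itself is left free; since \<open>l + r = k + 1\<close>, they
  are as many as the coefficients. The induction descends in \<open>i\<close>: the polynomial of
  \<open>two_point_poly_aux\<close> is right up to order \<open>i\<close>, and the interpolants of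
  higher index clear its coefficients from \<open>i + 1\<close> to \<open>l\<close>.\<close>

lemma two_point_poly:
  fixes p e :: int
  assumes p: "prime p" "p > int k" and lr: "l + r = k + 1" and r: "1 \<le> r" and e: "\<not> p dvd e" and i: "i \<le> l"
  shows "\<exists>w. degree w \<le> k \<and> (\<forall>m\<le>l. p ^ N dvd coeff w m - (if m = i then 1 else 0)) \<and>
    (\<forall>m. 1 \<le> m \<longrightarrow> m < r \<longrightarrow> p ^ N dvd coeff (pcompose w [:-e, 1:]) m)"
  using i
proof (induction "l - i" arbitrary: i rule: less_induct)
  case less
  show ?case
  proof (cases "i = 0")
    case True
    then show ?thesis by (intro exI[of _ 1]) (auto simp: pcompose_1)
  next
    case False
    have ir: "i - 1 + r \<le> k" and i1: "1 \<le> i" using False less.prems lr by linarith+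
    obtain w where w: "degree w \<le> k" "\<And>m. m < i \<Longrightarrow> p ^ N dvd coeff w m" "p ^ N dvd coeff w i - 1"
      "\<And>m. 1 \<le> m \<Longrightarrow> m < r \<Longrightarrow> p ^ N dvd coeff (pcompose w [:-e, 1:]) m"
      by (rule two_point_poly_aux[OF p ir i1 r e, of N]) (rule that)
    have "\<forall>n. \<exists>u. i < n \<and> n \<le> l \<longrightarrow> degree u \<le> k \<and> (\<forall>m\<le>l. p ^ N dvd coeff u m - (if m = n then 1 else 0)) \<and>
    (\<forall>m. 1 \<le> m \<longrightarrow> m < r \<longrightarrow> p ^ N dvd coeff (pcompose u [:-e, 1:]) m)"
      using less.hyps by (metis diff_less_mono2 order_less_le_trans)
    from choice[OF this] obtain u where u0: "\<And>n. i < n \<and> n \<le> l \<longrightarrow> degree (u n) \<le> k \<and>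
      (\<forall>m\<le>l. p ^ N dvd coeff (u n) m - (if m = n then 1 else 0)) \<and>
      (\<forall>m. 1 \<le> m \<longrightarrow> m < r \<longrightarrow> p ^ N dvd coeff (pcompose (u n) [:-e, 1:]) m)" by blast
    have u: "\<And>n. i < n \<Longrightarrow> n \<le> l \<Longrightarrow> degree (u n) \<le> k"
      "\<And>n m. i < n \<Longrightarrow> n \<le> l \<Longrightarrow> m \<le> l \<Longrightarrow> p ^ N dvd coeff (u n) m - (if m = n then 1 else 0)"
      "\<And>n m. i < n \<Longrightarrow> n \<le> l \<Longrightarrow> 1 \<le> m \<Longrightarrow> m < r \<Longrightarrow> p ^ N dvd coeff (pcompose (u n) [:-e, 1:]) m"
      using u0 by blast+
    define v where "v = w - (\<Sum>n\<in>{i<..l}. smult (coeff w n) (u n))"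
    have "degree v \<le> k" unfolding v_def
      by (intro degree_diff_le w degree_sum_le) (auto intro!: order_trans[OF degree_smult_le] u)
    moreover have "p ^ N dvd coeff v m - (if m = i then 1 else 0)" if m: "m \<le> l" for m
    proof -
      define t where "t = (\<Sum>n\<in>{i<..l}. coeff w n * (coeff (u n) m - (if m = n then 1 else 0)))"
      have t: "p ^ N dvd t" unfolding t_def using u(2) m by (intro dvd_sum dvd_mult) auto
      have "(\<Sum>n\<in>{i<..l}. coeff w n * (if m = n then 1 else 0)) = (\<Sum>n\<in>{i<..l}. if m = n then coeff w n else 0)"
        by (intro sum.cong) auto
      also have "\<dots> = (if i < m then coeff w m else 0)" using m by (simp add: sum.delta')
      finally have s: "(\<Sum>n\<in>{i<..l}. coeff w n * (if m = n then 1 else 0)) = (if i < m then coeff w m else 0)" .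
      have "t = (\<Sum>n\<in>{i<..l}. coeff w n * coeff (u n) m) - (if i < m then coeff w m else 0)"
        unfolding t_def right_diff_distrib sum_subtractf s ..
      then have "coeff v m = coeff w m - (if i < m then coeff w m else 0) - t"
        unfolding v_def by (simp add: coeff_sum)
      then have "coeff v m - (if m = i then 1 else 0) =
        ((coeff w m - (if i < m then coeff w m else 0)) - (if m = i then 1 else 0)) - t" by simp
      moreover have "p ^ N dvd (coeff w m - (if i < m then coeff w m else 0)) - (if m = i then 1 else 0)"
      proof (cases m i rule: linorder_cases)
        case less
        from w(2)[OF this] less show ?thesis by simp
      next
        case equal
        with w(3) show ?thesis by simp
      next
        case greater
        then show ?thesis by simp
      qed
      ultimately show ?thesis using t by (simp only: dvd_diff)
    qed
    moreover have "p ^ N dvd coeff (pcompose v [:-e, 1:]) m" if m: "1 \<le> m" "m < r" for m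
    proof -
      have "coeff (pcompose v [:-e, 1:]) m = coeff (pcompose w [:-e, 1:]) m -
        (\<Sum>n\<in>{i<..l}. coeff w n * coeff (pcompose (u n) [:-e, 1:]) m)"
        unfolding v_def by (simp add: pcompose_diff pcompose_sum pcompose_smult coeff_sum)
      also have "p ^ N dvd \<dots>" using u(3) m
        by (intro dvd_diff dvd_sum dvd_mult w(4)) auto
      finally show ?thesis .
    qed
    ultimately show ?thesis by blast
  qed
qed

lemma coeff_pcompose_scale: "coeff (pcompose g [:0, P:]) m = coeff g m * P ^ m" for g :: "int poly"
proof -
  have "pcompose g [:0, P:] = (\<Sum>i\<le>degree g. smult (coeff g i) (monom P 1 ^ i))"
    by (simp add: pcompose_as_sum[OF order_refl] monom_altdef)
  then have "coeff (pcompose g [:0, P:]) m = (\<Sum>i\<le>degree g. if i = m then coeff g i * P ^ i else 0)"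
    by (simp add: coeff_sum monom_power if_distrib[of "\<lambda>x. _ * x"] cong: if_cong)
  then show ?thesis by (auto simp: coeff_eq_0)
qed

text \<open>\<open>V z\<close> follows \<open>z\<close> to order \<open>l\<close> at
  \<open>c0\<close> and is flat to order \<open>r\<close> at \<open>c1\<close>. On the arc of length
  p^-a at \<open>c0\<close> the error starts at order \<open>l + 1\<close>, hence is divisible by
  \<open>p ^ ((l + 1) * a)\<close>; on the arc of length p^-b at \<open>c1\<close> the variation
  starts at order \<open>r\<close>, hence is divisible by \<open>p ^ (r * b)\<close>. This explains
  the two bounds on \<open>N\<close>. Transversality is what makes the interpolation solvable modulo
  powers of \<open>p\<close>.\<close>

lemma lower_transversal_map:
  fixes p c0 c1 :: int
  assumes p: "prime p" "p > int k" and lr: "l + r = k + 1" and r: "1 \<le> r" and e: "\<not> p dvd c0 - c1"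
    and Na: "N \<le> (l + 1) * a" and Nb: "N \<le> r * b"
  obtains V where "\<And>z. degree (V z) \<le> k" "\<And>u v. V (u + v) = V u + V v"
    "\<And>v c a'. degree v \<le> l \<Longrightarrow> a \<le> a' \<Longrightarrow> p ^ a dvd c - c0 \<Longrightarrow>
       [:p ^ N:] dvd pcompose (V v) [:c, p ^ a':] - pcompose v [:c, p ^ a':]"
    "\<And>v. [:p ^ N:] dvd pcompose (V v) [:c1, p ^ b:] - [:poly (V v) c1:]"
proof -
  define ee where "ee = c0 - c1"
  have "\<forall>i. \<exists>w. i \<le> l \<longrightarrow> degree w \<le> k \<and> (\<forall>m\<le>l. p ^ N dvd coeff w m - (if m = i then 1 else 0)) \<and>
    (\<forall>m. 1 \<le> m \<longrightarrow> m < r \<longrightarrow> p ^ N dvd coeff (pcompose w [:-ee, 1:]) m)"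
    using two_point_poly[OF p lr r] e unfolding ee_def by blast
  then obtain w where w: "\<And>i. i \<le> l \<Longrightarrow> degree (w i) \<le> k"
    "\<And>i m. i \<le> l \<Longrightarrow> m \<le> l \<Longrightarrow> p ^ N dvd coeff (w i) m - (if m = i then 1 else 0)"
    "\<And>i m. i \<le> l \<Longrightarrow> 1 \<le> m \<Longrightarrow> m < r \<Longrightarrow> p ^ N dvd coeff (pcompose (w i) [:-ee, 1:]) m"
    by metis
  define t where "t = (\<lambda>z i. coeff (pcompose z [:c0, 1:]) i)"
  \<comment> \<open>The Taylor expansion of \<open>z\<close> at \<open>c0\<close>, with the power
    \<open>i\<close> of \<open>S - c0\<close> replaced by the interpolant \<open>w i\<close> at
    \<open>S - c0\<close>.\<close>
  define V where "V = (\<lambda>z. \<Sum>i\<le>l. smult (t z i) (pcompose (w i) [:-c0, 1:]))"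
  show ?thesis
  proof (rule that[of V])
    show "degree (V z) \<le> k" for z
    proof -
      have "degree (pcompose (w i) [:-c0, 1:]) \<le> k" if "i \<le> l" for i
        using w(1)[OF that] by (simp add: degree_pcompose)
      then show ?thesis unfolding V_def
        by (intro degree_sum_le) (auto intro!: order_trans[OF degree_smult_le])
    qed
    show "V (u + v) = V u + V v" for u v
      unfolding V_def t_def by (simp add: pcompose_add smult_add_left sum.distrib)
    show "[:p ^ N:] dvd pcompose (V v) [:c, p ^ a':] - pcompose v [:c, p ^ a':]"
      if v: "degree v \<le> l" and a': "a \<le> a'" and c: "p ^ a dvd c - c0" for v c a'
    proof -
      define B where "B = [:c - c0, p ^ a':]"
      have B: "pcompose [:-c0, 1:] [:c, p ^ a':] = B" unfolding B_def by (simp add: pcompose_pCons)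
      have "degree (pcompose v [:c0, 1:]) \<le> l" using v by (simp add: degree_pcompose)
      moreover have "pcompose [:c0, 1:] [:-c0, 1:] = [:0, 1:]" by (simp add: pcompose_pCons)
      ultimately have v1: "v = (\<Sum>i\<le>l. smult (t v i) ([:-c0, 1:] ^ i))"
        unfolding t_def by (subst pcompose_as_sum[symmetric]) (auto simp: pcompose_assoc[symmetric])
      have v2: "pcompose v [:c, p ^ a':] = (\<Sum>i\<le>l. smult (t v i) (B ^ i))"
        by (subst v1) (simp only: pcompose_sum pcompose_smult pcompose_power B)
      have "pcompose (V v) [:c, p ^ a':] = (\<Sum>i\<le>l. smult (t v i) (pcompose (w i) B))"
        unfolding V_def by (simp only: pcompose_sum pcompose_smult pcompose_assoc[symmetric] B)
      then have eq: "pcompose (V v) [:c, p ^ a':] - pcompose v [:c, p ^ a':] =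
        (\<Sum>i\<le>l. smult (t v i) (pcompose (w i) B - B ^ i))"
        by (simp add: v2 sum_subtractf smult_diff_right)
      have "[:p ^ N:] dvd pcompose (w i) B - B ^ i" if i: "i \<le> l" for i
      proof -
        have ik: "i \<le> k" using i lr r by linarith
        have "B ^ i = (\<Sum>m\<le>k. smult (if m = i then 1 else 0) (B ^ m))"
          using ik by (simp add: if_distrib[of "\<lambda>x. smult x _"] cong: if_cong)
        then have "pcompose (w i) B - B ^ i = (\<Sum>m\<le>k. smult (coeff (w i) m - (if m = i then 1 else 0)) (B ^ m))"
          by (simp only: pcompose_as_sum[OF w(1)[OF i]] sum_subtractf[symmetric] smult_diff_left[symmetric])
        also have "[:p ^ N:] dvd \<dots>"
        proof (rule dvd_sum)
          fix m assume "m \<in> {..k}"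
          show "[:p ^ N:] dvd smult (coeff (w i) m - (if m = i then 1 else 0)) (B ^ m)"
          proof (cases "m \<le> l")
            case True
            show ?thesis using w(2)[OF i True] by (simp add: const_poly_dvd_iff)
          next
            case False
            have "[:p ^ a:] dvd B"
              using c a' by (auto simp: B_def const_poly_dvd_iff coeff_pCons le_imp_power_dvd split: nat.split)
            then have "[:p ^ a:] ^ m dvd B ^ m" by (rule dvd_power_same)
            then have "[:p ^ (a * m):] dvd B ^ m" by (simp add: poly_const_pow power_mult)
            moreover have "N \<le> a * m" using Na False by (metis Suc_eq_plus1 le_trans mult.commute mult_le_mono2 not_less_eq_eq)
            then have "[:p ^ N:] dvd [:p ^ (a * m):]" by (simp add: le_imp_power_dvd)
            ultimately show ?thesis by (meson dvd_smult dvd_trans)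
          qed
        qed
        finally show ?thesis .
      qed
      then show ?thesis unfolding eq by (intro dvd_sum dvd_smult) auto
    qed
    show "[:p ^ N:] dvd pcompose (V v) [:c1, p ^ b:] - [:poly (V v) c1:]" for v
    proof (rule dvd_pcompose_minus_const)
      fix m :: nat assume m: "1 \<le> m"
      have "p ^ N dvd coeff (pcompose (w i) [:-ee, p ^ b:]) m" if i: "i \<le> l" for i
      proof -
        have "pcompose [:-ee, 1:] [:0, p ^ b:] = [:-ee, p ^ b:]" by (simp add: pcompose_pCons)
        then have "pcompose (w i) [:-ee, p ^ b:] = pcompose (pcompose (w i) [:-ee, 1:]) [:0, p ^ b:]"
          by (simp add: pcompose_assoc[symmetric])
        then have eq: "coeff (pcompose (w i) [:-ee, p ^ b:]) m = coeff (pcompose (w i) [:-ee, 1:]) m * (p ^ b) ^ m"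
          by (simp add: coeff_pcompose_scale)
        show ?thesis
        proof (cases "m < r")
          case True
          then show ?thesis unfolding eq using w(3)[OF i m] by simp
        next
          case False
          then have "N \<le> b * m" using Nb by (metis le_trans mult.commute mult_le_mono2 not_less)
          then have "p ^ N dvd (p ^ b) ^ m" by (simp add: power_mult[symmetric] le_imp_power_dvd)
          then show ?thesis unfolding eq by simp
        qed
      qed
      moreover have "pcompose (V v) [:c1, p ^ b:] = (\<Sum>i\<le>l. smult (t v i) (pcompose (w i) [:-ee, p ^ b:]))"
        unfolding V_def ee_def by (simp add: pcompose_sum pcompose_smult pcompose_assoc[symmetric] pcompose_pCons)
      ultimately show "p ^ N dvd coeff (pcompose (V v) [:c1, p ^ b:]) m"
        by (auto simp: coeff_sum intro!: dvd_sum)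
    qed
  qed
qed

section \<open>Bilinear estimates\<close>

definition block :: "int \<Rightarrow> nat \<Rightarrow> nat \<Rightarrow> int \<Rightarrow> (int \<Rightarrow> int poly \<Rightarrow> complex) \<Rightarrow> int poly \<Rightarrow> complex" where
  "block p j a c0 f = (\<lambda>x. \<Sum>c\<in>cls p j a c0. f c x)"

text \<open>Each summand is the square of the norm of \<open>f c\<close> with exponent
  \<open>2 * sK k\<close>, as in l^2 decoupling. Energies add up exactly over subarcs
  (\<open>energy_split\<close>), so decoupling in several stages loses only the product of the
  constants.\<close>

definition energy :: "int \<Rightarrow> nat \<Rightarrow> nat \<Rightarrow> nat \<Rightarrow> nat \<Rightarrow> int \<Rightarrow> (int \<Rightarrow> int poly \<Rightarrow> complex) \<Rightarrow> real" where
  "energy p k M j a c0 f = (\<Sum>c\<in>cls p j a c0. root (sK k) (moment k (p ^ M) (sK k) (f c)))"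

lemma energy_nonneg [simp]: "0 \<le> energy p k M j a c0 f"
  unfolding energy_def by (intro sum_nonneg) (cases "sK k = 0", auto)

lemma block_covar:
  assumes p: "p > 0" and f: "\<And>c. c \<in> {0..<p ^ j} \<Longrightarrow> covar p k M j c (f c)" and a: "a \<le> j"
  shows "covar p k M a c0 (block p j a c0 f)"
  unfolding block_def
proof (rule covar_sum)
  fix c assume c: "c \<in> cls p j a c0"
  show "covar p k M a c0 (f c)"
    by (rule covar_mono[OF _ f a]) (use c p in \<open>auto simp: cls_def\<close>)
qed

lemma block_split:
  assumes "p > 0" "a \<le> a'" "a' \<le> j"
  shows "block p j a c0 f x = (\<Sum>J\<in>cls p a' a c0. block p j a' J f x)"
  unfolding block_def using sum_cls_split[OF assms] .

lemma energy_split: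
  assumes "p > 0" "a \<le> a'" "a' \<le> j"
  shows "energy p k M j a c0 f = (\<Sum>J\<in>cls p a' a c0. energy p k M j a' J f)"
  unfolding energy_def using sum_cls_split[OF assms] .

text \<open>An arc of length p^-a agrees with a curve of degree \<open>l\<close> up to p^-((l+1)a),
  and decoupling that curve into arcs of length p^-a' tolerates an error of p^-(la'); this is
  \<open>la\<close>. By \<open>lb\<close> the shifts in use leave the modulus of \<open>G\<close>
  unchanged, so that it can serve as the weight in \<open>dec_transfer\<close>.\<close>

lemma lower_decoupling:
  assumes p: "prime p" "p > int k" and l: "1 \<le> l" "l \<le> k" and D: "dec p l a' D" "D \<ge> 0"
    and a: "a \<le> a'" "a' \<le> j" and la: "l * a' \<le> (l + 1) * a" and lb: "l * a' \<le> (k - l + 1) * b"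
    and M: "k * j \<le> M" and c: "\<not> p dvd c0 - c1"
    and f: "\<And>c. c \<in> {0..<p ^ j} \<Longrightarrow> covar p k M j c (f c)" and G: "covar p k M b c1 G"
  shows "mean k (p ^ M) (\<lambda>x. norm (block p j a c0 f x) ^ (2 * sK l) * norm (G x) ^ n) \<le>
    D * (\<Sum>J\<in>cls p a' a c0. root (sK l) (mean k (p ^ M)
       (\<lambda>x. norm (block p j a' J f x) ^ (2 * sK l) * norm (G x) ^ n))) ^ sK l"
proof -
  have p1: "p > 1" using p(1) by (rule prime_gt_1_int)
  define N where "N = l * a'"
  define r where "r = k - l + 1"
  have r: "l + r = k + 1" "1 \<le> r" using l by (auto simp: r_def)
  have NM: "N \<le> M" unfolding N_def using M l(2) a(2) by (meson le_trans mult_le_mono)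
  obtain V where V: "\<And>z. degree (V z) \<le> k" "\<And>u v. V (u + v) = V u + V v"
    "\<And>v c a'. degree v \<le> l \<Longrightarrow> a \<le> a' \<Longrightarrow> p ^ a dvd c - c0 \<Longrightarrow>
       [:p ^ N:] dvd pcompose (V v) [:c, p ^ a':] - pcompose v [:c, p ^ a':]"
    "\<And>v. [:p ^ N:] dvd pcompose (V v) [:c1, p ^ b:] - [:poly (V v) c1:]"
    by (rule lower_transversal_map[OF p r c, of N a b]) (use la lb in \<open>auto simp: N_def r_def\<close>)
  define \<Phi> where "\<Phi> = (\<lambda>z. smult (p ^ (M - N)) (V z))"
  have pMN: "p ^ M = p ^ (M - N) * p ^ N" using NM by (simp add: power_add[symmetric])
  have deg: "degree (\<Phi> z) \<le> k" for z unfolding \<Phi>_def using V(1) by (intro order_trans[OF degree_smult_le])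
  have add: "\<Phi> (u + v) = \<Phi> u + \<Phi> v" for u v unfolding \<Phi>_def by (simp add: V(2) smult_add_right)
  \<comment> \<open>\<open>dec\<close> sums over all residues modulo \<open>p ^ a'\<close>; those
    outside the class of \<open>c0\<close> get the zero function.\<close>
  define F where "F = (\<lambda>J. if J \<in> cls p a' a c0 then block p j a' J f else (\<lambda>x. 0))"
  have F: "covar p k M a' J (F J)" for J
    unfolding F_def using block_covar[OF _ f a(2)] p1 by (auto intro: covar_zero)
  have GW: "norm (G (x + \<Phi> z)) = norm (G x)" for x z
  proof (rule covar_norm[OF G deg])
    have "[:p ^ (M - N) * p ^ N:] dvd smult (p ^ (M - N)) (pcompose (V z) [:c1, p ^ b:] - [:poly (V z) c1:])"
      by (rule smult_const_dvd[OF V(4)])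
    then show "[:p ^ M:] dvd pcompose (\<Phi> z) [:c1, p ^ b:] - [:poly (\<Phi> z) c1:]"
      by (simp add: \<Phi>_def pMN pcompose_smult smult_diff_right)
  qed
  have "mean k (p ^ M) (\<lambda>x. norm (\<Sum>J\<in>{0..<p ^ a'}. F J x) ^ (2 * sK l) * norm (G x) ^ n) \<le>
    D * (\<Sum>J\<in>{0..<p ^ a'}. root (sK l) (mean k (p ^ M) (\<lambda>x. norm (F J x) ^ (2 * sK l) * norm (G x) ^ n))) ^ sK l"
  proof (rule dec_transfer[OF p1 D l(1) _ deg])
    show "l * a' \<le> N" by (simp add: N_def)
    show "periodic k (p ^ M) (\<lambda>x. norm (G x) ^ n)"
      by (rule periodic_comp[OF covar_periodic[OF G]]) (use p1 in simp)
    show "periodic k (p ^ M) (F J)" for J by (rule covar_periodic[OF F]) (use p1 in simp)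
    show "covar p l N a' J (\<lambda>z. F J (x + \<Phi> z))" for J x
    proof (cases "J \<in> cls p a' a c0")
      case False
      then show ?thesis unfolding F_def by (simp add: covar_zero)
    next
      case True
      then have J: "p ^ a dvd J - c0" by (simp add: cls_def)
      show ?thesis
      proof (rule covar_pull[OF _ F NM add deg])
        fix v :: "int poly" assume v: "degree v \<le> l"
        have "[:p ^ (M - N) * p ^ N:] dvd smult (p ^ (M - N)) (pcompose (V v) [:J, p ^ a':] - pcompose v [:J, p ^ a':])"
          by (rule smult_const_dvd[OF V(3)[OF v a(1) J]])
        then show "[:p ^ M:] dvd pcompose (\<Phi> v) [:J, p ^ a':] - smult (p ^ (M - N)) (pcompose v [:J, p ^ a':])"
          by (simp add: \<Phi>_def pMN pcompose_smult smult_diff_right)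
      qed (use p1 in simp)
    qed
  qed (simp_all add: GW)
  moreover have "(\<Sum>J\<in>{0..<p ^ a'}. F J x) = block p j a c0 f x" for x
  proof -
    have "(\<Sum>J\<in>{0..<p ^ a'}. F J x) = (\<Sum>J\<in>cls p a' a c0. F J x)"
      by (rule sum.mono_neutral_right) (use cls_subset in \<open>auto simp: F_def\<close>)
    also have "\<dots> = (\<Sum>J\<in>cls p a' a c0. block p j a' J f x)" by (intro sum.cong) (auto simp: F_def)
    finally show ?thesis using block_split[OF _ a, of p c0 f x] p1 by simp
  qed
  moreover have "(\<Sum>J\<in>{0..<p ^ a'}. root (sK l) (mean k (p ^ M) (\<lambda>x. norm (F J x) ^ (2 * sK l) * norm (G x) ^ n)))
    = (\<Sum>J\<in>cls p a' a c0. root (sK l) (mean k (p ^ M) (\<lambda>x. norm (block p j a' J f x) ^ (2 * sK l) * norm (G x) ^ n)))"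
  proof (rule sum.mono_neutral_cong_right)
    show "\<forall>J\<in>{0..<p ^ a'} - cls p a' a c0.
      root (sK l) (mean k (p ^ M) (\<lambda>x. norm (F J x) ^ (2 * sK l) * norm (G x) ^ n)) = 0"
      using sK_pos[of l] l by (auto simp: F_def mean_def power_0_left)
  qed (use cls_subset in \<open>auto simp: F_def\<close>)
  ultimately show ?thesis by simp
qed

text \<open>The condition on \<open>c0 - c1\<close> makes the two pieces of the curve, of scales \<open>a\<close> and \<open>b\<close>, transversal.\<close>

definition bil :: "int \<Rightarrow> nat \<Rightarrow> nat \<Rightarrow> nat \<Rightarrow> nat \<Rightarrow> nat \<Rightarrow> real \<Rightarrow> bool" where
  "bil p k l j a b B \<longleftrightarrow> (\<forall>M f c0 c1. k * j \<le> M \<longrightarrow> (\<forall>c\<in>{0..<p ^ j}. covar p k M j c (f c)) \<longrightarrow> \<not> p dvd c0 - c1 \<longrightarrow>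
     mean k (p ^ M) (\<lambda>x. norm (block p j a c0 f x) ^ (2 * sK l) * norm (block p j b c1 f x) ^ (2 * (sK k - sK l))) \<le>
     B * energy p k M j a c0 f ^ sK l * energy p k M j b c1 f ^ (sK k - sK l))"

text \<open>Refining the first scale costs one constant of degree \<open>l\<close>. After taking the
  root of order \<open>sK l\<close>, the bilinear bounds for the subarcs add up through their
  energies, and the subarcs stay transversal to the second arc because
  \<open>a \<ge> 1\<close>.\<close>

lemma bil_lower_decoupling:
  assumes p: "prime p" "p > int k" and l: "1 \<le> l" "l \<le> k" and D: "dec p l a' D" "D \<ge> 0"
    and a: "a \<le> a'" "a' \<le> j" and b: "b \<le> j" and la: "l * a' \<le> (l + 1) * a" and lb: "l * a' \<le> (k - l + 1) * b"
    and B: "bil p k l j a' b B" "B \<ge> 0" and a0: "a \<ge> 1"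
  shows "bil p k l j a b (D * B)"
  unfolding bil_def
proof (intro allI impI)
  fix M f c0 c1
  assume M: "k * j \<le> M" and f: "\<forall>c\<in>{0..<p ^ j}. covar p k M j c (f c)" and c: "\<not> p dvd c0 - c1"
  have p1: "p > 1" using p(1) by (rule prime_gt_1_int)
  have s: "sK l > 0" using sK_pos l by simp
  let ?G = "block p j b c1 f" and ?n = "2 * (sK k - sK l)"
  let ?R = "B * energy p k M j b c1 f ^ (sK k - sK l)"
  have R0: "?R \<ge> 0" using B by simp
  have G: "covar p k M b c1 ?G" by (rule block_covar) (use p1 f b in auto)
  have "mean k (p ^ M) (\<lambda>x. norm (block p j a c0 f x) ^ (2 * sK l) * norm (?G x) ^ ?n) \<le>
    D * (\<Sum>J\<in>cls p a' a c0. root (sK l) (mean k (p ^ M)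
       (\<lambda>x. norm (block p j a' J f x) ^ (2 * sK l) * norm (?G x) ^ ?n))) ^ sK l"
    using f by (intro lower_decoupling[OF p l D a la lb M c _ G]) auto
  also have "\<dots> \<le> D * (\<Sum>J\<in>cls p a' a c0. root (sK l) ?R * energy p k M j a' J f) ^ sK l"
  proof (intro mult_left_mono[OF power_mono] sum_mono D(2))
    fix J assume J: "J \<in> cls p a' a c0"
    have "\<not> p dvd J - c1"
    proof
      assume "p dvd J - c1"
      moreover have "p dvd J - c0" using J a0 p1 unfolding cls_def
        by (auto intro: dvd_trans[OF dvd_power])
      ultimately have "p dvd (J - c1) - (J - c0)" by (rule dvd_diff)
      then show False using c by simp
    qed
    then have "mean k (p ^ M) (\<lambda>x. norm (block p j a' J f x) ^ (2 * sK l) * norm (?G x) ^ ?n)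
      \<le> ?R * energy p k M j a' J f ^ sK l"
      using B(1) M f unfolding bil_def by (simp add: mult_ac)
    then have "root (sK l) (mean k (p ^ M) (\<lambda>x. norm (block p j a' J f x) ^ (2 * sK l) * norm (?G x) ^ ?n))
      \<le> root (sK l) (?R * energy p k M j a' J f ^ sK l)" using s by simp
    also have "\<dots> = root (sK l) ?R * energy p k M j a' J f"
      using s by (simp add: real_root_mult real_root_power_cancel)
    finally show "root (sK l) (mean k (p ^ M) (\<lambda>x. norm (block p j a' J f x) ^ (2 * sK l) * norm (?G x) ^ ?n))
      \<le> root (sK l) ?R * energy p k M j a' J f" .
  qed (use s in \<open>auto intro!: sum_nonneg real_root_ge_zero mean_nonneg\<close>)
  also have "\<dots> = D * ?R * energy p k M j a c0 f ^ sK l"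
    using s R0 energy_split[OF _ a, of p k M c0 f] p1
    by (simp add: sum_distrib_left[symmetric] power_mult_distrib)
  finally show "mean k (p ^ M) (\<lambda>x. norm (block p j a c0 f x) ^ (2 * sK l) * norm (?G x) ^ ?n) \<le>
     D * B * energy p k M j a c0 f ^ sK l * energy p k M j b c1 f ^ (sK k - sK l)"
    by (simp add: mult_ac)
qed

lemma sK_mono: "l \<le> k \<Longrightarrow> sK l \<le> sK k"
  unfolding sK_def by (intro div_le_mono mult_le_mono) auto

lemma real_sK: "real (sK k) = real k * (real k + 1) / 2"
proof -
  have "2 * real (sK k) = real (k * (k + 1))" using two_sK[of k] by (metis of_nat_mult of_nat_numeral)
  then show ?thesis by (simp add: algebra_simps)
qed

text \<open>Both exponents of the Hoelder step below are these identities between triangular numbers.\<close>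

lemma sK_holder:
  assumes "1 \<le> l" "l < k"
  shows "(sK k - sK (k - l)) + (k - l) * sK (l - 1) = (k - l + 1) * sK l"
    "sK (k - l) + (k - l) * (sK k - sK (l - 1)) = (k - l + 1) * (sK k - sK l)"
proof -
  from assms obtain n where n: "k = l + n" "n \<ge> 1" by (metis add_diff_inverse_nat diff_is_0_eq' less_imp_le_nat not_less not_less_eq_eq One_nat_def zero_less_diff gr0_conv_Suc not_less_zero Suc_le_eq)
  from assms obtain m where m: "l = Suc m" by (cases l) auto
  have le: "sK (k - l) \<le> sK k" "sK (l - 1) \<le> sK k" "sK l \<le> sK k" using assms by (auto intro: sK_mono)
  have "real ((sK k - sK (k - l)) + (k - l) * sK (l - 1)) = real ((k - l + 1) * sK l)"
    using le by (simp add: of_nat_diff real_sK n m field_simps)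
  then show "(sK k - sK (k - l)) + (k - l) * sK (l - 1) = (k - l + 1) * sK l" by (simp only: of_nat_eq_iff)
  have "real (sK (k - l) + (k - l) * (sK k - sK (l - 1))) = real ((k - l + 1) * (sK k - sK l))"
    using le by (simp add: of_nat_diff real_sK n m field_simps)
  then show "sK (k - l) + (k - l) * (sK k - sK (l - 1)) = (k - l + 1) * (sK k - sK l)" by (simp only: of_nat_eq_iff)
qed

text \<open>The integrand of level \<open>l\<close> is a geometric mean of the one of level
  \<open>k - l\<close> with the two arcs exchanged, with weight 1/(k-l+1), and the one of level
  \<open>l - 1\<close>, with weight (k-l)/(k-l+1). The exchange allows the other scale to be refined
  in its turn.\<close>

lemma bil_holder:
  assumes p: "p > 1" and l: "1 \<le> l" "l < k" and B: "B \<ge> 0" "B ^ (k - l + 1) = B1 * B2 ^ (k - l)" "B1 \<ge> 0" "B2 \<ge> 0"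
    and B1: "bil p k (k - l) j b a B1" and B2: "bil p k (l - 1) j a b B2"
  shows "bil p k l j a b B"
  unfolding bil_def
proof (intro allI impI)
  fix M f c0 c1
  assume M: "k * j \<le> M" and f: "\<forall>c\<in>{0..<p ^ j}. covar p k M j c (f c)" and c: "\<not> p dvd c0 - c1"
  have c': "\<not> p dvd c1 - c0" using c by (simp add: dvd_diff_commute)
  let ?F = "\<lambda>x. norm (block p j a c0 f x)" and ?G = "\<lambda>x. norm (block p j b c1 f x)"
  let ?E = "energy p k M j a c0 f" and ?E' = "energy p k M j b c1 f"
  let ?n = "k - l"
  note s = sK_holder[OF l]
  have aux: "2 * P + 2 * q * n = 2 * t * (1 + n)" "P + q * n = t * (1 + n)" if "P + n * q = (n + 1) * t"
    for P q n t :: nat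
  proof -
    show "P + q * n = t * (1 + n)" using that by (simp add: algebra_simps)
    then show "2 * P + 2 * q * n = 2 * t * (1 + n)" by (metis distrib_left mult.assoc)
  qed
  have gen: "x ^ N1 * y ^ N2 = (y ^ C1 * x ^ C2) * (x ^ C3 * y ^ C4)" if "C2 + C3 = N1" "C1 + C4 = N2"
    for x y :: real and N1 N2 C1 C2 C3 C4 :: nat
    by (simp add: that[symmetric] power_add mult_ac)
  let ?L = "mean k (p ^ M) (\<lambda>x. ?F x ^ (2 * sK l) * ?G x ^ (2 * (sK k - sK l)))"
  let ?R = "B * ?E ^ sK l * ?E' ^ (sK k - sK l)"
  have "?L ^ (1 + ?n) \<le> mean k (p ^ M) (\<lambda>x. ?G x ^ (2 * sK (k - l)) * ?F x ^ (2 * (sK k - sK (k - l)))) ^ 1 *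
     mean k (p ^ M) (\<lambda>x. ?F x ^ (2 * sK (l - 1)) * ?G x ^ (2 * (sK k - sK (l - 1)))) ^ ?n"
  proof (rule mean_holder)
    fix x
    have "2 * (sK k - sK (k - l)) + 2 * sK (l - 1) * ?n = 2 * sK l * (1 + ?n)" by (rule aux[OF s(1)])
    moreover have "2 * sK (k - l) + 2 * (sK k - sK (l - 1)) * ?n = 2 * (sK k - sK l) * (1 + ?n)" by (rule aux[OF s(2)])
    ultimately show "(?F x ^ (2 * sK l) * ?G x ^ (2 * (sK k - sK l))) ^ (1 + ?n) \<le>
      (?G x ^ (2 * sK (k - l)) * ?F x ^ (2 * (sK k - sK (k - l)))) ^ 1 *
      (?F x ^ (2 * sK (l - 1)) * ?G x ^ (2 * (sK k - sK (l - 1)))) ^ ?n"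
      unfolding power_mult_distrib power_mult[symmetric] power_one_right
      by (intro eq_refl gen)
  qed (use p in auto)
  also have "\<dots> \<le> (B1 * ?E' ^ sK (k - l) * ?E ^ (sK k - sK (k - l))) ^ 1 *
     (B2 * ?E ^ sK (l - 1) * ?E' ^ (sK k - sK (l - 1))) ^ ?n"
    using B1 B2 M f c c' B unfolding bil_def
    by (intro mult_mono power_mono mean_nonneg mult_nonneg_nonneg zero_le_power) auto
  also have "\<dots> = ?R ^ (1 + ?n)"
  proof -
    have "sK k - sK (k - l) + sK (l - 1) * ?n = sK l * (1 + ?n)" by (rule aux[OF s(1)])
    moreover have "sK (k - l) + (sK k - sK (l - 1)) * ?n = (sK k - sK l) * (1 + ?n)" by (rule aux[OF s(2)])
    moreover have "B ^ (1 + ?n) = B1 * B2 ^ ?n" using B(2) by simp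
    ultimately have "(?E' ^ sK (k - l) * ?E ^ (sK k - sK (k - l))) * (?E ^ sK (l - 1) * ?E' ^ (sK k - sK (l - 1))) ^ ?n
        = (?E ^ sK l * ?E' ^ (sK k - sK l)) ^ (1 + ?n)" "B ^ (1 + ?n) = B1 * B2 ^ ?n"
      unfolding power_mult_distrib power_mult[symmetric] by (simp_all only: gen[symmetric])
    then show ?thesis
      unfolding power_one_right mult.assoc[of B1] mult.assoc[of B2] mult.assoc[of B]
        power_mult_distrib[of B2] power_mult_distrib[of B]
      by (simp only: mult_ac)
  qed
  finally have "?L ^ (1 + ?n) \<le> ?R ^ (1 + ?n)" .
  then have "?L ^ Suc ?n \<le> ?R ^ Suc ?n" by (simp only: plus_1_eq_Suc)
  then show "?L \<le> ?R" by (rule power_le_imp_le_base) (use B in simp)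
qed

lemma dec_mono: "dec p k j D \<Longrightarrow> D \<le> D' \<Longrightarrow> dec p k j D'"
  unfolding dec_def
  by (meson order_trans mult_right_mono zero_le_power sum_nonneg real_root_ge_zero moment_nonneg)

lemma bil_mono: "bil p k l j a b B \<Longrightarrow> B \<le> B' \<Longrightarrow> bil p k l j a b B'"
  unfolding bil_def
  by (meson order_trans mult_right_mono zero_le_power energy_nonneg)

lemma bil_holder_le:
  assumes p: "p > 1" and l: "1 \<le> l" "l < k" and B: "B \<ge> 0" "B1 * B2 ^ (k - l) \<le> B ^ (k - l + 1)" "B1 \<ge> 0" "B2 \<ge> 0"
    and B1: "bil p k (k - l) j b a B1" and B2: "bil p k (l - 1) j a b B2"
  shows "bil p k l j a b B"
proof -
  define B' where "B' = root (k - l + 1) (B1 * B2 ^ (k - l))"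
  have B': "B' \<ge> 0" "B' ^ (k - l + 1) = B1 * B2 ^ (k - l)" 
    unfolding B'_def using B by (auto simp del: power_Suc intro!: real_root_pow_pos2)
  have "bil p k l j a b B'" by (rule bil_holder[OF p l B' B(3,4) B1 B2])
  moreover have "B' \<le> B"
  proof (rule power_le_imp_le_base)
    show "B' ^ Suc (k - l) \<le> B ^ Suc (k - l)" using B'(2) B(2) by simp
  qed (rule B(1))
  ultimately show ?thesis by (rule bil_mono)
qed

text \<open>One refinement multiplies the scale by at most (l+1)/l, so passing from \<open>a\<close>
  to \<open>a'\<close> takes several. For \<open>a \<ge> 2 * l\<close> rounding down to an integer
  still leaves at least the factor (2l+1)/(2l); the number of refinements thus depends on the ratio
  of the scales only.\<close>

lemma bil_iterate:
  assumes p: "prime p" "p > int k" and l: "1 \<le> l" "l \<le> k" and D: "\<And>i. i \<le> j \<Longrightarrow> dec p l i D" "D \<ge> 0"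
    and a': "a' \<le> j" and b: "b \<le> j" and lb: "l * a' \<le> (k - l + 1) * b"
    and B: "bil p k l j a' b B" "B \<ge> 0"
    and a: "a \<le> a'" "2 * l \<le> a" and n: "a' * (2 * l) ^ n \<le> (2 * l + 1) ^ n * a"
  shows "bil p k l j a b (D ^ n * B)"
  using a n
proof (induction n arbitrary: a)
  case 0
  then have "a = a'" by simp
  then show ?case using B by simp
next
  case (Suc n)
  define a1 where "a1 = min a' ((l + 1) * a div l)"
  have "l * ((l + 1) * a div l) \<le> (l + 1) * a" by simp
  then have la: "l * a1 \<le> (l + 1) * a" unfolding a1_def by (meson le_trans min.cobounded2 mult_le_mono2)
  have "a \<le> (l + 1) * a div l" using l by (simp add: less_eq_div_iff_mult_less_eq)
  then have aa: "a \<le> a1" unfolding a1_def using Suc.prems by simp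
  have a1': "a1 \<le> a'" unfolding a1_def by simp
  have n: "a' * (2 * l) ^ n \<le> (2 * l + 1) ^ n * a1"
  proof (cases "a1 = a'")
    case True
    have "(2 * l) ^ n \<le> (2 * l + 1) ^ n" by (intro power_mono) auto
    then show ?thesis unfolding True by simp
  next
    case False
    then have e: "a1 = (l + 1) * a div l" unfolding a1_def by linarith
    have "(l + 1) * a < l * ((l + 1) * a div l) + l"
      using l mod_less_divisor[of l "(l + 1) * a"] mult_div_mod_eq[of l "(l + 1) * a"] by linarith
    then have "(2 * l + 1) * a \<le> 2 * l * a1" using Suc.prems(2) unfolding e by (simp add: algebra_simps)
    then have "(2 * l + 1) ^ n * ((2 * l + 1) * a) \<le> (2 * l + 1) ^ n * (2 * l * a1)" by (rule mult_le_mono2)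
    with Suc.prems(3) have "a' * (2 * l) ^ Suc n \<le> (2 * l + 1) ^ n * (2 * l * a1)"
      by (simp only: power_Suc2 mult.assoc)
    then have "(2 * l) * (a' * (2 * l) ^ n) \<le> (2 * l) * ((2 * l + 1) ^ n * a1)" by (simp only: power_Suc mult_ac)
    then show ?thesis using l by simp
  qed
  have b1: "bil p k l j a1 b (D ^ n * B)"
    by (rule Suc.IH[OF a1' _ n]) (use Suc.prems(2) aa in linarith)
  have a1j: "a1 \<le> j" using a1' a' by linarith
  have lb1: "l * a1 \<le> (k - l + 1) * b" using mult_le_mono2[OF a1', of l] lb by linarith
  have "bil p k l j a b (D * (D ^ n * B))"
    by (rule bil_lower_decoupling[OF p l D(1)[OF a1j] D(2) aa a1j b la lb1 b1])
      (use D B l Suc.prems(2) in auto)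
  then show ?case by (simp add: mult_ac)
qed

lemma moment_block_le:
  assumes p: "p > 1" and k: "k \<ge> 1" and D: "dec p k (j - b) D" "D \<ge> 0" and b: "b \<le> j" and M: "k * j \<le> M"
    and f: "\<And>c. c \<in> {0..<p ^ j} \<Longrightarrow> covar p k M j c (f c)"
  shows "mean k (p ^ M) (\<lambda>x. norm (block p j b c0 f x) ^ (2 * sK k)) \<le> D * energy p k M j b c0 f ^ sK k"
  using dec_rescale[OF p k D b M f, of c0] unfolding moment_def block_def energy_def by simp

text \<open>At level 0 only the second arc remains, and rescaling it leaves \<open>j - b\<close>
  scales. This saving of \<open>b\<close> scales is the source of every gain in the
  bootstrap.\<close>

lemma bil_zero:
  assumes p: "p > 1" and k: "k \<ge> 1" and D: "dec p k (j - b) D" "D \<ge> 0" and b: "b \<le> j"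
  shows "bil p k 0 j a b D"
  unfolding bil_def using moment_block_le[OF p k D b] by (simp add: sK_def)

text \<open>Hoelder's inequality separates the two arcs, and each is rescaled on its own. This is
  round 0 of the bootstrap.\<close>

lemma bil_trivial:
  assumes p: "p > 1" and k: "k \<ge> 1" and l: "l \<le> k" and D: "dec p k (j - a) D" "dec p k (j - b) D" "D \<ge> 0" and b: "a \<le> j" "b \<le> j"
  shows "bil p k l j a b D"
  unfolding bil_def
proof (intro allI impI)
  fix M f c0 c1
  assume M: "k * j \<le> M" and f: "\<forall>c\<in>{0..<p ^ j}. covar p k M j c (f c)" and c: "\<not> p dvd c0 - c1"
  let ?F = "\<lambda>x. norm (block p j a c0 f x)" and ?G = "\<lambda>x. norm (block p j b c1 f x)"
  let ?E = "energy p k M j a c0 f" and ?E' = "energy p k M j b c1 f"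
  define m where "m = sK l"
  define n where "n = sK k - sK l"
  have mn: "sK k = m + n" unfolding m_def n_def using sK_mono[OF l] by simp
  have mn0: "0 < m + n" using sK_pos[of k] k unfolding mn by simp
  let ?L = "mean k (p ^ M) (\<lambda>x. ?F x ^ (2 * m) * ?G x ^ (2 * n))"
  have "?L ^ (m + n) \<le> mean k (p ^ M) (\<lambda>x. ?F x ^ (2 * sK k)) ^ m * mean k (p ^ M) (\<lambda>x. ?G x ^ (2 * sK k)) ^ n"
    by (rule mean_holder[OF mn0])
       (use p in \<open>auto simp: power_mult_distrib power_mult[symmetric] mn mult_ac\<close>)
  also have "\<dots> \<le> (D * ?E ^ sK k) ^ m * (D * ?E' ^ sK k) ^ n"
    using f by (intro mult_mono power_mono moment_block_le[OF p k D(1,3) b(1) M] moment_block_le[OF p k D(2,3) b(2) M])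
      (auto intro!: mean_nonneg D zero_le_power mult_nonneg_nonneg)
  also have "\<dots> = (D * ?E ^ m * ?E' ^ n) ^ (m + n)"
    by (simp add: power_mult_distrib power_add power_mult[symmetric] mn mult_ac)
  finally have "?L ^ (m + n) \<le> (D * ?E ^ m * ?E' ^ n) ^ (m + n)" .
  then have "?L \<le> D * ?E ^ m * ?E' ^ n"
    using mn0 D by (subst (asm) power_mono_iff) (auto intro!: mean_nonneg)
  then show "mean k (p ^ M) (\<lambda>x. ?F x ^ (2 * sK l) * ?G x ^ (2 * (sK k - sK l))) \<le>
     D * ?E ^ sK l * ?E' ^ (sK k - sK l)"
    unfolding m_def n_def .
qed

section \<open>From bilinear to linear estimates\<close>

lemma norm_sum_power_le:
  fixes z :: "'a \<Rightarrow> complex"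
  assumes "finite S" "S \<noteq> {}"
  shows "norm (\<Sum>c\<in>S. z c) ^ n \<le> real (card S) ^ n * (\<Sum>c\<in>S. norm (z c) ^ n)"
proof -
  define m where "m = Max ((\<lambda>c. norm (z c)) ` S)"
  have "m \<in> (\<lambda>c. norm (z c)) ` S" unfolding m_def using assms by (intro Max_in) auto
  then obtain c0 where c0: "c0 \<in> S" "m = norm (z c0)" by auto
  have m: "norm (z c) \<le> m" if "c \<in> S" for c unfolding m_def using assms that by (intro Max_ge) auto
  have "norm (\<Sum>c\<in>S. z c) \<le> (\<Sum>c\<in>S. norm (z c))" by (rule norm_sum)
  also have "\<dots> \<le> real (card S) * m" using m by (rule sum_bounded_above)
  finally have "norm (\<Sum>c\<in>S. z c) ^ n \<le> (real (card S) * m) ^ n" by (intro power_mono) auto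
  also have "\<dots> = real (card S) ^ n * norm (z c0) ^ n" by (simp add: power_mult_distrib c0)
  also have "\<dots> \<le> real (card S) ^ n * (\<Sum>c\<in>S. norm (z c) ^ n)"
    using assms c0 by (intro mult_left_mono member_le_sum[of c0 S "\<lambda>c. norm (z c) ^ n"]) auto
  finally show ?thesis .
qed

lemma card_cls: "p > 1 \<Longrightarrow> b \<le> j \<Longrightarrow> card (cls p j b c0) = nat (p ^ (j - b))"
  using bij_betw_same_card[OF bij_betw_cls[of p b j c0]] by simp

text \<open>The arcs of scale 1 are split by the triangle inequality into at most p^a and p^b arcs
  of scales \<open>a\<close> and \<open>b\<close>. The loss is exponential in \<open>a + b\<close>
  but does not involve \<open>j\<close>.\<close>

lemma bil_coarsen:
  assumes p: "p > 1" and l: "l \<le> k" and ab: "1 \<le> a" "1 \<le> b" "a \<le> j" "b \<le> j"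
    and B: "bil p k l j a b B" "B \<ge> 0"
  shows "bil p k l j 1 1 (of_int p ^ ((2 * sK k + 1) * (a + b)) * B)"
  unfolding bil_def
proof (intro allI impI)
  fix M f c0 c1
  assume M: "k * j \<le> M" and f: "\<forall>c\<in>{0..<p ^ j}. covar p k M j c (f c)" and c: "\<not> p dvd c0 - c1"
  let ?F = "\<lambda>J x. norm (block p j a J f x)" and ?G = "\<lambda>J x. norm (block p j b J f x)"
  let ?E = "energy p k M j 1 c0 f" and ?E' = "energy p k M j 1 c1 f"
  let ?S = "cls p a 1 c0" and ?S' = "cls p b 1 c1"
  define P where "P = (of_int p :: real)"
  have P: "P > 1" using p by (simp add: P_def)
  define m where "m = sK l"
  define n where "n = sK k - sK l"
  have mn: "sK k = m + n" unfolding m_def n_def using sK_mono[OF l] by simp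
  have card: "real (card ?S) \<le> P ^ a" "real (card ?S') \<le> P ^ b"
  proof -
    have "real (nat (p ^ (i - 1))) \<le> P ^ i" for i
      using p P unfolding P_def by (auto simp: power_increasing)
    then show "real (card ?S) \<le> P ^ a" "real (card ?S') \<le> P ^ b"
      using card_cls[OF p ab(1)] card_cls[OF p ab(2)] by simp_all
  qed
  have ne: "?S \<noteq> {}" "?S' \<noteq> {}"
  proof -
    have "0 < nat (p ^ i)" for i using p by (simp only: zero_less_nat_eq) simp
    then have "card ?S > 0" "card ?S' > 0" using card_cls[OF p ab(1), of c0] card_cls[OF p ab(2), of c1] by simp_all
    then show "?S \<noteq> {}" "?S' \<noteq> {}" by auto
  qed
  have bound: "norm (block p j 1 c0 f x) ^ (2 * m) \<le> P ^ (a * (2 * m)) * (\<Sum>J\<in>?S. ?F J x ^ (2 * m))" for x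
  proof -
    have "norm (block p j 1 c0 f x) ^ (2 * m) \<le> real (card ?S) ^ (2 * m) * (\<Sum>J\<in>?S. ?F J x ^ (2 * m))"
      using norm_sum_power_le[OF finite_cls ne(1), of "\<lambda>J. block p j a J f x"] block_split[of p 1 a j c0 f x] p ab by simp
    also have "\<dots> \<le> P ^ (a * (2 * m)) * (\<Sum>J\<in>?S. ?F J x ^ (2 * m))"
      unfolding power_mult using card by (intro mult_right_mono power_mono sum_nonneg) auto
    finally show ?thesis .
  qed
  have bound': "norm (block p j 1 c1 f x) ^ (2 * n) \<le> P ^ (b * (2 * n)) * (\<Sum>J\<in>?S'. ?G J x ^ (2 * n))" for x
  proof -
    have "norm (block p j 1 c1 f x) ^ (2 * n) \<le> real (card ?S') ^ (2 * n) * (\<Sum>J\<in>?S'. ?G J x ^ (2 * n))"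
      using norm_sum_power_le[OF finite_cls ne(2), of "\<lambda>J. block p j b J f x"] block_split[of p 1 b j c1 f x] p ab by simp
    also have "\<dots> \<le> P ^ (b * (2 * n)) * (\<Sum>J\<in>?S'. ?G J x ^ (2 * n))"
      unfolding power_mult using card by (intro mult_right_mono power_mono sum_nonneg) auto
    finally show ?thesis .
  qed
  let ?Q = "P ^ (a * (2 * m)) * P ^ (b * (2 * n))"
  have Q0: "?Q \<ge> 0" using P by simp
  have "mean k (p ^ M) (\<lambda>x. norm (block p j 1 c0 f x) ^ (2 * m) * norm (block p j 1 c1 f x) ^ (2 * n)) \<le>
    mean k (p ^ M) (\<lambda>x. ?Q * (\<Sum>J\<in>?S. \<Sum>J'\<in>?S'. ?F J x ^ (2 * m) * ?G J' x ^ (2 * n)))"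
  proof (rule mean_mono)
    fix x
    have "norm (block p j 1 c0 f x) ^ (2 * m) * norm (block p j 1 c1 f x) ^ (2 * n) \<le>
      (P ^ (a * (2 * m)) * (\<Sum>J\<in>?S. ?F J x ^ (2 * m))) * (P ^ (b * (2 * n)) * (\<Sum>J\<in>?S'. ?G J x ^ (2 * n)))"
      using P by (intro mult_mono bound bound') (auto intro!: mult_nonneg_nonneg sum_nonneg)
    also have "\<dots> = ?Q * (\<Sum>J\<in>?S. \<Sum>J'\<in>?S'. ?F J x ^ (2 * m) * ?G J' x ^ (2 * n))"
      unfolding sum_product[symmetric] by (simp only: mult_ac)
    finally show "norm (block p j 1 c0 f x) ^ (2 * m) * norm (block p j 1 c1 f x) ^ (2 * n) \<le>
      ?Q * (\<Sum>J\<in>?S. \<Sum>J'\<in>?S'. ?F J x ^ (2 * m) * ?G J' x ^ (2 * n))" .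
  qed
  also have "\<dots> = ?Q * (\<Sum>J\<in>?S. \<Sum>J'\<in>?S'. mean k (p ^ M) (\<lambda>x. ?F J x ^ (2 * m) * ?G J' x ^ (2 * n)))"
    unfolding mean_cmult mean_sum ..
  also have "\<dots> \<le> ?Q * (\<Sum>J\<in>?S. \<Sum>J'\<in>?S'. B * ?E ^ m * ?E' ^ n)"
  proof (intro mult_left_mono[OF _ Q0] sum_mono)
    fix J J' assume J: "J \<in> ?S" "J' \<in> ?S'"
    have JJ: "\<not> p dvd J - J'"
    proof
      assume "p dvd J - J'"
      moreover have "p dvd J - c0" "p dvd J' - c1" using J by (auto simp: cls_def)
      ultimately have "p dvd (J - J') - (J - c0)" "p dvd J' - c1" by (simp_all only: dvd_diff)
      then have "p dvd ((J - J') - (J - c0)) + (J' - c1)" by (rule dvd_add)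
      then show False using c by simp
    qed
    have E: "energy p k M j a J f \<le> ?E" "energy p k M j b J' f \<le> ?E'"
    proof -
      have "?E = (\<Sum>J\<in>?S. energy p k M j a J f)" "?E' = (\<Sum>J\<in>?S'. energy p k M j b J f)"
        using p ab by (auto intro!: energy_split)
      then show "energy p k M j a J f \<le> ?E" "energy p k M j b J' f \<le> ?E'"
        using J by (auto intro!: member_le_sum)
    qed
    have "mean k (p ^ M) (\<lambda>x. ?F J x ^ (2 * m) * ?G J' x ^ (2 * n)) \<le> B * energy p k M j a J f ^ m * energy p k M j b J' f ^ n"
      using B(1) M f JJ unfolding bil_def m_def n_def by blast
    also have "\<dots> \<le> B * ?E ^ m * ?E' ^ n"
      using E B by (intro mult_mono power_mono mult_left_mono) auto
    finally show "mean k (p ^ M) (\<lambda>x. ?F J x ^ (2 * m) * ?G J' x ^ (2 * n)) \<le> B * ?E ^ m * ?E' ^ n" .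
  qed
  also have "\<dots> = (?Q * (real (card ?S) * real (card ?S'))) * (B * ?E ^ m * ?E' ^ n)" by simp
  also have "\<dots> \<le> (P ^ ((2 * sK k + 1) * (a + b))) * (B * ?E ^ m * ?E' ^ n)"
  proof (intro mult_right_mono)
    have "?Q * (real (card ?S) * real (card ?S')) \<le> ?Q * (P ^ a * P ^ b)"
      using card P by (intro mult_left_mono mult_mono Q0) auto
    also have "\<dots> = P ^ (a * (2 * m) + b * (2 * n) + a + b)" by (simp add: power_add)
    also have "\<dots> \<le> P ^ ((2 * sK k + 1) * (a + b))"
      using P by (intro power_increasing) (auto simp: mn algebra_simps)
    finally show "?Q * (real (card ?S) * real (card ?S')) \<le> P ^ ((2 * sK k + 1) * (a + b))" .
  qed (use B in auto)
  finally show "mean k (p ^ M) (\<lambda>x. norm (block p j 1 c0 f x) ^ (2 * sK l) * norm (block p j 1 c1 f x) ^ (2 * (sK k - sK l))) \<le>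
     of_int p ^ ((2 * sK k + 1) * (a + b)) * B * ?E ^ sK l * ?E' ^ (sK k - sK l)"
    unfolding m_def n_def P_def by (simp only: mult_ac)
qed

text \<open>Let \<open>c0\<close> be the index of the largest term. Either every other term is at
  most \<open>\<theta> / card S\<close> times as large, and the sum is at most
  \<open>1 + \<theta>\<close> times the largest term; or some other term is comparable to it, and a
  product of two distinct terms dominates the sum.\<close>

lemma broad_narrow:
  fixes z :: "'a \<Rightarrow> complex"
  assumes S: "finite S" and ne: "S \<noteq> {}" and \<theta>: "\<theta> > 0"
  shows "norm (\<Sum>c\<in>S. z c) ^ (2 * s) \<le> (1 + \<theta>) ^ (2 * s) * (\<Sum>c\<in>S. norm (z c) ^ (2 * s)) +
    real (card S) ^ (2 * s) * (card S / \<theta>) ^ s * (\<Sum>c\<in>S. \<Sum>c'\<in>S - {c}. norm (z c) ^ s * norm (z c') ^ s)"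
proof -
  define m where "m = Max ((\<lambda>c. norm (z c)) ` S)"
  have "m \<in> (\<lambda>c. norm (z c)) ` S" unfolding m_def using S ne by (intro Max_in) auto
  then obtain c0 where c0: "c0 \<in> S" "m = norm (z c0)" by auto
  have m: "norm (z c) \<le> m" if "c \<in> S" for c unfolding m_def using S that by (intro Max_ge) auto
  have N: "real (card S) > 0" using S ne by (simp add: card_gt_0_iff)
  let ?K = "real (card S) ^ (2 * s) * (card S / \<theta>) ^ s"
  let ?X = "\<Sum>c\<in>S. norm (z c) ^ (2 * s)"
  let ?Y = "\<Sum>c\<in>S. \<Sum>c'\<in>S - {c}. norm (z c) ^ s * norm (z c') ^ s"
  have K0: "?K \<ge> 0" using N \<theta> by simp
  have X: "norm (z c0) ^ (2 * s) \<le> ?X"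
    using S c0 by (intro member_le_sum[of c0 S "\<lambda>c. norm (z c) ^ (2 * s)"]) auto
  have Y0: "?Y \<ge> 0" by (intro sum_nonneg) auto
  have X0: "?X \<ge> 0" by (intro sum_nonneg) auto
  show ?thesis
  proof (cases "\<forall>c\<in>S - {c0}. norm (z c) \<le> \<theta> / card S * m")
    case True
    have "norm (\<Sum>c\<in>S. z c) \<le> (\<Sum>c\<in>S. norm (z c))" by (rule norm_sum)
    also have "\<dots> = m + (\<Sum>c\<in>S - {c0}. norm (z c))" using S c0 by (simp add: sum.remove)
    also have "(\<Sum>c\<in>S - {c0}. norm (z c)) \<le> real (card (S - {c0})) * (\<theta> / card S * m)"
      using True by (intro sum_bounded_above) auto
    also have "\<dots> \<le> real (card S) * (\<theta> / card S * m)"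
      using S \<theta> c0 by (intro mult_right_mono) (auto intro!: mult_nonneg_nonneg)
    also have "\<dots> = \<theta> * m" using N by simp
    finally have "norm (\<Sum>c\<in>S. z c) \<le> (1 + \<theta>) * m" by (simp add: algebra_simps)
    then have "norm (\<Sum>c\<in>S. z c) ^ (2 * s) \<le> ((1 + \<theta>) * m) ^ (2 * s)" by (intro power_mono) auto
    also have "\<dots> = (1 + \<theta>) ^ (2 * s) * norm (z c0) ^ (2 * s)" by (simp add: power_mult_distrib c0)
    also have "\<dots> \<le> (1 + \<theta>) ^ (2 * s) * ?X" using X \<theta> by (intro mult_left_mono) auto
    finally show ?thesis using mult_nonneg_nonneg[OF K0 Y0] by linarith
  next
    case False
    then obtain c1 where c1: "c1 \<in> S - {c0}" "\<theta> / card S * m < norm (z c1)" by (auto simp: not_le)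
    then have m1: "m \<le> card S / \<theta> * norm (z c1)" using N \<theta> by (simp add: field_simps)
    have "norm (\<Sum>c\<in>S. z c) \<le> (\<Sum>c\<in>S. norm (z c))" by (rule norm_sum)
    also have "\<dots> \<le> real (card S) * m" using m by (rule sum_bounded_above)
    finally have "norm (\<Sum>c\<in>S. z c) ^ (2 * s) \<le> (real (card S) * m) ^ (2 * s)" by (intro power_mono) auto
    also have "\<dots> = real (card S) ^ (2 * s) * (m ^ s * m ^ s)"
      by (simp add: power_mult_distrib power_add[symmetric] mult_2)
    also have "\<dots> \<le> real (card S) ^ (2 * s) * (norm (z c0) ^ s * (card S / \<theta> * norm (z c1)) ^ s)"
      using m1 c0 by (intro mult_left_mono mult_mono power_mono) auto
    also have "\<dots> = ?K * (norm (z c0) ^ s * norm (z c1) ^ s)"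
      by (simp only: power_mult_distrib mult_ac)
    also have "norm (z c0) ^ s * norm (z c1) ^ s \<le> (\<Sum>c'\<in>S - {c0}. norm (z c0) ^ s * norm (z c') ^ s)"
      using S c1 by (intro member_le_sum[of c1 "S - {c0}" "\<lambda>c'. norm (z c0) ^ s * norm (z c') ^ s"]) auto
    also have "\<dots> \<le> ?Y"
      using S c0 by (intro member_le_sum[of c0 S "\<lambda>c. \<Sum>c'\<in>S - {c}. norm (z c) ^ s * norm (z c') ^ s"]) (auto intro: sum_nonneg)
    finally have "norm (\<Sum>c\<in>S. z c) ^ (2 * s) \<le> ?K * ?Y" using K0 by (simp add: mult_left_mono)
    moreover have "0 \<le> (1 + \<theta>) ^ (2 * s) * ?X" using X0 \<theta> by simp
    ultimately show ?thesis by linarith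
  qed
qed

text \<open>The symmetric product is the geometric mean of the two level \<open>l\<close> integrands
  that arise from the two orders of the arcs, so Cauchy-Schwarz suffices.\<close>

lemma sym_holder:
  assumes p: "p > 1" and l: "l \<le> k" and B: "bil p k l j a a B" "B \<ge> 0"
    and M: "k * j \<le> M" and f: "\<forall>c\<in>{0..<p ^ j}. covar p k M j c (f c)" and c: "\<not> p dvd c0 - c1"
  shows "mean k (p ^ M) (\<lambda>x. norm (block p j a c0 f x) ^ sK k * norm (block p j a c1 f x) ^ sK k)
    ^ 2 \<le> B ^ 2 * energy p k M j a c0 f ^ sK k * energy p k M j a c1 f ^ sK k"
proof -
  have c': "\<not> p dvd c1 - c0" using c by (simp add: dvd_diff_commute)
  let ?F = "\<lambda>x. norm (block p j a c0 f x)" and ?G = "\<lambda>x. norm (block p j a c1 f x)"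
  let ?E = "energy p k M j a c0 f" and ?E' = "energy p k M j a c1 f"
  define m where "m = sK l"
  define n where "n = sK k - sK l"
  have mn: "sK k = m + n" unfolding m_def n_def using sK_mono[OF l] by simp
  have "mean k (p ^ M) (\<lambda>x. ?F x ^ sK k * ?G x ^ sK k) ^ (1 + 1) \<le>
     mean k (p ^ M) (\<lambda>x. ?F x ^ (2 * m) * ?G x ^ (2 * n)) ^ 1 * mean k (p ^ M) (\<lambda>x. ?G x ^ (2 * m) * ?F x ^ (2 * n)) ^ 1"
  proof (rule mean_holder)
    have "(x ^ (m + n) * y ^ (m + n)) ^ (1 + 1) = (x ^ (2 * m) * y ^ (2 * n)) ^ 1 * (y ^ (2 * m) * x ^ (2 * n)) ^ 1"
      for x y :: real
      unfolding mult_2 power_add by (simp add: mult_ac)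
    then show "(?F x ^ sK k * ?G x ^ sK k) ^ (1 + 1) \<le>
      (?F x ^ (2 * m) * ?G x ^ (2 * n)) ^ 1 * (?G x ^ (2 * m) * ?F x ^ (2 * n)) ^ 1" for x
      unfolding mn by simp
  qed (use p in auto)
  also have "\<dots> \<le> (B * ?E ^ m * ?E' ^ n) ^ 1 * (B * ?E' ^ m * ?E ^ n) ^ 1"
    using B M f c c' unfolding bil_def m_def n_def
    by (intro mult_mono power_mono mean_nonneg mult_nonneg_nonneg zero_le_power) auto
  also have "\<dots> = B ^ 2 * ?E ^ sK k * ?E' ^ sK k"
    by (simp add: mn power_add power2_eq_square mult_ac)
  finally show ?thesis by (simp add: numeral_2_eq_2)
qed

text \<open>\<open>broad_narrow\<close> is applied to the \<open>p\<close> arcs of scale 1. A single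
  arc is rescaled and has \<open>j - 1\<close> scales left; two distinct residues modulo
  \<open>p\<close> are automatically transversal, so the broad part is bilinear.\<close>

lemma dec_step:
  assumes p: "p > 1" and k: "k \<ge> 1" and l: "l \<le> k" and \<theta>: "\<theta> > 0" and j: "1 \<le> j"
    and D: "dec p k (j - 1) D" "D \<ge> 0" and B: "bil p k l j 1 1 B" "B \<ge> 0"
  shows "dec p k j ((1 + \<theta>) ^ (2 * sK k) * D + of_int p ^ (2 * sK k) * (of_int p / \<theta>) ^ sK k * (of_int p ^ 2 * B))"
  unfolding dec_def
proof (intro allI impI)
  fix M f
  assume M: "k * j \<le> M" and f: "\<forall>c\<in>{0..<p ^ j}. covar p k M j c (f c)"
  let ?s = "sK k" and ?S = "{0..<p}"
  have s: "?s > 0" using sK_pos k by simp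
  let ?F = "\<lambda>J x. block p j 1 J f x"
  let ?En = "\<lambda>J. energy p k M j 1 J f"
  define E where "E = (\<Sum>c\<in>{0..<p ^ j}. root ?s (moment k (p ^ M) ?s (f c)))"
  have cls0: "cls p i 0 0 = {0..<p ^ i}" for i by (auto simp: cls_def)
  have cls1: "cls p 1 0 0 = ?S" using cls0[of 1] by simp
  have E: "E = (\<Sum>J\<in>?S. ?En J)"
    using energy_split[of p 0 1 j k M 0 f] p j by (simp add: energy_def[of p k M j 0 0] cls0 cls1[simplified] E_def)
  have F: "(\<Sum>c\<in>{0..<p ^ j}. f c x) = (\<Sum>J\<in>?S. ?F J x)" for x
    using block_split[of p 0 1 j 0 f x] p j by (simp add: block_def[of p j 0 0] cls0 cls1[simplified])
  have E0: "E \<ge> 0" unfolding E by (intro sum_nonneg) auto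
  have EJ: "?En J \<le> E" if "J \<in> ?S" for J unfolding E using that by (intro member_le_sum) auto
  have card: "real (card ?S) = of_int p" using p by simp
  let ?K = "real (card ?S) ^ (2 * ?s) * (card ?S / \<theta>) ^ ?s"
  have K0: "?K \<ge> 0" using \<theta> by simp
  have "moment k (p ^ M) ?s (\<lambda>x. \<Sum>c\<in>{0..<p ^ j}. f c x) \<le>
    mean k (p ^ M) (\<lambda>x. (1 + \<theta>) ^ (2 * ?s) * (\<Sum>J\<in>?S. norm (?F J x) ^ (2 * ?s)) +
      ?K * (\<Sum>J\<in>?S. \<Sum>J'\<in>?S - {J}. norm (?F J x) ^ ?s * norm (?F J' x) ^ ?s))"
    unfolding moment_def F using p by (intro mean_mono broad_narrow \<theta>) auto
  also have "\<dots> = (1 + \<theta>) ^ (2 * ?s) * (\<Sum>J\<in>?S. mean k (p ^ M) (\<lambda>x. norm (?F J x) ^ (2 * ?s))) +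
     ?K * (\<Sum>J\<in>?S. \<Sum>J'\<in>?S - {J}. mean k (p ^ M) (\<lambda>x. norm (?F J x) ^ ?s * norm (?F J' x) ^ ?s))"
    unfolding mean_add mean_cmult mean_sum ..
  also have "\<dots> \<le> (1 + \<theta>) ^ (2 * ?s) * (D * E ^ ?s) + ?K * (of_int p ^ 2 * (B * E ^ ?s))"
  proof (intro add_mono mult_left_mono K0)
    have "(\<Sum>J\<in>?S. mean k (p ^ M) (\<lambda>x. norm (?F J x) ^ (2 * ?s))) \<le> (\<Sum>J\<in>?S. D * ?En J ^ ?s)"
      using f by (intro sum_mono moment_block_le[OF p k D j M]) auto
    also have "\<dots> = D * (\<Sum>J\<in>?S. ?En J ^ ?s)" by (simp add: sum_distrib_left)
    also have "(\<Sum>J\<in>?S. ?En J ^ ?s) \<le> (\<Sum>J\<in>?S. ?En J * E ^ (?s - 1))"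
    proof (rule sum_mono)
      fix J assume J: "J \<in> ?S"
      have "?En J ^ ?s = ?En J * ?En J ^ (?s - 1)" using s by (metis Suc_diff_1 power_Suc)
      also have "\<dots> \<le> ?En J * E ^ (?s - 1)" using EJ[OF J] by (intro mult_left_mono power_mono) auto
      finally show "?En J ^ ?s \<le> ?En J * E ^ (?s - 1)" .
    qed
    also have "\<dots> = E ^ ?s" using s unfolding sum_distrib_right[symmetric] E[symmetric] by (metis Suc_diff_1 power_Suc)
    finally show "(\<Sum>J\<in>?S. mean k (p ^ M) (\<lambda>x. norm (?F J x) ^ (2 * ?s))) \<le> D * E ^ ?s"
      using D by (simp add: mult_left_mono)
  next
    have "(\<Sum>J\<in>?S. \<Sum>J'\<in>?S - {J}. mean k (p ^ M) (\<lambda>x. norm (?F J x) ^ ?s * norm (?F J' x) ^ ?s)) \<le>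
      (\<Sum>J\<in>?S. \<Sum>J'\<in>?S - {J}. B * E ^ ?s)"
    proof (intro sum_mono)
      fix J J' assume J: "J \<in> ?S" "J' \<in> ?S - {J}"
      then have "\<not> p dvd J - J'" by (auto simp: mod_eq_dvd_iff[symmetric])
      then have "mean k (p ^ M) (\<lambda>x. norm (?F J x) ^ ?s * norm (?F J' x) ^ ?s) ^ 2
         \<le> B ^ 2 * ?En J ^ ?s * ?En J' ^ ?s"
        by (rule sym_holder[OF p l B M f])
      also have "\<dots> \<le> B ^ 2 * E ^ ?s * E ^ ?s"
        using J EJ B E0 by (intro mult_mono power_mono mult_left_mono) auto
      also have "\<dots> = (B * E ^ ?s) ^ 2" by (simp add: power2_eq_square mult_ac)
      finally show "mean k (p ^ M) (\<lambda>x. norm (?F J x) ^ ?s * norm (?F J' x) ^ ?s) \<le> B * E ^ ?s"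
        by (rule power2_le_imp_le) (use B E0 in simp)
    qed
    also have "\<dots> \<le> (\<Sum>J\<in>?S. of_int p * (B * E ^ ?s))"
    proof (intro sum_mono)
      fix J assume "J \<in> ?S"
      have "(\<Sum>J'\<in>?S - {J}. B * E ^ ?s) \<le> (\<Sum>J'\<in>?S. B * E ^ ?s)"
        using B E0 by (intro sum_mono2) auto
      then show "(\<Sum>J'\<in>?S - {J}. B * E ^ ?s) \<le> of_int p * (B * E ^ ?s)" using p by simp
    qed
    also have "\<dots> = of_int p ^ 2 * (B * E ^ ?s)" using p by (simp add: power2_eq_square)
    finally show "(\<Sum>J\<in>?S. \<Sum>J'\<in>?S - {J}. mean k (p ^ M) (\<lambda>x. norm (?F J x) ^ ?s * norm (?F J' x) ^ ?s))
      \<le> of_int p ^ 2 * (B * E ^ ?s)" .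
  qed (use \<theta> in auto)
  also have "\<dots> = ((1 + \<theta>) ^ (2 * ?s) * D + of_int p ^ (2 * ?s) * (of_int p / \<theta>) ^ ?s * (of_int p ^ 2 * B)) * E ^ ?s"
    unfolding card by (simp add: algebra_simps)
  finally show "moment k (p ^ M) ?s (\<lambda>x. \<Sum>c\<in>{0..<p ^ j}. f c x) \<le>
    ((1 + \<theta>) ^ (2 * ?s) * D + of_int p ^ (2 * ?s) * (of_int p / \<theta>) ^ ?s * (of_int p ^ 2 * B)) *
    (\<Sum>c\<in>{0..<p ^ j}. root ?s (moment k (p ^ M) ?s (f c))) ^ ?s" unfolding E_def .
qed

text \<open>\<open>\<eta>\<close> is the growth rate of the decoupling constant per scale, with one
  factor \<open>C\<close> for all numbers of scales; the aim is every positive rate.\<close>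

definition decexp :: "int \<Rightarrow> nat \<Rightarrow> real \<Rightarrow> bool" where
  "decexp p k \<eta> \<longleftrightarrow> (\<exists>C\<ge>1. \<forall>j. dec p k j (C * of_int p powr (\<eta> * real j)))"

lemma decexp_mono:
  assumes p: "p > 1" and "decexp p k \<eta>" "\<eta> \<le> \<eta>'"
  shows "decexp p k \<eta>'"
proof -
  from assms obtain C where C: "C \<ge> 1" "\<And>j. dec p k j (C * of_int p powr (\<eta> * real j))" unfolding decexp_def by blast
  have "C * of_int p powr (\<eta> * real j) \<le> C * of_int p powr (\<eta>' * real j)" for j
    using p C(1) assms(3) by (intro mult_left_mono powr_mono mult_right_mono) auto
  then show ?thesis unfolding decexp_def using C dec_mono by blast
qed

lemma dec_zero_scale:
  assumes p: "p > 1" and k: "k \<ge> 1"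
  shows "dec p k 0 1"
proof -
  have "{0..<p ^ 0} = {0::int}" by auto
  then show ?thesis unfolding dec_def using sK_pos[of k] k by (auto simp: real_root_pow_pos2)
qed

lemma dec_trivial:
  assumes p: "p > 1" and k: "k \<ge> 1"
  shows "dec p k j (of_int p powr (real (2 * sK k) * real j))"
  unfolding dec_def
proof (intro allI impI)
  fix M and f :: "int \<Rightarrow> int poly \<Rightarrow> complex"
  let ?s = "sK k" and ?S = "{0..<p ^ j}"
  have s: "?s > 0" using sK_pos k by simp
  define N where "N = (\<lambda>c. root ?s (moment k (p ^ M) ?s (f c)))"
  define E where "E = (\<Sum>c\<in>?S. N c)"
  have N0: "N c \<ge> 0" for c unfolding N_def using s by simp
  have E0: "E \<ge> 0" unfolding E_def using N0 by (intro sum_nonneg) auto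
  have NE: "N c \<le> E" if "c \<in> ?S" for c unfolding E_def using that N0 by (intro member_le_sum) auto
  have Ns: "moment k (p ^ M) ?s (f c) = N c ^ ?s" for c unfolding N_def using s by simp
  have ne: "?S \<noteq> {}" using p by auto
  have card: "real (card ?S) = of_int p ^ j" using p by simp
  have "moment k (p ^ M) ?s (\<lambda>x. \<Sum>c\<in>?S. f c x) \<le>
     mean k (p ^ M) (\<lambda>x. real (card ?S) ^ (2 * ?s) * (\<Sum>c\<in>?S. norm (f c x) ^ (2 * ?s)))"
    unfolding moment_def by (intro mean_mono norm_sum_power_le ne) simp
  also have "\<dots> = real (card ?S) ^ (2 * ?s) * (\<Sum>c\<in>?S. N c ^ ?s)"
    unfolding mean_cmult mean_sum Ns[symmetric] moment_def ..
  also have "(\<Sum>c\<in>?S. N c ^ ?s) \<le> (\<Sum>c\<in>?S. N c * E ^ (?s - 1))"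
  proof (rule sum_mono)
    fix J assume J: "J \<in> ?S"
    have "N J ^ ?s = N J * N J ^ (?s - 1)" using s by (metis Suc_diff_1 power_Suc)
    also have "\<dots> \<le> N J * E ^ (?s - 1)" using NE[OF J] N0 by (intro mult_left_mono power_mono) auto
    finally show "N J ^ ?s \<le> N J * E ^ (?s - 1)" .
  qed
  also have "\<dots> = E ^ ?s" using s unfolding sum_distrib_right[symmetric] E_def[symmetric] by (metis Suc_diff_1 power_Suc)
  also have "real (card ?S) ^ (2 * ?s) = of_int p powr (real (2 * ?s) * real j)"
    unfolding card using p by (simp add: powr_realpow[symmetric] powr_powr powr_mult_base mult_ac del: powr_realpow' flip: power_mult)
  finally show "moment k (p ^ M) ?s (\<lambda>x. \<Sum>c\<in>?S. f c x) \<le> of_int p powr (real (2 * ?s) * real j) *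
     (\<Sum>c\<in>?S. root ?s (moment k (p ^ M) ?s (f c))) ^ ?s"
    unfolding E_def N_def by (simp add: mult_left_mono)
qed

text \<open>A bilinear estimate with an exponent \<open>\<eta> > 0\<close> passes to the linear one: the narrow part of
  the broad-narrow inequality costs only \<open>(1 + \<theta>)\<close> per scale.\<close>

lemma decexp_of_bil:
  assumes p: "p > 1" and k: "k \<ge> 1" and l: "l \<le> k" and \<eta>: "\<eta> > 0" and B: "B \<ge> 0"
    "\<And>j. 1 \<le> j \<Longrightarrow> bil p k l j 1 1 (B * of_int p powr (\<eta> * real j))"
  shows "decexp p k \<eta>"
proof -
  define P where "P = (of_int p :: real)"
  have P: "P > 1" using p by (simp add: P_def)
  define s where "s = sK k"
  have s: "s > 0" using sK_pos k by (simp add: s_def)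
  define \<rho> where "\<rho> = P powr \<eta>"
  have \<rho>: "\<rho> > 1" unfolding \<rho>_def using P \<eta> by simp
  \<comment> \<open>The factor \<open>(1 + \<theta>) ^ (2 * s)\<close> becomes the midpoint of 1 and
    \<open>\<rho>\<close>, hence less than the growth \<open>\<rho>\<close> allowed per scale. The
    remaining \<open>(\<rho> - 1) / 2 * C\<close> absorbs the broad term \<open>K * \<rho>\<close>
    once \<open>C\<close> is large.\<close>
  define \<theta> where "\<theta> = root (2 * s) ((1 + \<rho>) / 2) - 1"
  have "root (2 * s) 1 < root (2 * s) ((1 + \<rho>) / 2)" using s \<rho> by (intro real_root_less_mono) auto
  then have \<theta>: "\<theta> > 0" unfolding \<theta>_def using s by simp
  have \<theta>p: "(1 + \<theta>) ^ (2 * s) = (1 + \<rho>) / 2" unfolding \<theta>_def using s \<rho> by simp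
  define K where "K = P ^ (2 * s) * (P / \<theta>) ^ s * (P ^ 2 * B)"
  have K0: "K \<ge> 0" unfolding K_def using P \<theta> B by (intro mult_nonneg_nonneg) auto
  define C where "C = max 1 (2 * K * \<rho> / (\<rho> - 1))"
  have C: "C \<ge> 1" "2 * K * \<rho> / (\<rho> - 1) \<le> C" unfolding C_def by auto
  have CK: "(1 + \<rho>) / 2 * C + K * \<rho> \<le> C * \<rho>"
  proof -
    have "2 * K * \<rho> \<le> C * (\<rho> - 1)" using C(2) \<rho> by (simp add: field_simps)
    then show ?thesis by (simp add: field_simps)
  qed
  have pow: "P powr (\<eta> * real j) = \<rho> ^ j" for j
    unfolding \<rho>_def using P by (simp add: powr_realpow[symmetric] powr_powr del: powr_realpow')
  have "dec p k j (C * \<rho> ^ j)" for j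
  proof (induction j)
    case 0
    show ?case by (rule dec_mono[OF dec_zero_scale[OF p k]]) (use C in simp)
  next
    case (Suc j)
    have b: "bil p k l (Suc j) 1 1 (B * \<rho> ^ Suc j)" using B(2)[of "Suc j"] pow[of "Suc j"] by (simp add: P_def)
    have "dec p k (Suc j) ((1 + \<theta>) ^ (2 * s) * (C * \<rho> ^ j) + P ^ (2 * s) * (P / \<theta>) ^ s * (P ^ 2 * (B * \<rho> ^ Suc j)))"
      unfolding s_def P_def
      by (rule dec_step[OF p k l \<theta> _ _ _ b]) (use Suc C \<rho> B in auto)
    moreover have "(1 + \<theta>) ^ (2 * s) * (C * \<rho> ^ j) + P ^ (2 * s) * (P / \<theta>) ^ s * (P ^ 2 * (B * \<rho> ^ Suc j))
      = ((1 + \<rho>) / 2 * C + K * \<rho>) * \<rho> ^ j"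
      unfolding \<theta>p K_def by (simp add: algebra_simps)
    moreover have "\<dots> \<le> (C * \<rho>) * \<rho> ^ j" using CK \<rho> by (intro mult_right_mono) auto
    ultimately show ?case using dec_mono by (simp add: mult_ac)
  qed
  then show ?thesis unfolding decexp_def using C(1) pow unfolding P_def by metis
qed

section \<open>Bootstrapping the bilinear estimates\<close>

text \<open>The bilinear estimate of level \<open>l\<close> at scale \<open>b\<close> improves by \<open>p\<^bsup>-\<eta> b gain k t l\<^esup>\<close> over the trivial one after \<open>t\<close>
  rounds; the recursion is that of the scales in the bootstrap step.\<close>

fun gain :: "nat \<Rightarrow> nat \<Rightarrow> nat \<Rightarrow> real" where
  "gain k 0 l = (if l = 0 then 1 else 0)"
| "gain k (Suc t) l = (if l = 0 then 1 else
     gain k t (k - l) / l + real (k - l) / real (k - l + 1) * gain k t (l - 1))"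

lemma gain_0 [simp]: "gain k t 0 = 1"
  by (cases t) auto

text \<open>Summed over the levels, the recursion returns \<open>gain k t m\<close> with total
  weight 1/(k-m) + (k-m-1)/(k-m) = 1, and level 0 feeds in (k-1)/k in each round. Hence the sum
  grows linearly in \<open>t\<close>.\<close>

lemma sum_gain:
  assumes k: "k \<ge> 2"
  shows "(\<Sum>l\<in>{1..<k}. gain k t l) = t * (real k - 1) / k"
proof (induction t)
  case 0
  show ?case by simp
next
  case (Suc t)
  let ?g = "\<lambda>m. real (k - m - 1) / real (k - m) * gain k t m"
  have "(\<Sum>l\<in>{1..<k}. gain k (Suc t) l) = (\<Sum>l\<in>{1..<k}. gain k t (k - l) / l) +
    (\<Sum>l\<in>{1..<k}. real (k - l) / real (k - l + 1) * gain k t (l - 1))"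
    by (simp add: sum.distrib[symmetric])
  also have "(\<Sum>l\<in>{1..<k}. gain k t (k - l) / l) = (\<Sum>m\<in>{1..<k}. 1 / real (k - m) * gain k t m)"
    by (rule sum.reindex_bij_witness[where i = "\<lambda>m. k - m" and j = "\<lambda>m. k - m"]) auto
  also have "(\<Sum>l\<in>{1..<k}. real (k - l) / real (k - l + 1) * gain k t (l - 1)) = (\<Sum>m\<in>{0..<k - 1}. ?g m)"
    by (rule sum.reindex_bij_witness[where i = "\<lambda>m. m + 1" and j = "\<lambda>m. m - 1"]) (auto simp: Suc_diff_le of_nat_diff)
  also have "{0..<k - 1} = insert 0 {1..<k - 1}" using k by auto
  also have "(\<Sum>m\<in>insert 0 {1..<k - 1}. ?g m) = ?g 0 + (\<Sum>m\<in>{1..<k - 1}. ?g m)" by simp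
  also have "(\<Sum>m\<in>{1..<k - 1}. ?g m) = (\<Sum>m\<in>{1..<k}. ?g m)"
    by (rule sum.mono_neutral_left) (use k in auto)
  also have "(\<Sum>m\<in>{1..<k}. 1 / real (k - m) * gain k t m) + (?g 0 + (\<Sum>m\<in>{1..<k}. ?g m)) =
    (\<Sum>m\<in>{1..<k}. 1 / real (k - m) * gain k t m + ?g m) + ?g 0" by (simp add: sum.distrib)
  also have "(\<Sum>m\<in>{1..<k}. 1 / real (k - m) * gain k t m + ?g m) = (\<Sum>m\<in>{1..<k}. gain k t m)"
  proof (rule sum.cong[OF refl])
    fix m assume "m \<in> {1..<k}"
    then have "1 / real (k - m) + real (k - m - 1) / real (k - m) = 1" by (simp add: field_simps of_nat_diff)
    then show "1 / real (k - m) * gain k t m + ?g m = gain k t m"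
      by (metis distrib_right mult_1)
  qed
  also have "?g 0 = (real k - 1) / k" using k by (simp add: of_nat_diff)
  also have "(\<Sum>m\<in>{1..<k}. gain k t m) + (real k - 1) / k = real (Suc t) * (real k - 1) / k"
    unfolding Suc using k by (simp add: field_simps)
  finally show ?case .
qed

lemma exists_large_gain:
  assumes k: "k \<ge> 2"
  obtains t l where "1 \<le> l" "l < k" "gain k t l \<ge> A"
proof -
  obtain n :: nat where n: "real k * A \<le> real n" using real_arch_simple by blast
  define t where "t = k * n"
  have "\<exists>l\<in>{1..<k}. gain k t l \<ge> A"
  proof (rule ccontr)
    assume "\<not> ?thesis"
    then have "(\<Sum>l\<in>{1..<k}. gain k t l) < (\<Sum>l\<in>{1..<k}. A)"
      using k by (intro sum_strict_mono) (auto simp: not_le)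
    then have "real n * (real k - 1) < (real k - 1) * A"
      using k unfolding sum_gain[OF k] by (simp add: t_def of_nat_diff)
    then have nA: "real n < A" using k by (simp add: mult.commute)
    then have "A > 0" by linarith
    then have "A \<le> real k * A" using k by simp
    then show False using n nA by linarith
  qed
  then show ?thesis using that by auto
qed

text \<open>The factor (2l+1)/(2l) is smallest for l = k, so one count of refinements serves all
  levels. For \<open>c\<close> stands a bound on the ratio of the scales to be bridged.\<close>

lemma exists_iteration_count:
  fixes k c :: nat
  assumes k: "k \<ge> 1"
  obtains n where "\<And>l. 1 \<le> l \<Longrightarrow> l \<le> k \<Longrightarrow> c * (2 * l) ^ n \<le> (2 * l + 1) ^ n"
proof -
  have "(1::real) < (2 * real k + 1) / (2 * real k)" using k by simp
  then obtain n where n: "real c < ((2 * real k + 1) / (2 * real k)) ^ n" using real_arch_pow by blast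
  have "c * (2 * l) ^ n \<le> (2 * l + 1) ^ n" if l: "1 \<le> l" "l \<le> k" for l
  proof -
    have "(2 * real k + 1) / (2 * real k) \<le> (2 * real l + 1) / (2 * real l)"
      using l by (simp add: field_simps)
    then have "((2 * real k + 1) / (2 * real k)) ^ n \<le> ((2 * real l + 1) / (2 * real l)) ^ n"
      by (intro power_mono) auto
    then have "real c \<le> (2 * real l + 1) ^ n / (2 * real l) ^ n" using n by (simp add: power_divide)
    then have "real c * (2 * real l) ^ n \<le> (2 * real l + 1) ^ n" using l by (simp add: field_simps)
    then have "real (c * (2 * l) ^ n) \<le> real ((2 * l + 1) ^ n)" by (simp add: add.commute)
    then show ?thesis by (simp only: of_nat_le_iff)
  qed
  then show ?thesis using that by blast
qed

text \<open>One round of the induction: Hoelder's inequality relates the bilinear quantity of level \<open>l\<close> to those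
  of the levels \<open>k - l\<close> and \<open>l - 1\<close>, and lower degree decoupling brings their scales back to the
  normal position \<open>a = (k - l + 1) b / l\<close>.\<close>

lemma bil_bootstrap_step:
  assumes p: "prime p" "p > int k" and l: "1 \<le> l" "l < k"
    and dvd: "2 * fact k * k dvd b" and b: "0 < b" "(k + 1) ^ 2 * b \<le> j"
    and a: "a = (k - l + 1) * b div l"  and dvda: "2 * fact k dvd a"
    and D: "\<And>l i. 1 \<le> l \<Longrightarrow> l < k \<Longrightarrow> i \<le> j \<Longrightarrow> dec p l i D" "D \<ge> 1"
    and n: "\<And>l. 1 \<le> l \<Longrightarrow> l \<le> k \<Longrightarrow> (k + 1) ^ 2 * (2 * l) ^ n \<le> (2 * l + 1) ^ n"
    and B1: "bil p k (k - l) j ((l + 1) * a div (k - l)) a B1" "B1 \<ge> 0"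
    and B2: "l \<noteq> 1 \<Longrightarrow> bil p k (l - 1) j ((k - l + 2) * b div (l - 1)) b B2" "l = 1 \<Longrightarrow> bil p k 0 j a b B2" "B2 \<ge> 0"
    and B: "D ^ n * B1 * (D ^ n * B2) ^ (k - l) \<le> B ^ (k - l + 1)" "B \<ge> 0"
  shows "bil p k l j a b B"
proof -
  have p1: "p > 1" using p(1) by (rule prime_gt_1_int)
  have fk: "i dvd fact k" if "1 \<le> i" "i \<le> k" for i :: nat using that by (simp add: dvd_fact)
  have kf: "k \<le> fact k" by (rule fact_ge_self)
  have D0: "D \<ge> 0" using D(2) by simp
  \<comment> \<open>The division in \<open>a\<close> is exact because \<open>l\<close> divides
    \<open>fact k\<close> and hence \<open>b\<close>.\<close>
  have la: "l * a = (k - l + 1) * b"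
  proof -
    have "l dvd fact k" by (rule fk) (use l in auto)
    then have "l dvd b" using dvd by (meson dvd_mult dvd_mult2 dvd_trans)
    then have "l dvd (k - l + 1) * b" by simp
    then show ?thesis unfolding a by simp
  qed
  have a0: "a > 0" using la b(1) l by (metis add_gr_0 less_one mult_0_right mult_is_0 neq0_conv not_less_zero)
  have a2k: "2 * k \<le> a" using dvd_imp_le[OF dvda a0] kf by linarith
  have b2k: "2 * k \<le> b"
  proof -
    have "2 * fact k \<le> b" using dvd b(1) by (meson dvd_imp_le dvd_mult_left)
    then show ?thesis using kf by linarith
  qed
  have ak: "a \<le> k * b"
  proof -
    have "a \<le> (k - l + 1) * b" unfolding a by simp
    also have "\<dots> \<le> k * b" using l by (intro mult_le_mono1) linarith
    finally show ?thesis .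
  qed
  have bla: "b \<le> l * a" unfolding la by simp
  have kb: "k * b \<le> j" "b \<le> j" "k * (k * b) \<le> j"
  proof -
    have "k * (k * b) \<le> (k + 1) ^ 2 * b" by (simp add: power2_eq_square algebra_simps)
    then show 1: "k * (k * b) \<le> j" using b(2) by linarith
    have "1 \<le> k" using l by linarith
    then have "b \<le> k * b" "k * b \<le> k * (k * b)" by simp_all
    then show "k * b \<le> j" "b \<le> j" using 1 by linarith+
  qed
  have aj: "a \<le> j" using ak kb by linarith
  define a1 where "a1 = (l + 1) * a div (k - l)"
  have a1: "(k - l) * a1 = (l + 1) * a"
  proof -
    have "(k - l) dvd fact k" by (rule fk) (use l in auto)
    then have "(k - l) dvd a" using dvda by (meson dvd_mult dvd_trans)
    then have "(k - l) dvd (l + 1) * a" by (rule dvd_mult)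
    then show ?thesis unfolding a1_def by (rule dvd_mult_div_cancel)
  qed
  have a1k: "a1 \<le> k * (k * b)"
  proof -
    have "a1 \<le> (l + 1) * a" unfolding a1_def by simp
    also have "\<dots> \<le> k * (k * b)" using l ak by (intro mult_le_mono) auto
    finally show ?thesis .
  qed
  have c: "k * k \<le> (k + 1) ^ 2" "(k + 1) * k \<le> (k + 1) ^ 2" by (auto simp: power2_eq_square)
  \<comment> \<open>At level \<open>k - l\<close> the arc of scale \<open>b\<close> comes first; it
    is refined until it reaches its normal position \<open>a1\<close> relative to the scale
    \<open>a\<close>.\<close>
  have I1: "bil p k (k - l) j b a (D ^ n * B1)"
  proof (rule bil_iterate[OF p, where a' = a1])
    show "b \<le> a1"
    proof -
      have "(k - l) * l * b \<le> (l + 1) * (k - l + 1) * b" by (intro mult_le_mono1) (simp add: algebra_simps)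
      also have "\<dots> = (l + 1) * (l * a)" unfolding la by (simp only: mult.assoc)
      also have "\<dots> = l * ((k - l) * a1)" unfolding a1 by (simp only: mult_ac)
      finally have "((k - l) * l) * b \<le> ((k - l) * l) * a1" by (simp only: mult_ac)
      then show ?thesis using l by simp
    qed
    show "(k - l) * a1 \<le> (k - (k - l) + 1) * a" unfolding a1 using l by simp
    show "a1 * (2 * (k - l)) ^ n \<le> (2 * (k - l) + 1) ^ n * b"
    proof -
      have "a1 \<le> (k + 1) ^ 2 * b" by (rule order_trans[OF a1k mult_le_mono1[OF c(1), of b, unfolded mult.assoc]])
      then have "a1 * (2 * (k - l)) ^ n \<le> ((k + 1) ^ 2 * b) * (2 * (k - l)) ^ n" by (rule mult_le_mono1)
      also have "\<dots> = ((k + 1) ^ 2 * (2 * (k - l)) ^ n) * b" by (simp only: mult_ac)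
      also have "\<dots> \<le> (2 * (k - l) + 1) ^ n * b" using n[of "k - l"] l by (intro mult_le_mono1) auto
      finally show ?thesis .
    qed
    show "bil p k (k - l) j a1 a B1" using B1(1) unfolding a1_def .
  qed (use l D D0 a1k kb aj B1 b2k in auto)
  \<comment> \<open>At level \<open>l - 1\<close> the first arc is refined from \<open>a\<close> to
    its normal position relative to \<open>b\<close>. Level 0 has no first arc to refine.\<close>
  have I2: "bil p k (l - 1) j a b (D ^ n * B2)"
  proof (cases "l = 1")
    case True
    have "B2 \<le> D ^ n * B2" using D(2) B2(3) by (simp add: mult_le_cancel_right1)
    then show ?thesis using B2(2)[OF True] bil_mono True by simp
  next
    case False
    define a2 where "a2 = (k - l + 2) * b div (l - 1)"
    have a2: "(l - 1) * a2 = (k - l + 2) * b"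
    proof -
      have "(l - 1) dvd fact k" by (rule fk) (use l False in auto)
      then have "(l - 1) dvd b" using dvd by (meson dvd_mult dvd_mult2 dvd_trans)
      then have "(l - 1) dvd (k - l + 2) * b" by (rule dvd_mult)
      then show ?thesis unfolding a2_def by (rule dvd_mult_div_cancel)
    qed
    have a2k: "a2 \<le> k * b"
    proof -
      have "a2 \<le> (k - l + 2) * b" unfolding a2_def by simp
      also have "\<dots> \<le> k * b" using l False by (intro mult_le_mono1) linarith
      finally show ?thesis .
    qed
    show ?thesis
    proof (rule bil_iterate[OF p, where a' = a2])
      show "a \<le> a2"
      proof -
        have "l * (l - 1) * a = (l - 1) * ((k - l + 1) * b)" unfolding la[symmetric] by (simp only: mult_ac)
        also have "\<dots> \<le> l * ((k - l + 2) * b)" by (intro mult_le_mono) auto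
        also have "\<dots> = l * (l - 1) * a2" unfolding a2[symmetric] by (simp only: mult_ac)
        finally show ?thesis using l False by simp
      qed
      have "k - (l - 1) + 1 = k - l + 2" using l False by linarith
      then show "(l - 1) * a2 \<le> (k - (l - 1) + 1) * b" unfolding a2 by simp
      show "a2 * (2 * (l - 1)) ^ n \<le> (2 * (l - 1) + 1) ^ n * a"
      proof -
        have "k * b \<le> k * (k * a)" using bla l mult_le_mono1[of l k a] by (intro mult_le_mono2) linarith
        from order_trans[OF a2k order_trans[OF this mult_le_mono1[OF c(1), of a, unfolded mult.assoc]]]
        have "a2 \<le> (k + 1) ^ 2 * a" .
        then have "a2 * (2 * (l - 1)) ^ n \<le> ((k + 1) ^ 2 * a) * (2 * (l - 1)) ^ n" by (rule mult_le_mono1)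
        also have "\<dots> = ((k + 1) ^ 2 * (2 * (l - 1)) ^ n) * a" by (simp only: mult_ac)
        also have "\<dots> \<le> (2 * (l - 1) + 1) ^ n * a" using n[of "l - 1"] l False by (intro mult_le_mono1) auto
        finally show ?thesis .
      qed
      show "bil p k (l - 1) j a2 b B2" using B2(1)[OF False] unfolding a2_def .
      show "1 \<le> l - 1" using l False by linarith
      show "2 * (l - 1) \<le> a" using a2k l \<open>2 * k \<le> a\<close> by linarith
    qed (use l D D0 a2k kb B2 False in auto)
  qed
  show ?thesis
    by (rule bil_holder_le[OF p1 l B(2) B(1) _ _ I1 I2]) (use D0 B1 B2 in auto)
qed

lemma uniform_lower_decoupling:
  assumes p: "p > 1" and low: "\<And>l. 1 \<le> l \<Longrightarrow> l < k \<Longrightarrow> decexp p l \<epsilon>" and \<epsilon>: "\<epsilon> \<ge> 0"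
  obtains C where "C \<ge> 1" "\<And>l i j. 1 \<le> l \<Longrightarrow> l < k \<Longrightarrow> i \<le> j \<Longrightarrow> dec p l i (C * of_int p powr (\<epsilon> * real j))"
proof -
  have "\<forall>l\<in>{1..<k}. \<exists>C\<ge>1. \<forall>j. dec p l j (C * of_int p powr (\<epsilon> * real j))"
    using low unfolding decexp_def by auto
  then obtain C where C: "\<And>l. l \<in> {1..<k} \<Longrightarrow> C l \<ge> 1"
    "\<And>l j. l \<in> {1..<k} \<Longrightarrow> dec p l j (C l * of_int p powr (\<epsilon> * real j))" by metis
  define C' where "C' = 1 + (\<Sum>l\<in>{1..<k}. C l)"
  have s0: "(\<Sum>l\<in>{1..<k}. C l) \<ge> 0" using C(1) by (intro sum_nonneg) (meson order_trans zero_le_one)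
  show ?thesis
  proof (rule that[of C'])
    show "C' \<ge> 1" unfolding C'_def using s0 by simp
    fix l i j :: nat assume l: "1 \<le> l" "l < k" and ij: "i \<le> j"
    have "C l \<le> (\<Sum>l\<in>{1..<k}. C l)" using l C(1) by (intro member_le_sum) (auto intro: order_trans[OF zero_le_one])
    then have "C l \<le> C'" unfolding C'_def by simp
    then have "C l * of_int p powr (\<epsilon> * real i) \<le> C' * of_int p powr (\<epsilon> * real j)"
      using ij p \<epsilon> C(1)[of l] l by (intro mult_mono powr_mono) (auto intro: mult_left_mono)
    then show "dec p l i (C' * of_int p powr (\<epsilon> * real j))" using C(2)[of l i] l dec_mono by auto
  qed
qed

text \<open>The power of \<open>2 * fact k * k\<close> that divides \<open>b\<close> keeps the
  scales of all rounds integral, and \<open>(k + 1) ^ (2 * t + 2) * b \<le> j\<close> keeps them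
  below \<open>j\<close>. Decoupling in lower degrees has arbitrarily small rate, so its losses go
  into \<open>\<epsilon>\<close>: half is spent on the previous rounds, half on the present
  one.\<close>

lemma bil_bootstrap:
  assumes p: "prime p" "p > int k" and low: "\<And>l \<epsilon>. 1 \<le> l \<Longrightarrow> l < k \<Longrightarrow> \<epsilon> > 0 \<Longrightarrow> decexp p l \<epsilon>"
    and C0: "C0 \<ge> 1" "\<And>j. dec p k j (C0 * of_int p powr (\<eta> * real j))" and \<eta>: "\<eta> \<ge> 0"
  shows "1 \<le> l \<Longrightarrow> l < k \<Longrightarrow> \<epsilon> > 0 \<Longrightarrow> \<exists>C\<ge>1. \<forall>j b. (2 * fact k * k) ^ (t + 1) dvd b \<longrightarrow> 0 < b \<longrightarrow>
    (k + 1) ^ (2 * t + 2) * b \<le> j \<longrightarrow> bil p k l j ((k - l + 1) * b div l) b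
      (C * of_int p powr (\<eta> * real j - \<eta> * gain k t l * real b + \<epsilon> * real j))"
proof (induction t arbitrary: l \<epsilon>)
  case 0
  have p1: "p > 1" using p(1) by (rule prime_gt_1_int)
  show ?case
  proof (rule exI[of _ C0], intro conjI allI impI C0(1))
    fix j b assume b: "(0::nat) < b" "(k + 1) ^ (2 * 0 + 2) * b \<le> j"
    have "(k - l + 1) * b div l \<le> (k - l + 1) * b" by simp
    also have "\<dots> \<le> (k + 1) * b" by (intro mult_le_mono1) simp
    also have "\<dots> \<le> (k + 1) ^ 2 * b" by (intro mult_le_mono1) (simp add: power2_eq_square)
    also have b2: "\<dots> \<le> j" using b(2) by (simp only: mult_0_right add_0)
    finally have a: "(k - l + 1) * b div l \<le> j" .
    have "1 * b \<le> (k + 1) ^ 2 * b" by (intro mult_le_mono1 one_le_power) simp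
    then have bj: "b \<le> j" using b2 by linarith
    have D: "dec p k (j - i) (C0 * of_int p powr (\<eta> * real j + \<epsilon> * real j))" for i
    proof (rule dec_mono[OF C0(2)])
      show "C0 * of_int p powr (\<eta> * real (j - i)) \<le> C0 * of_int p powr (\<eta> * real j + \<epsilon> * real j)"
        using C0(1) p1 \<eta> 0(3) by (intro mult_left_mono powr_mono add_increasing2 mult_left_mono) auto
    qed
    show "bil p k l j ((k - l + 1) * b div l) b (C0 * of_int p powr (\<eta> * real j - \<eta> * gain k 0 l * real b + \<epsilon> * real j))"
      using bil_trivial[OF p1 _ _ D D _ a bj, of l] 0 C0(1) by simp
  qed
next
  case (Suc t)
  have p1: "p > 1" using p(1) by (rule prime_gt_1_int)
  define P where "P = (of_int p :: real)"
  have P: "P > 1" using p1 by (simp add: P_def)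
  note l = Suc.prems(1,2) and \<epsilon> = Suc.prems(3)
  have k: "k \<ge> 1" using l by linarith
  obtain n where n: "\<And>l. 1 \<le> l \<Longrightarrow> l \<le> k \<Longrightarrow> (k + 1) ^ 2 * (2 * l) ^ n \<le> (2 * l + 1) ^ n"
    using exists_iteration_count[OF k] by blast
  \<comment> \<open>Up to \<open>n\<close> refinements at rate \<open>\<delta>\<close> together may
    lose the rate \<open>\<epsilon> / 2\<close>.\<close>
  define \<delta> where "\<delta> = \<epsilon> / (2 * (real n + 1))"
  have \<delta>: "\<delta> > 0" unfolding \<delta>_def using \<epsilon> by simp
  have n\<delta>: "real n * \<delta> \<le> \<epsilon> / 2" unfolding \<delta>_def using \<epsilon> by (simp add: field_simps)
  obtain C' where C': "C' \<ge> 1" "\<And>l i j. 1 \<le> l \<Longrightarrow> l < k \<Longrightarrow> i \<le> j \<Longrightarrow> dec p l i (C' * P powr (\<delta> * real j))"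
    using uniform_lower_decoupling[OF p1 low[OF _ _ \<delta>]] \<delta> unfolding P_def by (metis less_imp_le)
  define N where "N = k - l"
  have e2: "\<epsilon> / 2 > 0" using \<epsilon> by simp
  have N1: "1 \<le> N" "N < k" unfolding N_def using l by auto
  let ?L = "2 * fact k * k :: nat"
  obtain C1 where C1: "C1 \<ge> 1" "\<And>j b. ?L ^ (t + 1) dvd b \<Longrightarrow> 0 < b \<Longrightarrow>
    (k + 1) ^ (2 * t + 2) * b \<le> j \<Longrightarrow> bil p k N j ((k - N + 1) * b div N) b
      (C1 * P powr (\<eta> * real j - \<eta> * gain k t N * real b + \<epsilon> / 2 * real j))"
    using Suc.IH[OF N1 e2] unfolding P_def by blast
  have "\<exists>C2\<ge>1. \<forall>j b a. ?L ^ (t + 1) dvd b \<longrightarrow> 0 < b \<longrightarrow> (k + 1) ^ (2 * t + 2) * b \<le> j \<longrightarrow>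
      (l \<noteq> 1 \<longrightarrow> bil p k (l - 1) j ((k - l + 2) * b div (l - 1)) b
        (C2 * P powr (\<eta> * real j - \<eta> * gain k t (l - 1) * real b + \<epsilon> / 2 * real j))) \<and>
      (l = 1 \<longrightarrow> bil p k 0 j a b
        (C2 * P powr (\<eta> * real j - \<eta> * gain k t (l - 1) * real b + \<epsilon> / 2 * real j)))"
  proof (cases "l = 1")
    case True
    show ?thesis
    proof (rule exI[of _ C0], intro conjI allI impI C0(1))
      fix j b a assume b: "(k + 1) ^ (2 * t + 2) * b \<le> j"
      have "1 * b \<le> (k + 1) ^ (2 * t + 2) * b" by (intro mult_le_mono1 one_le_power) simp
      then have bj: "b \<le> j" using b by linarith
      have "bil p k 0 j a b (C0 * P powr (\<eta> * real (j - b)))"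
        unfolding P_def by (rule bil_zero[OF p1 k C0(2)]) (use C0(1) bj in auto)
      moreover have "C0 * P powr (\<eta> * real (j - b)) \<le>
        C0 * P powr (\<eta> * real j - \<eta> * gain k t (l - 1) * real b + \<epsilon> / 2 * real j)"
        using C0(1) P bj \<epsilon> True by (intro mult_left_mono powr_mono) (auto simp: of_nat_diff algebra_simps)
      ultimately show "bil p k 0 j a b (C0 * P powr (\<eta> * real j - \<eta> * gain k t (l - 1) * real b + \<epsilon> / 2 * real j))"
        by (rule bil_mono)
    qed (use True in auto)
  next
    case False
    then have l1: "1 \<le> l - 1" "l - 1 < k" "k - (l - 1) + 1 = k - l + 2" using l by auto
    from Suc.IH[OF l1(1,2) e2] show ?thesis unfolding l1(3) P_def using False by blast
  qed
  then obtain C2 where C2: "C2 \<ge> 1" "\<And>j b a. ?L ^ (t + 1) dvd b \<Longrightarrow> 0 < b \<Longrightarrow> (k + 1) ^ (2 * t + 2) * b \<le> j \<Longrightarrow> l \<noteq> 1 \<Longrightarrow>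
      bil p k (l - 1) j ((k - l + 2) * b div (l - 1)) b
        (C2 * P powr (\<eta> * real j - \<eta> * gain k t (l - 1) * real b + \<epsilon> / 2 * real j))"
    "\<And>j b a. ?L ^ (t + 1) dvd b \<Longrightarrow> 0 < b \<Longrightarrow> (k + 1) ^ (2 * t + 2) * b \<le> j \<Longrightarrow> l = 1 \<Longrightarrow> bil p k 0 j a b
        (C2 * P powr (\<eta> * real j - \<eta> * gain k t (l - 1) * real b + \<epsilon> / 2 * real j))" by blast
  define C where "C = C' ^ n * C1 * C2"
  have C'n: "C' ^ n \<ge> 1" using C'(1) by simp
  have Cge: "C \<ge> 1"
  proof -
    have "1 * 1 * 1 \<le> C' ^ n * C1 * C2" using C'n C1(1) C2(1) by (intro mult_mono) auto
    then show ?thesis unfolding C_def by simp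
  qed
  show ?case
  proof (rule exI[of _ C], intro conjI allI impI Cge)
    fix j b assume dvd: "?L ^ (Suc t + 1) dvd b" and b: "0 < b" "(k + 1) ^ (2 * Suc t + 2) * b \<le> j"
    define a where "a = (k - l + 1) * b div l"
    from dvd obtain b' where b': "b = ?L ^ (Suc t + 1) * b'" by blast
    have "l dvd fact k" using l by (simp add: dvd_fact)
    then have "l dvd ?L" by (meson dvd_mult dvd_mult2)
    then obtain m where m: "?L = l * m" by blast
    have "?L ^ (Suc t + 1) = ?L * ?L ^ (t + 1)" by (simp only: add_Suc power_Suc)
    also have "\<dots> = l * m * ?L ^ (t + 1)" using m by (rule arg_cong)
    finally have bb: "b = l * (?L ^ (t + 1) * (m * b'))" unfolding b' by (simp only: mult_ac)
    have aa: "a = ?L ^ (t + 1) * ((k - l + 1) * m * b')"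
    proof -
      have "(k - l + 1) * b = (?L ^ (t + 1) * ((k - l + 1) * m * b')) * l" unfolding bb by (simp only: mult_ac)
      then show ?thesis unfolding a_def using l by (metis nonzero_mult_div_cancel_right not_one_le_zero)
    qed
    have la: "l * a = (N + 1) * b" unfolding aa N_def by (subst bb) (simp only: mult_ac)
    have dvda: "?L ^ (t + 1) dvd a" unfolding aa by simp
    have dvdb: "?L ^ (t + 1) dvd b" using dvd by (meson dvd_trans le_imp_power_dvd add_le_mono1 le_SucI order_refl)
    have a0: "a > 0" using la b(1) l by (metis add_gr_0 less_one mult_0_right mult_is_0 neq0_conv not_less_zero)
    have akb: "a \<le> (k + 1) * b"
    proof -
      have "a \<le> (k - l + 1) * b" unfolding a_def by simp
      also have "\<dots> \<le> (k + 1) * b" by (intro mult_le_mono1) simp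
      finally show ?thesis .
    qed
    have pw: "(k + 1) ^ (2 * Suc t + 2) = (k + 1) ^ (2 * t + 2) * (k + 1) ^ 2"
      by (simp only: power_add[symmetric]) simp
    have ja: "(k + 1) ^ (2 * t + 2) * a \<le> j"
    proof -
      have "(k + 1) ^ (2 * t + 2) * a \<le> (k + 1) ^ (2 * t + 2) * ((k + 1) * b)" using akb by (rule mult_le_mono2)
      also have "\<dots> \<le> (k + 1) ^ (2 * t + 2) * ((k + 1) ^ 2 * b)"
        by (intro mult_le_mono2 mult_le_mono1) (simp add: power2_eq_square)
      finally show ?thesis using b(2) unfolding pw by (simp only: mult.assoc)
    qed
    have jb: "(k + 1) ^ (2 * t + 2) * b \<le> j"
    proof -
      have "(k + 1) ^ (2 * t + 2) * b * 1 \<le> (k + 1) ^ (2 * t + 2) * b * (k + 1) ^ 2" by (intro mult_le_mono2 one_le_power) simp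
      then show ?thesis using b(2) unfolding pw by (simp only: mult_ac)
    qed
    have jb2: "(k + 1) ^ 2 * b \<le> j"
    proof -
      have "1 * ((k + 1) ^ 2 * b) \<le> (k + 1) ^ (2 * t + 2) * ((k + 1) ^ 2 * b)" by (intro mult_le_mono1 one_le_power) simp
      then show ?thesis using b(2) unfolding pw by (simp only: mult.assoc)
    qed
    have Lb: "?L dvd b" using dvdb by (metis dvd_mult_left power_Suc Suc_eq_plus1)
    have La: "2 * fact k dvd a" using dvda by (metis dvd_mult_left power_Suc Suc_eq_plus1)
    define g1 where "g1 = gain k t N"
    define g2 where "g2 = gain k t (l - 1)"
    define g where "g = gain k (Suc t) l"
    \<comment> \<open>The relation \<open>l * a = (N + 1) * b\<close> expresses the gain at scale
      \<open>a\<close> in terms of \<open>b\<close>; with the recursion of \<open>gain\<close> it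
      makes the exponents \<open>X1\<close> and \<open>X2\<close> combine to
      \<open>X\<close>.\<close>
    have g: "g * real b * (real N + 1) = g1 * real a + real N * g2 * real b"
    proof -
      have ra: "real l * real a = (real N + 1) * real b" using la by (metis of_nat_Suc of_nat_mult Suc_eq_plus1 add.commute)
      have g': "g = g1 / l + real N / real (N + 1) * g2" using l by (simp add: g_def g1_def g2_def N_def)
      have "g1 / l * real b * (real N + 1) = g1 * ((real N + 1) * real b) / l" by simp
      also have "\<dots> = g1 * real a" unfolding ra[symmetric] using l by simp
      finally show ?thesis unfolding g' using of_nat_0_le_iff[of N] by (simp add: distrib_right add.commute)
    qed
    define D where "D = C' * P powr (\<delta> * real j)"
    have D1: "D \<ge> 1"
    proof -
      have "P powr (\<delta> * real j) \<ge> 1" using P \<delta> by (intro ge_one_powr_ge_zero) auto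
      then have "1 * 1 \<le> C' * P powr (\<delta> * real j)" using C'(1) by (intro mult_mono) auto
      then show ?thesis unfolding D_def by simp
    qed
    have Dn: "D ^ n \<le> C' ^ n * P powr (\<epsilon> / 2 * real j)"
    proof -
      have "D ^ n = C' ^ n * P powr (real n * \<delta> * real j)"
        unfolding D_def using P by (simp add: power_mult_distrib powr_realpow[symmetric] powr_powr mult_ac del: powr_realpow')
      also have "\<dots> \<le> C' ^ n * P powr (\<epsilon> / 2 * real j)"
        using C'n P n\<delta> by (intro mult_left_mono powr_mono mult_right_mono) auto
      finally show ?thesis .
    qed
    define X1 where "X1 = \<eta> * real j - \<eta> * g1 * real a + \<epsilon> * real j"
    define X2 where "X2 = \<eta> * real j - \<eta> * g2 * real b + \<epsilon> * real j"
    define X where "X = \<eta> * real j - \<eta> * g * real b + \<epsilon> * real j"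
    define B1 where "B1 = C1 * P powr (\<eta> * real j - \<eta> * g1 * real a + \<epsilon> / 2 * real j)"
    define B2 where "B2 = C2 * P powr (\<eta> * real j - \<eta> * g2 * real b + \<epsilon> / 2 * real j)"
    have B0: "B1 \<ge> 0" "B2 \<ge> 0" unfolding B1_def B2_def using C1(1) C2(1) by auto
    have DB1: "D ^ n * B1 \<le> C' ^ n * C1 * P powr X1"
    proof -
      have "D ^ n * B1 \<le> (C' ^ n * P powr (\<epsilon> / 2 * real j)) * B1" by (intro mult_right_mono Dn B0)
      also have "\<dots> = C' ^ n * C1 * (P powr (\<epsilon> / 2 * real j) * P powr (\<eta> * real j - \<eta> * g1 * real a + \<epsilon> / 2 * real j))"
        unfolding B1_def by (simp only: mult_ac)
      also have "\<dots> = C' ^ n * C1 * P powr X1" unfolding powr_add[symmetric] X1_def by (simp add: algebra_simps)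
      finally show ?thesis .
    qed
    have DB2: "D ^ n * B2 \<le> C' ^ n * C2 * P powr X2"
    proof -
      have "D ^ n * B2 \<le> (C' ^ n * P powr (\<epsilon> / 2 * real j)) * B2" by (intro mult_right_mono Dn B0)
      also have "\<dots> = C' ^ n * C2 * (P powr (\<epsilon> / 2 * real j) * P powr (\<eta> * real j - \<eta> * g2 * real b + \<epsilon> / 2 * real j))"
        unfolding B2_def by (simp only: mult_ac)
      also have "\<dots> = C' ^ n * C2 * P powr X2" unfolding powr_add[symmetric] X2_def by (simp add: algebra_simps)
      finally show ?thesis .
    qed
    have "D ^ n * B1 * (D ^ n * B2) ^ N \<le> (C' ^ n * C1 * P powr X1) * (C' ^ n * C2 * P powr X2) ^ N"
      using D1 B0 C'n C1(1) by (intro mult_mono power_mono DB1 DB2) auto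
    also have "\<dots> \<le> (C * P powr X1) * (C * P powr X2) ^ N"
    proof -
      have "C' ^ n * C1 \<le> C" "C' ^ n * C2 \<le> C"
        unfolding C_def using C'n C1(1) C2(1) by (auto simp: mult_le_cancel_left1 mult.assoc intro!: mult_left_mono)
      then show ?thesis using C'n C1(1) C2(1) Cge by (intro mult_mono power_mono mult_right_mono) auto
    qed
    also have "\<dots> = C ^ (N + 1) * P powr (X1 + real N * X2)"
      using P by (simp add: power_mult_distrib powr_realpow[symmetric] powr_powr powr_add mult_ac del: powr_realpow')
    also have "X1 + real N * X2 = (real N + 1) * X"
    proof -
      have "X1 + real N * X2 = (real N + 1) * (\<eta> * real j + \<epsilon> * real j) - \<eta> * (g1 * real a + real N * g2 * real b)"
        unfolding X1_def X2_def by (simp add: algebra_simps)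
      also have "\<dots> = (real N + 1) * X" unfolding g[symmetric] X_def by (simp add: algebra_simps)
      finally show ?thesis .
    qed
    also have "C ^ (N + 1) * P powr ((real N + 1) * X) = (C * P powr X) ^ (N + 1)"
      using P by (simp add: power_mult_distrib powr_realpow[symmetric] powr_powr powr_add algebra_simps del: powr_realpow')
    finally have fin: "D ^ n * B1 * (D ^ n * B2) ^ (k - l) \<le> (C * P powr X) ^ (k - l + 1)" unfolding N_def .
    have "bil p k l j a b (C * P powr X)"
    proof (rule bil_bootstrap_step[OF p l Lb b(1) jb2 a_def La _ D1 n _ B0(1) _ _ B0(2) fin])
      show "dec p l' i D" if "1 \<le> l'" "l' < k" "i \<le> j" for l' i unfolding D_def using C'(2)[OF that] .
      have "k - N + 1 = l + 1" using l by (simp add: N_def)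
      then show "bil p k (k - l) j ((l + 1) * a div (k - l)) a B1"
        using C1(2)[OF dvda a0 ja] unfolding B1_def g1_def N_def by simp
      show "bil p k (l - 1) j ((k - l + 2) * b div (l - 1)) b B2" if "l \<noteq> 1"
        using C2(2)[OF dvdb b(1) jb that] unfolding B2_def g2_def .
      show "bil p k 0 j a b B2" if "l = 1"
        using C2(3)[OF dvdb b(1) jb that] unfolding B2_def g2_def .
    qed (use Cge in auto)
    then show "bil p k l j ((k - l + 1) * b div l) b
      (C * of_int p powr (\<eta> * real j - \<eta> * gain k (Suc t) l * real b + \<epsilon> * real j))"
      unfolding a_def X_def g_def P_def .
  qed
qed

text \<open>The improvement \<open>\<kappa>\<close> depends on \<open>\<delta>\<close> but not on
  \<open>\<eta>\<close>, so finitely many repetitions bring the rate down to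
  \<open>\<delta>\<close>. The point is to run the bootstrap until the gain outweighs the loss of
  \<open>bil_coarsen\<close>. The maximum with \<open>\<delta> / 2\<close> keeps the rate positive,
  as \<open>decexp_of_bil\<close> demands.\<close>

lemma decexp_improve:
  assumes p: "prime p" "p > int k" and k: "k \<ge> 2" and low: "\<And>l \<epsilon>. 1 \<le> l \<Longrightarrow> l < k \<Longrightarrow> \<epsilon> > 0 \<Longrightarrow> decexp p l \<epsilon>"
    and \<delta>: "\<delta> > 0"
  shows "\<exists>\<kappa>>0. \<forall>\<eta>\<ge>\<delta>. decexp p k \<eta> \<longrightarrow> decexp p k (max (\<delta> / 2) (\<eta> - \<kappa>))"
proof -
  have p1: "p > 1" using p(1) by (rule prime_gt_1_int)
  define P where "P = (of_int p :: real)"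
  have P: "P > 1" using p1 by (simp add: P_def)
  \<comment> \<open>Since \<open>a + b \<le> (k + 1) * b\<close>, the exponent lost in
    \<open>bil_coarsen\<close> is at most \<open>\<Gamma> * b\<close>. A gain of
    \<open>(\<Gamma> + 1) / \<delta>\<close> pays for it and leaves \<open>b\<close> over.\<close>
  define \<Gamma> where "\<Gamma> = (2 * sK k + 1) * (k + 1)"
  obtain t l where l: "1 \<le> l" "l < k" and gain: "gain k t l \<ge> (real \<Gamma> + 1) / \<delta>"
    using exists_large_gain[OF k] by blast
  define L where "L = (2 * fact k * k :: nat) ^ (t + 1)"
  define \<Lambda> where "\<Lambda> = (k + 1) ^ (2 * t + 2)"
  define R where "R = \<Lambda> * L"
  have L0: "L > 0" and \<Lambda>0: "\<Lambda> > 0" unfolding L_def \<Lambda>_def using k by auto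
  then have R0: "R > 0" unfolding R_def by simp
  \<comment> \<open>Below, \<open>j \<le> 2 * (\<Lambda> * b)\<close>, so the remaining
    \<open>b\<close> is at least \<open>2 * \<kappa> * j\<close>: one half covers the loss
    \<open>\<kappa> * j\<close> of \<open>bil_bootstrap\<close>, the other half is the
    improvement.\<close>
  define \<kappa> where "\<kappa> = 1 / (4 * real \<Lambda>)"
  have \<kappa>: "\<kappa> > 0" unfolding \<kappa>_def using \<Lambda>0 by simp
  have "decexp p k (max (\<delta> / 2) (\<eta> - \<kappa>))" if \<eta>: "\<eta> \<ge> \<delta>" and de: "decexp p k \<eta>" for \<eta>
  proof -
    have \<eta>0: "\<eta> \<ge> 0" using \<eta> \<delta> by simp
    obtain C0 where C0: "C0 \<ge> 1" "\<And>j. dec p k j (C0 * P powr (\<eta> * real j))"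
      using de unfolding decexp_def P_def by blast
    from bil_bootstrap[OF p low C0(1) C0(2)[unfolded P_def] \<eta>0 l \<kappa>, of t]
    obtain C where C: "C \<ge> 1" "\<And>j b. L dvd b \<Longrightarrow> 0 < b \<Longrightarrow> \<Lambda> * b \<le> j \<Longrightarrow> bil p k l j ((k - l + 1) * b div l) b
      (C * P powr (\<eta> * real j - \<eta> * gain k t l * real b + \<kappa> * real j))"
      unfolding L_def \<Lambda>_def P_def by blast
    define \<eta>' where "\<eta>' = max (\<delta> / 2) (\<eta> - \<kappa>)"
    have \<eta>': "\<eta>' > 0" "\<eta> - \<kappa> \<le> \<eta>'" unfolding \<eta>'_def using \<delta> by auto
    define B where "B = C + C0 * P powr (\<eta> * real R)"
    have BC: "B \<ge> C" "B \<ge> C0 * P powr (\<eta> * real R)" unfolding B_def using C(1) C0(1) by auto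
    have B0: "B \<ge> 0" using BC(1) C(1) by simp
    have "bil p k l j 1 1 (B * P powr (\<eta>' * real j))" if j: "1 \<le> j" for j
    proof (cases "R \<le> j")
      case True
      \<comment> \<open>The largest multiple of \<open>L\<close> with
        \<open>\<Lambda> * b \<le> j\<close>.\<close>
      define b where "b = L * (j div R)"
      have jR: "1 \<le> j div R" using True R0 by (simp add: Suc_leI div_greater_zero_iff)
      have b0: "0 < b" unfolding b_def using L0 jR by simp
      have \<Lambda>b: "\<Lambda> * b = R * (j div R)" unfolding b_def R_def by simp
      have bj: "\<Lambda> * b \<le> j" unfolding \<Lambda>b by simp
      have "j < R * (j div R) + R" using R0 by (metis add_strict_left_mono mod_less_divisor mult_div_mod_eq)
      also have "\<dots> \<le> 2 * (R * (j div R))" using jR by simp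
      finally have "j \<le> 2 * (\<Lambda> * b)" unfolding \<Lambda>b by simp
      then have "real j \<le> 2 * (real \<Lambda> * real b)" by (metis of_nat_le_iff of_nat_mult of_nat_numeral)
      then have bk: "2 * \<kappa> * real j \<le> real b" unfolding \<kappa>_def using \<Lambda>0 by (simp add: field_simps)
      define a where "a = (k - l + 1) * b div l"
      have "a \<le> (k - l + 1) * b" unfolding a_def by simp
      also have "\<dots> \<le> k * b" using l by (intro mult_le_mono1) linarith
      finally have akb: "a \<le> k * b" .
      have "l \<le> k * b" "l dvd b" 
      proof -
        have "l \<le> k * 1" using l by simp
        also have "\<dots> \<le> k * b" using b0 by (intro mult_le_mono2) simp
        finally show "l \<le> k * b" .
        have "l dvd fact k" using l by (simp add: dvd_fact)
        then have "l dvd 2 * fact k * k" by (meson dvd_mult dvd_mult2)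
        also have "2 * fact k * k dvd L" unfolding L_def by simp
        also have "L dvd b" unfolding b_def by simp
        finally show "l dvd b" .
      qed
      have "l * 1 \<le> l * ((k - l + 1) * (b div l))"
        using l \<open>l dvd b\<close> b0 by (intro mult_le_mono2) (auto simp: Suc_le_eq dvd_imp_le div_greater_zero_iff)
      then have a1: "1 \<le> a" unfolding a_def using l \<open>l dvd b\<close> by (simp add: div_mult_swap)
      have "(k + 1) * b \<le> \<Lambda> * b" unfolding \<Lambda>_def by (intro mult_le_mono1 self_le_power) auto
      then have kbj: "(k + 1) * b \<le> j" using bj by linarith
      have aj: "a \<le> j" "b \<le> j" using akb kbj by (auto simp: algebra_simps)
      define Y where "Y = \<eta> * real j - \<eta> * gain k t l * real b + \<kappa> * real j"
      have Ldvd: "L dvd b" unfolding b_def by simp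
      have bab: "bil p k l j a b (C * P powr Y)" unfolding a_def Y_def by (rule C(2)[OF Ldvd b0 bj])
      have "bil p k l j 1 1 (P ^ ((2 * sK k + 1) * (a + b)) * (C * P powr Y))"
        unfolding P_def by (rule bil_coarsen[OF p1 _ a1 _ aj bab[unfolded P_def]]) (use l b0 C(1) in auto)
      moreover have "P ^ ((2 * sK k + 1) * (a + b)) * (C * P powr Y) \<le> B * P powr (\<eta>' * real j)"
      proof -
        have "(2 * sK k + 1) * (a + b) \<le> (2 * sK k + 1) * ((k + 1) * b)" using akb by (intro mult_le_mono2) simp
        also have "\<dots> = \<Gamma> * b" unfolding \<Gamma>_def by (simp only: mult.assoc)
        finally have "P ^ ((2 * sK k + 1) * (a + b)) \<le> P ^ (\<Gamma> * b)" using P by (intro power_increasing) auto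
        also have "\<dots> = P powr (real \<Gamma> * real b)" using P by (simp add: powr_realpow[symmetric])
        finally have "P ^ ((2 * sK k + 1) * (a + b)) * (C * P powr Y) \<le> P powr (real \<Gamma> * real b) * (C * P powr Y)"
          using C(1) by (intro mult_right_mono) auto
        also have "\<dots> = C * P powr (real \<Gamma> * real b + Y)" by (simp add: powr_add)
        also have "\<dots> \<le> C * P powr (\<eta>' * real j)"
        proof (intro mult_left_mono powr_mono)
          have "(real \<Gamma> + 1) \<le> \<delta> * gain k t l" using gain \<delta> by (simp add: field_simps)
          also have "\<dots> \<le> \<eta> * gain k t l"
          proof (intro mult_right_mono \<eta>)
            have "0 \<le> (real \<Gamma> + 1) / \<delta>" using \<delta> by simp
            then show "0 \<le> gain k t l" using gain by linarith
          qed
          finally have "(real \<Gamma> + 1) * real b \<le> \<eta> * gain k t l * real b" by (intro mult_right_mono) auto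
          then have "real \<Gamma> * real b + Y \<le> \<eta> * real j - real b + \<kappa> * real j" unfolding Y_def by (simp add: algebra_simps)
          also have "\<dots> \<le> (\<eta> - \<kappa>) * real j" using bk by (simp add: algebra_simps)
          also have "\<dots> \<le> \<eta>' * real j" using \<eta>'(2) by (intro mult_right_mono) auto
          finally show "real \<Gamma> * real b + Y \<le> \<eta>' * real j" .
        qed (use P C(1) in auto)
        also have "\<dots> \<le> B * P powr (\<eta>' * real j)" by (intro mult_right_mono BC) auto
        finally show ?thesis .
      qed
      ultimately show ?thesis by (rule bil_mono)
    next
      case False
      \<comment> \<open>For \<open>j < R\<close> no scale is available, but then the constant
        \<open>B\<close> alone covers the decoupling constant.\<close>
      have D: "dec p k (j - 1) (B * P powr (\<eta>' * real j))"
      proof (rule dec_mono[OF C0(2)])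
        have "C0 * P powr (\<eta> * real (j - 1)) \<le> C0 * P powr (\<eta> * real R)"
          using C0(1) P \<eta>0 False by (intro mult_left_mono powr_mono mult_left_mono) auto
        also have "\<dots> \<le> B" by (rule BC)
        also have "B * 1 \<le> B * P powr (\<eta>' * real j)" using \<eta>' P B0 by (intro mult_left_mono ge_one_powr_ge_zero) auto
        finally show "C0 * P powr (\<eta> * real (j - 1)) \<le> B * P powr (\<eta>' * real j)" by simp
      qed
      show ?thesis by (rule bil_trivial[OF p1 _ _ D D]) (use k l j B0 in auto)
    qed
    then show ?thesis
      unfolding \<eta>'_def[symmetric] using decexp_of_bil[OF p1 _ _ \<eta>'(1) B0, of k l] k l unfolding P_def by simp
  qed
  then show ?thesis using \<kappa> by blast
qed

section \<open>Degree one and the induction on the degree\<close>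

lemma e_eq_1_imp_Ints:
  assumes "e z = 1"
  obtains n :: int where "z = of_int n"
proof -
  from assms obtain n :: int where "2 * pi * z = of_int (2 * n) * pi" unfolding e_def exp_eq_1 by auto
  then have "z = of_int n" by simp
  then show ?thesis using that by blast
qed

lemma e_minus: "e (- z) = cnj (e z)"
  unfolding e_def by (simp add: exp_cnj)

text \<open>In degree 1 decoupling is orthogonality: the shift by \<open>[:0, p ^ (M - j):]\<close>
  multiplies \<open>f c\<close> by the value of \<open>e\<close> at c/p^j. These values differ for
  distinct residues, so by translation invariance the cross terms vanish.\<close>

lemma dec_one:
  assumes p: "p > 1"
  shows "dec p 1 j 1"
  unfolding dec_def
proof (intro allI impI)
  fix M and f :: "int \<Rightarrow> int poly \<Rightarrow> complex"
  assume M: "1 * j \<le> M" and f: "\<forall>c\<in>{0..<p ^ j}. covar p 1 M j c (f c)"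
  let ?S = "{0..<p ^ j}" and ?X = "pols 1 (p ^ M)"
  have s: "sK 1 = 1" by (simp add: sK_def)
  have q: "p ^ M > 0" using p by simp
  define T where "T = (\<lambda>c c'. \<Sum>x\<in>?X. f c x * cnj (f c' x))"
  have T0: "T c c' = 0" if c: "c \<in> ?S" "c' \<in> ?S" "c \<noteq> c'" for c c'
  proof -
    define v where "v = [:0, p ^ (M - j):]"
    have pM: "p ^ M = p ^ (M - j) * p ^ j" using M by (simp add: power_add[symmetric])
    have sh: "f c (x + v) = e (of_int c / of_int (p ^ j)) * f c x" if "c \<in> ?S" for c x
    proof -
      have "[:p ^ M:] dvd pcompose v [:c, p ^ j:] - [:poly v c:]"
        by (simp add: v_def pcompose_pCons const_poly_dvd_iff coeff_pCons pM mult_ac split: nat.split)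
      moreover have "degree v \<le> 1" by (simp add: v_def)
      ultimately have "f c (x + v) = e (of_int (poly v c) / of_int (p ^ M)) * f c x"
        using f that unfolding covar_def by blast
      also have "of_int (poly v c) / of_int (p ^ M) = (of_int c / of_int (p ^ j) :: real)"
        using p by (simp add: v_def pM)
      finally show ?thesis .
    qed
    define \<omega> where "\<omega> = e (of_int (c - c') / of_int (p ^ j))"
    have per: "periodic 1 (p ^ M) (\<lambda>x. f c x * cnj (f c' x))"
      using f c p by (intro periodic_comp2[where g = "\<lambda>a b. a * cnj b"]) (auto intro!: covar_periodic)
    have "T c c' = (\<Sum>x\<in>?X. f c (x + v) * cnj (f c' (x + v)))"
      unfolding T_def by (rule sum_pols_shift[OF q per, symmetric]) (simp add: v_def)
    also have "\<dots> = \<omega> * T c c'"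
    proof -
      have "e (of_int c / of_int (p ^ j)) * cnj (e (of_int c' / of_int (p ^ j))) = \<omega>"
        unfolding \<omega>_def e_minus[symmetric] e_add[symmetric] by (simp add: diff_divide_distrib)
      then have "f c (x + v) * cnj (f c' (x + v)) = \<omega> * (f c x * cnj (f c' x))" for x
        unfolding sh[OF c(1)] sh[OF c(2)] complex_cnj_mult by (metis mult.assoc mult.left_commute)
      then show ?thesis unfolding T_def by (simp add: sum_distrib_left)
    qed
    finally have "T c c' = 0 \<or> \<omega> = 1" by simp
    moreover have "\<omega> \<noteq> 1"
    proof
      assume "\<omega> = 1"
      then obtain n :: int where n: "of_int (c - c') / of_int (p ^ j) = (of_int n :: real)"
        unfolding \<omega>_def by (rule e_eq_1_imp_Ints)
      then have "real_of_int (c - c') = of_int (n * p ^ j)" using p by (simp add: field_simps)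
      then have "c - c' = n * p ^ j" by (simp only: of_int_eq_iff)
      then have "c mod p ^ j = c' mod p ^ j" by (metis dvd_triv_right mod_eq_dvd_iff)
      then show False using c by simp
    qed
    ultimately show ?thesis by blast
  qed
  have "(of_real (\<Sum>x\<in>?X. norm (\<Sum>c\<in>?S. f c x) ^ 2) :: complex) = (\<Sum>x\<in>?X. (\<Sum>c\<in>?S. f c x) * cnj (\<Sum>c\<in>?S. f c x))"
    by (simp only: of_real_sum complex_norm_square)
  also have "\<dots> = (\<Sum>x\<in>?X. \<Sum>c\<in>?S. \<Sum>c'\<in>?S. f c x * cnj (f c' x))"
    by (simp only: cnj_sum sum_product)
  also have "\<dots> = (\<Sum>c\<in>?S. \<Sum>c'\<in>?S. T c c')"
    unfolding T_def by (subst sum.swap, intro sum.cong refl sum.swap)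
  also have "\<dots> = (\<Sum>c\<in>?S. T c c)"
  proof (intro sum.cong refl)
    fix c assume c: "c \<in> ?S"
    have "(\<Sum>c'\<in>?S. T c c') = (\<Sum>c'\<in>{c}. T c c')"
      by (rule sum.mono_neutral_right) (use c T0 in auto)
    then show "(\<Sum>c'\<in>?S. T c c') = T c c" by simp
  qed
  also have "\<dots> = of_real (\<Sum>c\<in>?S. \<Sum>x\<in>?X. norm (f c x) ^ 2)"
    unfolding T_def by (simp only: of_real_sum complex_norm_square)
  finally have "(\<Sum>x\<in>?X. norm (\<Sum>c\<in>?S. f c x) ^ 2) = (\<Sum>c\<in>?S. \<Sum>x\<in>?X. norm (f c x) ^ 2)"
    by (simp only: of_real_eq_iff)
  then have "moment 1 (p ^ M) 1 (\<lambda>x. \<Sum>c\<in>?S. f c x) = (\<Sum>c\<in>?S. moment 1 (p ^ M) 1 (f c))"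
    unfolding moment_def mean_def by (simp add: sum_divide_distrib[symmetric])
  then show "moment 1 (p ^ M) (sK 1) (\<lambda>x. \<Sum>c\<in>?S. f c x) \<le>
    1 * (\<Sum>c\<in>?S. root (sK 1) (moment 1 (p ^ M) (sK 1) (f c))) ^ sK 1"
    unfolding s by simp
qed

text \<open>For each degree the rate starts at the trivial \<open>2 * sK k\<close> and is lowered by
  a fixed \<open>\<kappa>\<close> until it falls to \<open>\<eta>\<close>. The induction over the
  degree supplies arbitrarily small rates below \<open>k\<close>.\<close>

theorem padic_decoupling:
  assumes p: "prime p" "p > int k" and k: "k \<ge> 1" and \<eta>: "\<eta> > 0"
  shows "decexp p k \<eta>"
  using k p(2) \<eta>
proof (induction k arbitrary: \<eta> rule: less_induct)
  case (less k)
  have p1: "p > 1" using p(1) by (rule prime_gt_1_int)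
  show ?case
  proof (cases "k = 1")
    case True
    have "dec p 1 j (1 * of_int p powr (\<eta> * real j))" for j
      by (rule dec_mono[OF dec_one[OF p1]]) (use p1 less.prems in \<open>simp add: ge_one_powr_ge_zero\<close>)
    then show ?thesis unfolding decexp_def True by blast
  next
    case False
    then have k2: "k \<ge> 2" using less.prems by simp
    have low: "decexp p l \<epsilon>" if "1 \<le> l" "l < k" "\<epsilon> > 0" for l \<epsilon>
      using less.IH[of l \<epsilon>] that less.prems by simp
    obtain \<kappa> where \<kappa>: "\<kappa> > 0" "\<And>\<eta>'. \<eta>' \<ge> \<eta> \<Longrightarrow> decexp p k \<eta>' \<Longrightarrow> decexp p k (max (\<eta> / 2) (\<eta>' - \<kappa>))"
      using decexp_improve[OF p(1) less.prems(2) k2 low less.prems(3)] by blast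
    have it: "decexp p k (max \<eta> (real (2 * sK k) - real n * \<kappa>))" for n
    proof (induction n)
      case 0
      have "decexp p k (real (2 * sK k))"
        unfolding decexp_def using dec_trivial[OF p1, of k] less.prems(1) by (intro exI[of _ 1]) auto
      then show ?case by (rule decexp_mono[OF p1]) simp
    next
      case (Suc n)
      from \<kappa>(2)[OF _ Suc] show ?case
        by (rule decexp_mono[OF p1]) (use less.prems \<kappa>(1) in \<open>auto simp: algebra_simps max_def\<close>)
    qed
    obtain n :: nat where "real (2 * sK k) < real n * \<kappa>" using \<kappa>(1) ex_less_of_nat_mult by blast
    with it[of n] show ?thesis using less.prems(3) by (simp add: max_absorb1)
  qed
qed

section \<open>Vinogradov's mean value theorem\<close>

definition tuples :: "nat \<Rightarrow> nat \<Rightarrow> (nat \<Rightarrow> nat) set" where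
  "tuples s N = PiE {..<s} (\<lambda>_. {..<N})"

definition power_sum :: "nat \<Rightarrow> nat \<Rightarrow> (nat \<Rightarrow> nat) \<Rightarrow> nat" where
  "power_sum s j \<phi> = (\<Sum>i<s. \<phi> i ^ j)"

definition vinogradov_pairs :: "nat \<Rightarrow> nat \<Rightarrow> nat \<Rightarrow> ((nat \<Rightarrow> nat) \<times> (nat \<Rightarrow> nat)) set" where
  "vinogradov_pairs s k N = {(\<phi>, \<psi>) \<in> tuples s N \<times> tuples s N. \<forall>j\<in>{1..k}. power_sum s j \<phi> = power_sum s j \<psi>}"

lemma finite_tuples [simp]: "finite (tuples s N)"
  unfolding tuples_def by (intro finite_PiE) auto

lemma finite_vinogradov_pairs [simp]: "finite (vinogradov_pairs s k N)"
  by (rule finite_subset[of _ "tuples s N \<times> tuples s N"]) (auto simp: vinogradov_pairs_def)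

lemma vinogradov_pairs_mono: "N \<le> N' \<Longrightarrow> vinogradov_pairs s k N \<subseteq> vinogradov_pairs s k N'"
  unfolding vinogradov_pairs_def tuples_def PiE_def Pi_def extensional_def by auto

lemma e_sum: "(\<Prod>i\<in>I. e (f i)) = e (\<Sum>i\<in>I. f i)"
  by (induction I rule: infinite_finite_induct) (auto simp: e_add)

lemma sum_power_tuples:
  fixes g :: "nat \<Rightarrow> 'a::comm_semiring_1"
  shows "(\<Sum>n<N. g n) ^ s = (\<Sum>\<phi>\<in>tuples s N. \<Prod>i<s. g (\<phi> i))"
proof -
  have "(\<Sum>n<N. g n) ^ s = (\<Prod>i<s. \<Sum>n<N. g n)" by simp
  also have "\<dots> = (\<Sum>\<phi>\<in>tuples s N. \<Prod>i<s. g (\<phi> i))"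
    unfolding tuples_def by (rule prod_sum_PiE) auto
  finally show ?thesis .
qed

text \<open>Expanding the moment counts the solutions of the corresponding congruences modulo
  \<open>q\<close>, and solutions in integers are among them. The phases are linear in
  \<open>x\<close>, so translation invariance gives each the average 0 or 1; all terms are
  nonnegative and the others may be dropped.\<close>

lemma card_vinogradov_pairs_le_moment:
  assumes q: "q > 0"
  shows "real (card (vinogradov_pairs s k N)) \<le>
    moment k q s (\<lambda>x. \<Sum>n<N. e (of_int (poly x (int n)) / of_int q))"
proof -
  let ?X = "pols k q" and ?T = "tuples s N"
  define H where "H = (\<lambda>\<phi> \<psi> x. (\<Sum>i<s. poly x (int (\<phi> i))) - (\<Sum>i<s. poly x (int (\<psi> i))) :: int)"
  define L where "L = (\<lambda>\<phi> \<psi>. \<Sum>x\<in>?X. e (of_int (H \<phi> \<psi> x) / of_int q))"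
  have Hadd: "H \<phi> \<psi> (x + y) = H \<phi> \<psi> x + H \<phi> \<psi> y" for \<phi> \<psi> x y
    by (simp add: H_def sum.distrib)
  have Hsm: "H \<phi> \<psi> (smult a y) = a * H \<phi> \<psi> y" for \<phi> \<psi> a y
    by (simp add: H_def sum_distrib_left right_diff_distrib)
  have L: "L \<phi> \<psi> = 0 \<or> L \<phi> \<psi> = of_nat (card ?X)" for \<phi> \<psi>
  proof (cases "\<forall>v. degree v \<le> k \<longrightarrow> e (of_int (H \<phi> \<psi> v) / of_int q) = 1")
    case True
    then have "L \<phi> \<psi> = (\<Sum>x\<in>?X. 1)" unfolding L_def by (intro sum.cong) (auto simp: pols_def)
    then show ?thesis by simp
  next
    case False
    then obtain v where v: "degree v \<le> k" "e (of_int (H \<phi> \<psi> v) / of_int q) \<noteq> 1" by blast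
    have add: "e (of_int (H \<phi> \<psi> (x + y)) / of_int q) = e (of_int (H \<phi> \<psi> x) / of_int q) * e (of_int (H \<phi> \<psi> y) / of_int q)" for x y
      by (simp add: Hadd e_add[symmetric] add_divide_distrib)
    have "e (of_int (H \<phi> \<psi> (smult q u)) / of_int q) = 1" for u
      using q by (simp add: Hsm)
    then have per: "periodic k q (\<lambda>x. e (of_int (H \<phi> \<psi> x) / of_int q))"
      unfolding periodic_def add by simp
    have "L \<phi> \<psi> = (\<Sum>x\<in>?X. e (of_int (H \<phi> \<psi> (x + v)) / of_int q))"
      unfolding L_def by (rule sum_pols_shift[OF q per v(1), symmetric])
    also have "\<dots> = L \<phi> \<psi> * e (of_int (H \<phi> \<psi> v) / of_int q)"
      unfolding L_def add by (simp add: sum_distrib_right)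
    finally show ?thesis using v(2) by simp
  qed
  have L1: "L \<phi> \<psi> = of_nat (card ?X)" if mem: "(\<phi>, \<psi>) \<in> vinogradov_pairs s k N" for \<phi> \<psi>
  proof -
    have ps: "power_sum s m \<phi> = power_sum s m \<psi>" if "m \<le> k" for m
      using that mem by (cases "m = 0") (auto simp: vinogradov_pairs_def power_sum_def)
    have "H \<phi> \<psi> x = 0" if x: "x \<in> ?X" for x
    proof -
      have "(\<Sum>i<s. poly x (int (\<zeta> i))) = (\<Sum>m\<le>degree x. coeff x m * int (power_sum s m \<zeta>))" for \<zeta>
        unfolding poly_altdef power_sum_def by (subst sum.swap) (simp add: sum_distrib_left)
      then show ?thesis unfolding H_def using ps x by (auto simp: pols_def intro!: sum.cong)
    qed
    then show ?thesis unfolding L_def by simp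
  qed
  have expand: "(of_real (norm (\<Sum>n<N. e (of_int (poly x (int n)) / of_int q)) ^ (2 * s)) :: complex) =
    (\<Sum>\<phi>\<in>?T. \<Sum>\<psi>\<in>?T. e (of_int (H \<phi> \<psi> x) / of_int q))" for x
  proof -
    let ?g = "\<lambda>n. e (of_int (poly x (int n)) / of_int q)"
    have 1: "(\<Sum>n<N. ?g n) ^ s = (\<Sum>\<phi>\<in>?T. e (of_int (\<Sum>i<s. poly x (int (\<phi> i))) / of_int q))"
      unfolding sum_power_tuples e_sum by (simp add: sum_divide_distrib)
    have "(of_real (norm (\<Sum>n<N. ?g n) ^ (2 * s)) :: complex) = of_real (norm ((\<Sum>n<N. ?g n) ^ s) ^ 2)"
      by (simp add: norm_power power_mult[symmetric] mult.commute)
    also have "\<dots> = (\<Sum>n<N. ?g n) ^ s * cnj ((\<Sum>n<N. ?g n) ^ s)" by (rule complex_norm_square)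
    also have "\<dots> = (\<Sum>\<phi>\<in>?T. \<Sum>\<psi>\<in>?T. e (of_int (H \<phi> \<psi> x) / of_int q))"
      unfolding 1 cnj_sum sum_product e_minus[symmetric] e_add[symmetric] H_def
      by (simp add: diff_divide_distrib)
    finally show ?thesis .
  qed
  have "(of_real (\<Sum>x\<in>?X. norm (\<Sum>n<N. e (of_int (poly x (int n)) / of_int q)) ^ (2 * s)) :: complex)
      = (\<Sum>x\<in>?X. \<Sum>\<phi>\<in>?T. \<Sum>\<psi>\<in>?T. e (of_int (H \<phi> \<psi> x) / of_int q))"
    unfolding of_real_sum expand ..
  also have "\<dots> = (\<Sum>\<phi>\<in>?T. \<Sum>\<psi>\<in>?T. L \<phi> \<psi>)"
    unfolding L_def by (subst sum.swap, intro sum.cong refl sum.swap)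
  finally have eq: "(of_real (\<Sum>x\<in>?X. norm (\<Sum>n<N. e (of_int (poly x (int n)) / of_int q)) ^ (2 * s)) :: complex) =
    (\<Sum>z\<in>?T \<times> ?T. L (fst z) (snd z))" by (simp add: sum.cartesian_product split_def)
  have "(\<Sum>x\<in>?X. norm (\<Sum>n<N. e (of_int (poly x (int n)) / of_int q)) ^ (2 * s)) =
    (\<Sum>z\<in>?T \<times> ?T. Re (L (fst z) (snd z)))"
    using arg_cong[OF eq, of Re] by simp
  also have "\<dots> \<ge> (\<Sum>z\<in>vinogradov_pairs s k N. Re (L (fst z) (snd z)))"
  proof (rule sum_mono2)
    fix z assume "z \<in> ?T \<times> ?T - vinogradov_pairs s k N"
    show "0 \<le> Re (L (fst z) (snd z))" using L[of "fst z" "snd z"] by auto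
  qed (auto simp: vinogradov_pairs_def)
  also have "(\<Sum>z\<in>vinogradov_pairs s k N. Re (L (fst z) (snd z))) = (\<Sum>z\<in>vinogradov_pairs s k N. real (card ?X))"
    using L1 by (intro sum.cong) auto
  finally have "real (card (vinogradov_pairs s k N)) * real (card ?X) \<le>
    (\<Sum>x\<in>?X. norm (\<Sum>n<N. e (of_int (poly x (int n)) / of_int q)) ^ (2 * s))" by simp
  then show ?thesis unfolding moment_def mean_def using card_pols_pos[OF q, of k]
    by (simp add: pos_le_divide_eq)
qed

text \<open>Decoupling is applied to single exponentials, whose moments are 1; the right-hand side
  is then \<open>p ^ j\<close> to the power \<open>sK k\<close>, times the constant. Enlarging
  \<open>N\<close> to the next power of \<open>p\<close> costs a bounded factor.\<close>

theorem vinogradov_mean_value: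
  assumes k: "k \<ge> 1" and \<epsilon>: "\<epsilon> > 0"
  shows "\<exists>C\<ge>1. \<forall>N\<ge>1. real (card (vinogradov_pairs (sK k) k N)) \<le> C * real N powr (real (sK k) + \<epsilon>)"
proof -
  obtain p0 :: nat where p0: "prime p0" "p0 > k" using bigger_prime by blast
  define p where "p = int p0"
  have p: "prime p" "p > int k" unfolding p_def using p0 by auto
  have p1: "p > 1" using p(1) by (rule prime_gt_1_int)
  define P where "P = real p0"
  have P: "P > 1" "of_int p = P" using p1 by (auto simp: P_def p_def)
  let ?s = "sK k"
  have s: "?s > 0" using sK_pos k by simp
  obtain C where C: "C \<ge> 1" "\<And>j. dec p k j (C * P powr (\<epsilon> * real j))"
    using padic_decoupling[OF p k \<epsilon>] unfolding decexp_def P(2) by blast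
  define K where "K = C * P powr (real ?s + \<epsilon>)"
  have K: "K \<ge> 1"
  proof -
    have "P powr (real ?s + \<epsilon>) \<ge> 1" using P \<epsilon> by (intro ge_one_powr_ge_zero) auto
    then have "1 * 1 \<le> C * P powr (real ?s + \<epsilon>)" using C(1) by (intro mult_mono) auto
    then show ?thesis unfolding K_def by simp
  qed
  have "real (card (vinogradov_pairs ?s k N)) \<le> K * real N powr (real ?s + \<epsilon>)" if N: "N \<ge> 1" for N
  proof -
    obtain i where i: "p0 ^ i \<le> N" "N < p0 ^ (i + 1)"
      using ex_power_ivl1[of p0 N] N p0 prime_ge_2_nat by blast
    define j where "j = i + 1"
    define M where "M = k * j"
    have q: "p ^ M > 0" using p1 by simp
    define f where "f = (\<lambda>c x. e (of_int (poly x c) / of_int (p ^ M)))"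
    have cov: "covar p k M j c (f c)" for c
      unfolding covar_def f_def by (simp add: e_add add_divide_distrib mult.commute)
    have m1: "moment k (p ^ M) ?s (f c) = 1" for c
      unfolding moment_def f_def using mean_const[OF q] by simp
    have "card (vinogradov_pairs ?s k N) \<le> card (vinogradov_pairs ?s k (p0 ^ j))"
      using i unfolding j_def by (intro card_mono vinogradov_pairs_mono) auto
    then have "real (card (vinogradov_pairs ?s k N)) \<le> real (card (vinogradov_pairs ?s k (p0 ^ j)))" by simp
    also have "\<dots> \<le> moment k (p ^ M) ?s (\<lambda>x. \<Sum>n<p0 ^ j. f (int n) x)"
      unfolding f_def by (rule card_vinogradov_pairs_le_moment[OF q])
    also have "(\<lambda>x. \<Sum>n<p0 ^ j. f (int n) x) = (\<lambda>x. \<Sum>c\<in>{0..<p ^ j}. f c x)"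
    proof
      fix x
      have im: "int ` {..<p0 ^ j} = {0..<p ^ j}" unfolding p_def by (simp add: lessThan_atLeast0 image_int_atLeastLessThan)
      show "(\<Sum>n<p0 ^ j. f (int n) x) = (\<Sum>c\<in>{0..<p ^ j}. f c x)"
        unfolding im[symmetric] by (subst sum.reindex) (auto simp: inj_on_def)
    qed
    also have "moment k (p ^ M) ?s \<dots> \<le> C * P powr (\<epsilon> * real j) *
        (\<Sum>c\<in>{0..<p ^ j}. root ?s (moment k (p ^ M) ?s (f c))) ^ ?s"
      using C(2)[of j] cov unfolding dec_def M_def by blast
    also have "(\<Sum>c\<in>{0..<p ^ j}. root ?s (moment k (p ^ M) ?s (f c))) = P ^ j"
      unfolding m1 using s p1 P(2) by simp
    also have "C * P powr (\<epsilon> * real j) * (P ^ j) ^ ?s = C * (P ^ j) powr (real ?s + \<epsilon>)"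
      using P by (simp add: powr_realpow[symmetric] powr_powr powr_add algebra_simps del: powr_realpow')
    also have "\<dots> \<le> C * (P * real N) powr (real ?s + \<epsilon>)"
    proof (intro mult_left_mono powr_mono2)
      have "real (p0 ^ i) \<le> real N" using i(1) by (simp only: of_nat_le_iff)
      then show "P ^ j \<le> P * real N" using P unfolding j_def P_def by (simp add: mult_left_mono)
    qed (use C(1) P \<epsilon> in auto)
    also have "\<dots> = K * real N powr (real ?s + \<epsilon>)" unfolding K_def using P by (simp add: powr_mult)
    finally show ?thesis .
  qed
  then show ?thesis using K by blast
qed

section \<open>The large sieve\<close>

definition idist :: "real \<Rightarrow> real" where "idist x = \<bar>x - of_int (round x)\<bar>"

text \<open>The minimum of \<open>N\<close> and \<open>1 / idist x\<close>, in a form that also covers \<open>idist x = 0\<close>.\<close>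

definition peak :: "real \<Rightarrow> real \<Rightarrow> real" where "peak N x = 1 / max (1 / N) (idist x)"

lemma idist_le: "idist x \<le> \<bar>x - of_int m\<bar>"
  unfolding idist_def by (rule round_diff_minimal)

lemma idist_nonneg [simp]: "0 \<le> idist x"
  by (simp add: idist_def)

lemma idist_le_half: "idist x \<le> 1 / 2"
  unfolding idist_def using of_int_round_abs_le[of x] by (simp add: abs_minus_commute)

lemma idist_add_int: "idist (x + of_int n) = idist x"
proof (rule antisym)
  have "idist (x + of_int n) \<le> \<bar>(x + of_int n) - of_int (round x + n)\<bar>" by (rule idist_le)
  then show "idist (x + of_int n) \<le> idist x" by (simp add: idist_def)
  have "idist x \<le> \<bar>x - of_int (round (x + of_int n) - n)\<bar>" by (rule idist_le)
  then show "idist x \<le> idist (x + of_int n)" by (simp add: idist_def algebra_simps)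
qed

lemma idist_minus: "idist (- x) = idist x"
proof -
  have "idist (- y) \<le> idist y" for y
    using idist_le[of "- y" "- round y"] by (simp add: idist_def abs_minus_commute)
  from this[of x] this[of "- x"] show ?thesis by simp
qed

lemma idist_triangle: "idist x \<le> idist (x + y) + \<bar>y\<bar>"
proof -
  have "idist x \<le> \<bar>x - of_int (round (x + y))\<bar>" by (rule idist_le)
  also have "\<dots> \<le> \<bar>(x + y) - of_int (round (x + y))\<bar> + \<bar>y\<bar>" by simp
  finally show ?thesis by (simp add: idist_def)
qed

lemma idist_fraction_ge:
  fixes a t :: int
  assumes "t > 0" "\<not> t dvd a"
  shows "1 / of_int t \<le> idist (of_int a / of_int t)"
proof -
  define n where "n = round (of_int a / of_int t :: real)"
  have "a \<noteq> n * t" using assms by auto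
  then have "1 \<le> \<bar>a - n * t\<bar>" by simp
  then have "1 \<le> \<bar>of_int a - of_int n * of_int t :: real\<bar>"
    by (metis of_int_1_le_iff of_int_abs of_int_diff of_int_mult)
  moreover have "of_int a / of_int t - of_int n = (of_int a - of_int n * of_int t) / (of_int t :: real)"
    using assms by (simp add: field_simps)
  ultimately show ?thesis unfolding idist_def n_def[symmetric] using assms
    by (simp add: divide_right_mono)
qed

lemma peak_nonneg: "N > 0 \<Longrightarrow> 0 \<le> peak N x"
  unfolding peak_def by (intro divide_nonneg_nonneg) (auto simp: le_max_iff_disj)

lemma peak_le: "N > 0 \<Longrightarrow> peak N x \<le> N"
proof -
  assume N: "N > 0"
  have "1 / max (1 / N) (idist x) \<le> 1 / (1 / N)" using N by (intro divide_left_mono) (auto simp: less_max_iff_disj)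
  then show ?thesis unfolding peak_def by simp
qed

lemma peak_le_inverse:
  assumes "0 < d" "d \<le> idist x" "N > 0"
  shows "peak N x \<le> 1 / d"
  unfolding peak_def using assms by (intro divide_left_mono) (auto simp: le_max_iff_disj less_max_iff_disj)

lemma peak_mono: "0 < M \<Longrightarrow> M \<le> N \<Longrightarrow> peak M x \<le> peak N x"
  unfolding peak_def by (intro divide_left_mono max.mono mult_pos_pos) (auto simp: frac_le less_max_iff_disj)

lemma peak_minus: "peak N (- x) = peak N x"
  by (simp add: peak_def idist_minus)

text \<open>The chord is 2|sin(pi y)|, where \<open>y\<close> is the signed distance to the nearest
  integer. As |pi y| is at most 1.6 and 1.6^2 < 3, the cubic error term is at most half of |pi y|;
  hence the chord is at least |pi y|.\<close>

lemma norm_e_minus_1_ge: "2 * idist x \<le> norm (e x - 1)"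
proof -
  define y where "y = x - of_int (round x)"
  have y: "\<bar>y\<bar> \<le> 1 / 2" unfolding y_def using of_int_round_abs_le[of x] by (simp add: abs_minus_commute)
  have "e x = e (y + of_int (round x))" by (simp add: y_def)
  also have "\<dots> = e y" by (simp only: e_add e_int mult_1_right)
  also have "e y = cis (2 * pi * y)" unfolding e_def cis_conv_exp by (simp add: mult_ac)
  finally have ex: "e x = cis (2 * (pi * y))" by (simp only: mult.assoc)
  have "norm (e x - 1) ^ 2 = (cos (2 * (pi * y)) - 1) ^ 2 + sin (2 * (pi * y)) ^ 2"
    unfolding ex cmod_power2 by simp
  also have "\<dots> = 2 - 2 * cos (2 * (pi * y))"
    using sin_cos_squared_add[of "2 * (pi * y)"] by (simp add: power2_eq_square algebra_simps)
  also have "\<dots> = (2 * \<bar>sin (pi * y)\<bar>) ^ 2" unfolding cos_double_sin by (simp add: power_mult_distrib)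
  finally have n: "norm (e x - 1) = 2 * \<bar>sin (pi * y)\<bar>" by (rule power2_eq_imp_eq) auto
  have "\<bar>sin (pi * y) - (\<Sum>m<3. sin_coeff m * (pi * y) ^ m)\<bar> \<le> inverse (fact 3) * \<bar>pi * y\<bar> ^ 3"
    by (rule Maclaurin_sin_bound)
  then have s: "\<bar>sin (pi * y) - pi * y\<bar> \<le> \<bar>pi * y\<bar> ^ 3 / 6"
    by (simp add: eval_nat_numeral sin_coeff_def)
  have "z ^ 3 / 6 \<le> z * (1 / 2)" if "0 \<le> z" "z \<le> 1.6" for z :: real
  proof -
    have "z * z \<le> 1.6 * 1.6" using that by (intro mult_mono) auto
    then have "z * (z * z) \<le> z * 3" using that by (intro mult_left_mono) auto
    then show ?thesis by (simp add: power3_eq_cube mult.assoc)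
  qed
  moreover have "\<bar>pi * y\<bar> \<le> 1.6"
  proof -
    have "pi * \<bar>y\<bar> \<le> 3.2 * (1 / 2)" using pi_less_4 pi_approx y by (intro mult_mono) auto
    then show ?thesis by (simp add: abs_mult)
  qed
  ultimately have "\<bar>pi * y\<bar> ^ 3 / 6 \<le> \<bar>pi * y\<bar> * (1 / 2)" by simp
  with s have "\<bar>pi * y\<bar> / 2 \<le> \<bar>sin (pi * y)\<bar>" by linarith
  moreover have "2 * \<bar>y\<bar> \<le> \<bar>pi * y\<bar>" using pi_ge_two by (simp add: abs_mult mult_right_mono)
  ultimately show ?thesis unfolding n idist_def y_def[symmetric] by linarith
qed

lemma e_mult_nat: "e (real n * x) = e x ^ n"
  by (induction n) (simp_all add: e_add distrib_right)

lemma norm_geometric_le_peak: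
  assumes "N \<ge> 1"
  shows "norm (\<Sum>n<N. e (real n * x)) \<le> peak (real N) x"
proof -
  have 1: "norm (\<Sum>n<N. e (real n * x)) \<le> real N"
    by (rule order_trans[OF norm_sum]) simp
  have 2: "norm (\<Sum>n<N. e (real n * x)) * idist x \<le> 1"
  proof (cases "e x = 1")
    case True
    then have "idist x = 0" using norm_e_minus_1_ge[of x] by (simp add: order_antisym)
    then show ?thesis by simp
  next
    case False
    have "(\<Sum>n<N. e (real n * x)) * (e x - 1) = e x ^ N - 1"
      unfolding e_mult_nat using power_diff_1_eq[of "e x" N] by (simp add: mult.commute)
    then have "norm (\<Sum>n<N. e (real n * x)) * norm (e x - 1) = norm (e x ^ N - 1)"
      by (metis norm_mult)
    also have "\<dots> \<le> 2" using norm_triangle_ineq4[of "e x ^ N" 1] by (simp add: norm_power)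
    finally have "norm (\<Sum>n<N. e (real n * x)) * norm (e x - 1) \<le> 2" .
    moreover have "norm (\<Sum>n<N. e (real n * x)) * (2 * idist x) \<le> norm (\<Sum>n<N. e (real n * x)) * norm (e x - 1)"
      by (intro mult_left_mono norm_e_minus_1_ge) auto
    ultimately show ?thesis by simp
  qed
  have "norm (\<Sum>n<N. e (real n * x)) * max (1 / real N) (idist x) \<le> 1"
    using 1 2 assms by (auto simp: max_def field_simps)
  moreover have "max (1 / real N) (idist x) > 0" using assms by (simp add: less_max_iff_disj)
  ultimately show ?thesis unfolding peak_def by (simp add: pos_le_divide_eq)
qed

lemma harm_le: "n \<ge> 1 \<Longrightarrow> (\<Sum>t\<in>{1..n}. 1 / real t) \<le> 1 + ln (real n)"
proof (induction n rule: dec_induct)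
  case base
  show ?case by simp
next
  case (step n)
  have "ln (real n / real (Suc n)) \<le> real n / real (Suc n) - 1" using step by (intro ln_le_minus_one) auto
  then have "1 / real (Suc n) \<le> ln (real (Suc n)) - ln (real n)"
    using step by (simp add: ln_div field_simps)
  then show ?case using step by (simp add: atLeastAtMostSuc_conv)
qed

text \<open>The sign of \<open>\<rho> i\<close> and the integer part of
  \<open>\<bar>\<rho> i\<bar> / \<delta>\<close> label the points injectively, because two points
  with equal labels are closer than \<open>\<delta>\<close>. Integer part 0 contributes at most
  \<open>N\<close> and integer part t at most 1/(t \<delta>), each for two signs; the rest is a
  harmonic sum.\<close>

lemma sum_peak_spaced:
  fixes \<theta> :: "'a \<Rightarrow> real"
  assumes A: "finite A" and \<delta>: "0 < \<delta>" "\<delta> \<le> 1"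
    and sp: "\<And>i j. i \<in> A \<Longrightarrow> j \<in> A \<Longrightarrow> i \<noteq> j \<Longrightarrow> \<delta> \<le> idist (\<theta> i - \<theta> j)" and N: "N > 0"
  shows "(\<Sum>i\<in>A. peak N (\<theta> i)) \<le> 2 * N + 2 / \<delta> * (1 + ln (1 / \<delta>))"
proof -
  define \<rho> where "\<rho> = (\<lambda>i. \<theta> i - of_int (round (\<theta> i)))"
  define T where "T = (\<lambda>i. nat \<lfloor>\<bar>\<rho> i\<bar> / \<delta>\<rfloor>)"
  define \<kappa> where "\<kappa> = (\<lambda>i. (\<rho> i \<ge> 0, T i))"
  define n where "n = nat \<lfloor>1 / \<delta>\<rfloor>"
  define w where "w = (\<lambda>z :: bool \<times> nat. if snd z = 0 then N else 1 / (real (snd z) * \<delta>))"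
  have Tle: "real (T i) * \<delta> \<le> \<bar>\<rho> i\<bar>" "\<bar>\<rho> i\<bar> < (real (T i) + 1) * \<delta>" for i
  proof -
    have "real (T i) = of_int \<lfloor>\<bar>\<rho> i\<bar> / \<delta>\<rfloor>" unfolding T_def using \<delta> by simp
    then have "real (T i) \<le> \<bar>\<rho> i\<bar> / \<delta>" "\<bar>\<rho> i\<bar> / \<delta> < real (T i) + 1" by linarith+
    then show "real (T i) * \<delta> \<le> \<bar>\<rho> i\<bar>" "\<bar>\<rho> i\<bar> < (real (T i) + 1) * \<delta>" using \<delta> by (auto simp: field_simps)
  qed
  have \<rho>i: "\<bar>\<rho> i\<bar> = idist (\<theta> i)" for i by (simp add: \<rho>_def idist_def)
  have inj: "inj_on \<kappa> A"
  proof (rule inj_onI, rule ccontr)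
    fix i j assume ij: "i \<in> A" "j \<in> A" "\<kappa> i = \<kappa> j" "i \<noteq> j"
    then have "(\<rho> i \<ge> 0) = (\<rho> j \<ge> 0)" "T i = T j" by (auto simp: \<kappa>_def)
    then have "\<bar>\<rho> i - \<rho> j\<bar> < \<delta>" using Tle[of i] Tle[of j] by (auto simp: algebra_simps abs_if split: if_splits)
    moreover have "idist (\<theta> i - \<theta> j) \<le> \<bar>\<rho> i - \<rho> j\<bar>"
      using idist_le[of "\<theta> i - \<theta> j" "round (\<theta> i) - round (\<theta> j)"] by (simp add: \<rho>_def algebra_simps)
    ultimately show False using sp[of i j] ij by simp
  qed
  have "peak N (\<theta> i) \<le> w (\<kappa> i)" for i
  proof (cases "T i = 0")
    case True
    then show ?thesis using peak_le[OF N] by (simp add: w_def \<kappa>_def)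
  next
    case False
    then show ?thesis using peak_le_inverse[OF _ _ N, of "real (T i) * \<delta>" "\<theta> i"] Tle(1)[of i] \<delta>
      by (simp add: w_def \<kappa>_def \<rho>i)
  qed
  then have "(\<Sum>i\<in>A. peak N (\<theta> i)) \<le> (\<Sum>i\<in>A. w (\<kappa> i))" by (intro sum_mono)
  also have "\<dots> = (\<Sum>z\<in>\<kappa> ` A. w z)" by (simp add: sum.reindex[OF inj])
  also have "\<dots> \<le> (\<Sum>z\<in>UNIV \<times> {0..n}. w z)"
  proof (rule sum_mono2)
    have "T i \<le> n" for i unfolding T_def n_def
      using idist_le_half[of "\<theta> i"] \<delta> by (intro nat_mono floor_mono divide_right_mono) (auto simp: \<rho>i)
    then show "\<kappa> ` A \<subseteq> UNIV \<times> {0..n}" by (auto simp: \<kappa>_def)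
    show "0 \<le> w b" for b using N \<delta> by (auto simp: w_def)
  qed auto
  also have "\<dots> = 2 * (\<Sum>t\<in>{0..n}. w (True, t))"
    unfolding sum.cartesian_product[symmetric, of "\<lambda>a b. w (a, b)", simplified] UNIV_bool by (simp add: w_def cong: if_cong)
  also have "(\<Sum>t\<in>{0..n}. w (True, t)) = N + (\<Sum>t\<in>{1..n}. w (True, t))"
    by (simp add: sum.atLeast_Suc_atMost w_def)
  also have "(\<Sum>t\<in>{1..n}. w (True, t)) = (\<Sum>t\<in>{1..n}. 1 / real t) / \<delta>"
    unfolding sum_divide_distrib by (intro sum.cong) (auto simp: w_def)
  also have "(\<Sum>t\<in>{1..n}. 1 / real t) \<le> 1 + ln (1 / \<delta>)"
  proof -
    have d1: "1 \<le> 1 / \<delta>" using \<delta> by simp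
    then have "1 \<le> \<lfloor>1 / \<delta>\<rfloor>" by (simp add: le_floor_iff)
    then have n1: "n \<ge> 1" unfolding n_def by linarith
    have "real n \<le> 1 / \<delta>" unfolding n_def using \<delta> by simp
    then have "ln (real n) \<le> ln (1 / \<delta>)" using n1 by (intro ln_mono) auto
    then show ?thesis using harm_le[OF n1] by linarith
  qed
  finally show ?thesis using \<delta> by (simp add: divide_right_mono field_simps)
qed

text \<open>By duality it is enough to bound the sum of the squares of the \<open>R n\<close> by
  \<open>\<Delta> * V\<close>. Its kernel is a geometric sum, bounded by \<open>peak\<close>, and
  2|uu'| \<le> |u|^2 + |u'|^2 reduces the estimate to row sums (Schur's test). Spacing of the points
  enters only through \<open>\<Delta>\<close>.\<close>

lemma large_sieve_dual:
  fixes \<mu> :: "'a \<Rightarrow> real" and c :: "nat \<Rightarrow> complex"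
  assumes ne: "\<Omega> \<noteq> {}" and N: "N \<ge> 1" and \<Delta>: "\<And>x'. x' \<in> \<Omega> \<Longrightarrow> (\<Sum>x\<in>\<Omega>. peak (real N) (\<mu> x - \<mu> x')) \<le> \<Delta>"
  shows "(\<Sum>x\<in>\<Omega>. norm (\<Sum>n<N. c n * e (real n * \<mu> x)) ^ 2) \<le> \<Delta> * (\<Sum>n<N. norm (c n) ^ 2)"
proof -
  define S where "S = (\<lambda>x. \<Sum>n<N. c n * e (real n * \<mu> x))"
  define u where "u = (\<lambda>x. cnj (S x))"
  define V where "V = (\<Sum>x\<in>\<Omega>. norm (S x) ^ 2)"
  define C where "C = (\<Sum>n<N. norm (c n) ^ 2)"
  define R where "R = (\<lambda>n. \<Sum>x\<in>\<Omega>. u x * e (real n * \<mu> x))"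
  have V0: "V \<ge> 0" and C0: "C \<ge> 0" unfolding V_def C_def by (auto intro: sum_nonneg)
  have N0: "real N > 0" using N by simp
  have \<Delta>0: "\<Delta> \<ge> 0"
  proof -
    obtain x' where "x' \<in> \<Omega>" using ne by blast
    have "0 \<le> (\<Sum>x\<in>\<Omega>. peak (real N) (\<mu> x - \<mu> x'))" by (intro sum_nonneg peak_nonneg N0)
    then show ?thesis using \<Delta>[OF \<open>x' \<in> \<Omega>\<close>] by linarith
  qed
  have half: "(\<Sum>x\<in>\<Omega>. norm (u x) ^ 2 / 2 * \<Delta>) = \<Delta> * V / 2"
  proof -
    have "V = (\<Sum>x\<in>\<Omega>. norm (u x) ^ 2)" unfolding V_def u_def by simp
    then show ?thesis unfolding sum_distrib_right[symmetric] sum_divide_distrib[symmetric] by simp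
  qed
  have "(of_real V :: complex) = (\<Sum>x\<in>\<Omega>. S x * cnj (S x))" unfolding V_def by (simp only: of_real_sum complex_norm_square)
  also have "\<dots> = (\<Sum>x\<in>\<Omega>. \<Sum>n<N. c n * (u x * e (real n * \<mu> x)))"
  proof (intro sum.cong refl)
    fix x
    have "S x * cnj (S x) = (\<Sum>n<N. c n * e (real n * \<mu> x)) * u x" by (simp only: S_def u_def)
    then show "S x * cnj (S x) = (\<Sum>n<N. c n * (u x * e (real n * \<mu> x)))"
      unfolding sum_distrib_right by (simp only: mult_ac)
  qed
  also have "\<dots> = (\<Sum>n<N. c n * R n)" unfolding R_def by (subst sum.swap) (simp add: sum_distrib_left)
  finally have "V = norm (\<Sum>n<N. c n * R n)" using V0 by (metis norm_of_real abs_of_nonneg)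
  also have "\<dots> \<le> (\<Sum>n<N. norm (c n) * norm (R n))" by (rule order_trans[OF norm_sum]) (simp add: norm_mult)
  finally have "V ^ 2 \<le> (\<Sum>n<N. norm (c n) * norm (R n)) ^ 2" using V0 by (intro power_mono) auto
  also have "\<dots> \<le> C * (\<Sum>n<N. norm (R n) ^ 2)"
    unfolding C_def using Cauchy_Schwarz_ineq_sum[of "\<lambda>n. norm (c n)" "\<lambda>n. norm (R n)" "{..<N}"] by simp
  also have "(\<Sum>n<N. norm (R n) ^ 2) \<le> \<Delta> * V"
  proof -
    have "(of_real (\<Sum>n<N. norm (R n) ^ 2) :: complex) = (\<Sum>n<N. R n * cnj (R n))"
      by (simp only: of_real_sum complex_norm_square)
    also have "\<dots> = (\<Sum>n<N. \<Sum>x\<in>\<Omega>. \<Sum>x'\<in>\<Omega>. (u x * cnj (u x')) * e (real n * (\<mu> x - \<mu> x')))"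
    proof -
      have "(u x * e (real n * \<mu> x)) * (cnj (u x') * e (- (real n * \<mu> x'))) =
        (u x * cnj (u x')) * e (real n * (\<mu> x - \<mu> x'))" for n x x'
      proof -
        have "e (real n * (\<mu> x - \<mu> x')) = e (real n * \<mu> x) * e (- (real n * \<mu> x'))"
          unfolding e_add[symmetric] by (simp add: right_diff_distrib)
        then show ?thesis by (simp only: mult_ac)
      qed
      then show ?thesis
        unfolding R_def cnj_sum sum_product complex_cnj_mult e_minus[symmetric] by (simp only:)
    qed
    also have "\<dots> = (\<Sum>x\<in>\<Omega>. \<Sum>x'\<in>\<Omega>. (u x * cnj (u x')) * (\<Sum>n<N. e (real n * (\<mu> x - \<mu> x'))))"
      by (simp only: sum_distrib_left) (subst sum.swap, intro sum.cong refl sum.swap)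
    finally have eq: "(of_real (\<Sum>n<N. norm (R n) ^ 2) :: complex) =
      (\<Sum>x\<in>\<Omega>. \<Sum>x'\<in>\<Omega>. (u x * cnj (u x')) * (\<Sum>n<N. e (real n * (\<mu> x - \<mu> x'))))" .
    have R0: "(\<Sum>n<N. norm (R n) ^ 2) \<ge> 0" by (intro sum_nonneg) auto
    have "(\<Sum>n<N. norm (R n) ^ 2) = norm (of_real (\<Sum>n<N. norm (R n) ^ 2) :: complex)"
      using R0 by (simp only: norm_of_real abs_of_nonneg)
    also have "\<dots> \<le> (\<Sum>x\<in>\<Omega>. \<Sum>x'\<in>\<Omega>. norm ((u x * cnj (u x')) * (\<Sum>n<N. e (real n * (\<mu> x - \<mu> x')))))"
      unfolding eq by (intro sum_norm_le order_refl)
    also have "\<dots> \<le> (\<Sum>x\<in>\<Omega>. \<Sum>x'\<in>\<Omega>. (norm (u x) ^ 2 / 2 + norm (u x') ^ 2 / 2) * peak (real N) (\<mu> x - \<mu> x'))"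
    proof (intro sum_mono)
      fix x x'
      have "2 * (norm (u x) * norm (u x')) \<le> norm (u x) ^ 2 + norm (u x') ^ 2"
        using sum_squares_bound[of "norm (u x)" "norm (u x')"] by simp
      then have "norm (u x) * norm (u x') \<le> norm (u x) ^ 2 / 2 + norm (u x') ^ 2 / 2" by simp
      then show "norm ((u x * cnj (u x')) * (\<Sum>n<N. e (real n * (\<mu> x - \<mu> x')))) \<le>
        (norm (u x) ^ 2 / 2 + norm (u x') ^ 2 / 2) * peak (real N) (\<mu> x - \<mu> x')"
        unfolding norm_mult complex_mod_cnj by (intro mult_mono norm_geometric_le_peak N) auto
    qed
    also have "\<dots> = (\<Sum>x\<in>\<Omega>. \<Sum>x'\<in>\<Omega>. norm (u x) ^ 2 / 2 * peak (real N) (\<mu> x - \<mu> x')) +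
       (\<Sum>x\<in>\<Omega>. \<Sum>x'\<in>\<Omega>. norm (u x') ^ 2 / 2 * peak (real N) (\<mu> x - \<mu> x'))"
      by (simp only: distrib_right sum.distrib)
    also have "(\<Sum>x\<in>\<Omega>. \<Sum>x'\<in>\<Omega>. norm (u x) ^ 2 / 2 * peak (real N) (\<mu> x - \<mu> x')) \<le> \<Delta> * V / 2"
    proof -
      have "(\<Sum>x\<in>\<Omega>. \<Sum>x'\<in>\<Omega>. norm (u x) ^ 2 / 2 * peak (real N) (\<mu> x - \<mu> x')) =
        (\<Sum>x\<in>\<Omega>. norm (u x) ^ 2 / 2 * (\<Sum>x'\<in>\<Omega>. peak (real N) (\<mu> x' - \<mu> x)))"
        unfolding sum_distrib_left
      proof (intro sum.cong refl)
        fix x x'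
        have "peak (real N) (\<mu> x - \<mu> x') = peak (real N) (\<mu> x' - \<mu> x)"
          using peak_minus[of "real N" "\<mu> x - \<mu> x'"] by simp
        then show "norm (u x) ^ 2 / 2 * peak (real N) (\<mu> x - \<mu> x') = norm (u x) ^ 2 / 2 * peak (real N) (\<mu> x' - \<mu> x)"
          by (simp only:)
      qed
      also have "\<dots> \<le> (\<Sum>x\<in>\<Omega>. norm (u x) ^ 2 / 2 * \<Delta>)"
        using \<Delta> by (intro sum_mono mult_left_mono) auto
      also have "\<dots> = \<Delta> * V / 2" by (rule half)
      finally show ?thesis .
    qed
    also have "(\<Sum>x\<in>\<Omega>. \<Sum>x'\<in>\<Omega>. norm (u x') ^ 2 / 2 * peak (real N) (\<mu> x - \<mu> x')) \<le> \<Delta> * V / 2"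
    proof -
      have "(\<Sum>x\<in>\<Omega>. \<Sum>x'\<in>\<Omega>. norm (u x') ^ 2 / 2 * peak (real N) (\<mu> x - \<mu> x')) =
        (\<Sum>x'\<in>\<Omega>. norm (u x') ^ 2 / 2 * (\<Sum>x\<in>\<Omega>. peak (real N) (\<mu> x - \<mu> x')))"
        unfolding sum_distrib_left by (rule sum.swap)
      also have "\<dots> \<le> (\<Sum>x\<in>\<Omega>. norm (u x) ^ 2 / 2 * \<Delta>)"
        using \<Delta> by (intro sum_mono mult_left_mono) auto
      also have "\<dots> = \<Delta> * V / 2" by (rule half)
      finally show ?thesis .
    qed
    finally show ?thesis by (simp add: mult.commute)
  qed
  finally have "V ^ 2 \<le> C * (\<Delta> * V)" using C0 by (simp add: mult_left_mono)
  then have "V * V \<le> (\<Delta> * C) * V" by (simp add: power2_eq_square mult_ac)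
  then have "V \<le> \<Delta> * C"
  proof (cases "V = 0")
    case True
    then show ?thesis using \<Delta>0 C0 by simp
  next
    case False
    then have "V > 0" using V0 by simp
    then show ?thesis using \<open>V * V \<le> (\<Delta> * C) * V\<close> by (rule mult_right_le_imp_le[rotated])
  qed
  then show ?thesis unfolding V_def C_def S_def .
qed

text \<open>Pairs with equal value of \<open>G\<close> are counted fibre by fibre. This turns the
  mean square of the coefficients in the large sieve into the count of Vinogradov pairs.\<close>

lemma sum_card_fibres_sq:
  assumes A: "finite A" and G: "G ` A \<subseteq> R" and R: "finite R"
  shows "(\<Sum>g\<in>R. real (card {\<phi>\<in>A. G \<phi> = g}) ^ 2) = real (card {(\<phi>, \<psi>) \<in> A \<times> A. G \<phi> = G \<psi>})"
proof -
  have "{(\<phi>, \<psi>) \<in> A \<times> A. G \<phi> = G \<psi>} = (\<Union>g\<in>R. {\<phi>\<in>A. G \<phi> = g} \<times> {\<phi>\<in>A. G \<phi> = g})"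
    using G by auto
  then have "card {(\<phi>, \<psi>) \<in> A \<times> A. G \<phi> = G \<psi>} = (\<Sum>g\<in>R. card ({\<phi>\<in>A. G \<phi> = g} \<times> {\<phi>\<in>A. G \<phi> = g}))"
    by (simp only:) (rule card_UN_disjoint, use A R in auto)
  then show ?thesis by (simp add: card_cartesian_product power2_eq_square)
qed

lemma norm_sum_sq_le:
  fixes z :: "'a \<Rightarrow> complex"
  shows "norm (\<Sum>i\<in>A. z i) ^ 2 \<le> real (card A) * (\<Sum>i\<in>A. norm (z i) ^ 2)"
proof -
  have "norm (\<Sum>i\<in>A. z i) ^ 2 \<le> (\<Sum>i\<in>A. 1 * norm (z i)) ^ 2"
    by (intro power_mono) (auto intro: norm_sum)
  also have "\<dots> \<le> (\<Sum>i\<in>A. 1\<^sup>2) * (\<Sum>i\<in>A. norm (z i) ^ 2)" by (rule Cauchy_Schwarz_ineq_sum)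
  finally show ?thesis by simp
qed

text \<open>Only the top coefficient \<open>\<mu>\<close> is sieved; Cauchy--Schwarz over the values of the lower power sums
  replaces the lower coefficients by the factor \<open>\<Prod>\<^sub>i (s Y\<^sup>i + 1)\<close>.\<close>

lemma mean_value_large_sieve:
  fixes \<mu> :: "'a \<Rightarrow> real" and B :: "nat \<Rightarrow> 'a \<Rightarrow> real" and b :: "nat \<Rightarrow> complex"
  assumes ne: "\<Omega> \<noteq> {}" and k: "k \<ge> 1" and b: "\<And>y. norm (b y) \<le> 1"
    and \<Delta>: "\<And>x'. x' \<in> \<Omega> \<Longrightarrow> (\<Sum>x\<in>\<Omega>. peak (real (s * Y ^ k + 1)) (\<mu> x - \<mu> x')) \<le> \<Delta>"
  shows "(\<Sum>x\<in>\<Omega>. norm (\<Sum>y<Y. b y * e ((\<Sum>i\<in>{1..<k}. B i x * real y ^ i) + \<mu> x * real y ^ k)) ^ (2 * s)) \<le>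
    real (\<Prod>i\<in>{1..<k}. s * Y ^ i + 1) * \<Delta> * real (card (vinogradov_pairs s k Y))"
proof -
  let ?T = "tuples s Y"
  define N where "N = s * Y ^ k + 1"
  note \<Delta> = \<Delta>[folded N_def]
  define Lab where "Lab = PiE {1..<k} (\<lambda>i. {..s * Y ^ i})"
  define \<kappa> where "\<kappa> = (\<lambda>\<phi>. restrict (\<lambda>i. power_sum s i \<phi>) {1..<k})"
  define bb where "bb = (\<lambda>\<phi>. \<Prod>i<s. b (\<phi> i))"
  define c where "c = (\<lambda>l h. \<Sum>\<phi>\<in>{\<phi>\<in>?T. (\<kappa> \<phi>, power_sum s k \<phi>) = (l, h)}. bb \<phi>)"
  have finL: "finite Lab" unfolding Lab_def by (intro finite_PiE) auto
  have cardL: "card Lab = (\<Prod>i\<in>{1..<k}. s * Y ^ i + 1)" unfolding Lab_def by (simp add: card_PiE)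
  have ps: "power_sum s i \<phi> \<le> s * Y ^ i" if "\<phi> \<in> ?T" for i \<phi>
  proof -
    have "power_sum s i \<phi> \<le> (\<Sum>j<s. Y ^ i)" unfolding power_sum_def
      using that by (intro sum_mono power_mono) (auto simp: tuples_def PiE_def Pi_def less_imp_le)
    then show ?thesis by simp
  qed
  have G: "(\<lambda>\<phi>. (\<kappa> \<phi>, power_sum s k \<phi>)) ` ?T \<subseteq> Lab \<times> {..<N}"
    using ps by (auto simp: Lab_def \<kappa>_def less_Suc_eq_le N_def)
  have bb: "norm (bb \<phi>) \<le> 1" for \<phi>
    unfolding bb_def prod_norm[symmetric] using b by (intro prod_le_1) auto
  have nc: "norm (c l h) ^ 2 \<le> real (card {\<phi>\<in>?T. (\<kappa> \<phi>, power_sum s k \<phi>) = (l, h)}) ^ 2" for l h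
  proof (rule power_mono)
    have "norm (c l h) \<le> (\<Sum>\<phi>\<in>{\<phi>\<in>?T. (\<kappa> \<phi>, power_sum s k \<phi>) = (l, h)}. 1)"
      unfolding c_def using bb by (intro sum_norm_le) auto
    then show "norm (c l h) \<le> real (card {\<phi>\<in>?T. (\<kappa> \<phi>, power_sum s k \<phi>) = (l, h)})" by simp
  qed simp
  define V where "V = (\<lambda>x. \<Sum>y<Y. b y * e ((\<Sum>i\<in>{1..<k}. B i x * real y ^ i) + \<mu> x * real y ^ k))"
  have Vs: "V x ^ s = (\<Sum>l\<in>Lab. e (\<Sum>i\<in>{1..<k}. B i x * real (l i)) * (\<Sum>h<N. c l h * e (real h * \<mu> x)))" for x
  proof -
    have ph: "(\<Sum>j<s. (\<Sum>i\<in>{1..<k}. B i x * real (\<phi> j) ^ i) + \<mu> x * real (\<phi> j) ^ k) =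
      (\<Sum>i\<in>{1..<k}. B i x * real (\<kappa> \<phi> i)) + real (power_sum s k \<phi>) * \<mu> x" for \<phi>
    proof -
      have "(\<Sum>j<s. \<Sum>i\<in>{1..<k}. B i x * real (\<phi> j) ^ i) = (\<Sum>i\<in>{1..<k}. B i x * real (\<kappa> \<phi> i))"
        by (subst sum.swap) (simp add: \<kappa>_def power_sum_def sum_distrib_left)
      moreover have "(\<Sum>j<s. \<mu> x * real (\<phi> j) ^ k) = real (power_sum s k \<phi>) * \<mu> x"
        by (simp add: power_sum_def sum_distrib_left mult.commute)
      ultimately show ?thesis by (simp only: sum.distrib)
    qed
    define F where "F = (\<lambda>l h. e (\<Sum>i\<in>{1..<k}. B i x * real (l i)) * e (real h * \<mu> x))"
    have "V x ^ s = (\<Sum>\<phi>\<in>?T. \<Prod>j<s. b (\<phi> j) * e ((\<Sum>i\<in>{1..<k}. B i x * real (\<phi> j) ^ i) + \<mu> x * real (\<phi> j) ^ k))"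
      unfolding V_def by (rule sum_power_tuples)
    also have "\<dots> = (\<Sum>\<phi>\<in>?T. bb \<phi> * F (\<kappa> \<phi>) (power_sum s k \<phi>))"
    proof (rule sum.cong[OF refl])
      fix \<phi>
      have "(\<Prod>j<s. b (\<phi> j) * e ((\<Sum>i\<in>{1..<k}. B i x * real (\<phi> j) ^ i) + \<mu> x * real (\<phi> j) ^ k)) =
        bb \<phi> * e ((\<Sum>i\<in>{1..<k}. B i x * real (\<kappa> \<phi> i)) + real (power_sum s k \<phi>) * \<mu> x)"
        by (simp only: prod.distrib e_sum bb_def ph)
      then show "(\<Prod>j<s. b (\<phi> j) * e ((\<Sum>i\<in>{1..<k}. B i x * real (\<phi> j) ^ i) + \<mu> x * real (\<phi> j) ^ k)) =
        bb \<phi> * F (\<kappa> \<phi>) (power_sum s k \<phi>)"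
        by (simp only: F_def e_add)
    qed
    also have "\<dots> = (\<Sum>z\<in>Lab \<times> {..<N}. \<Sum>\<phi>\<in>{\<phi>\<in>?T. (\<kappa> \<phi>, power_sum s k \<phi>) = z}. bb \<phi> * F (\<kappa> \<phi>) (power_sum s k \<phi>))"
      by (rule sum.group[symmetric]) (use finL G in auto)
    also have "\<dots> = (\<Sum>z\<in>Lab \<times> {..<N}. c (fst z) (snd z) * F (fst z) (snd z))"
      unfolding c_def sum_distrib_right by (intro sum.cong refl) auto
    also have "\<dots> = (\<Sum>l\<in>Lab. \<Sum>h<N. c l h * F l h)"
      by (simp add: sum.cartesian_product split_def)
    finally show ?thesis unfolding F_def sum_distrib_left by (simp only: mult_ac)
  qed
  have "(\<Sum>x\<in>\<Omega>. norm (V x) ^ (2 * s)) = (\<Sum>x\<in>\<Omega>. norm (V x ^ s) ^ 2)"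
    by (simp add: norm_power power_mult[symmetric] mult.commute)
  also have "\<dots> \<le> (\<Sum>x\<in>\<Omega>. real (card Lab) * (\<Sum>l\<in>Lab. norm (\<Sum>h<N. c l h * e (real h * \<mu> x)) ^ 2))"
  proof (rule sum_mono)
    fix x
    have "norm (V x ^ s) ^ 2 \<le> real (card Lab) *
      (\<Sum>l\<in>Lab. norm (e (\<Sum>i\<in>{1..<k}. B i x * real (l i)) * (\<Sum>h<N. c l h * e (real h * \<mu> x))) ^ 2)"
      unfolding Vs by (rule norm_sum_sq_le)
    then show "norm (V x ^ s) ^ 2 \<le> real (card Lab) * (\<Sum>l\<in>Lab. norm (\<Sum>h<N. c l h * e (real h * \<mu> x)) ^ 2)"
      by (simp only: norm_mult norm_e mult_1)
  qed
  also have "\<dots> = real (card Lab) * (\<Sum>l\<in>Lab. \<Sum>x\<in>\<Omega>. norm (\<Sum>h<N. c l h * e (real h * \<mu> x)) ^ 2)"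
    unfolding sum_distrib_left[symmetric] by (subst sum.swap) (rule refl)
  also have "\<dots> \<le> real (card Lab) * (\<Sum>l\<in>Lab. \<Delta> * (\<Sum>h<N. norm (c l h) ^ 2))"
    by (intro mult_left_mono sum_mono large_sieve_dual ne \<Delta>) (auto simp: N_def)
  also have "\<dots> = real (card Lab) * \<Delta> * (\<Sum>l\<in>Lab. \<Sum>h<N. norm (c l h) ^ 2)"
    by (simp only: sum_distrib_left[symmetric] mult.assoc)
  also have "\<dots> \<le> real (card Lab) * \<Delta> * real (card (vinogradov_pairs s k Y))"
  proof (rule mult_left_mono)
    have "(\<Sum>l\<in>Lab. \<Sum>h<N. norm (c l h) ^ 2) \<le>
      (\<Sum>l\<in>Lab. \<Sum>h<N. real (card {\<phi>\<in>?T. (\<kappa> \<phi>, power_sum s k \<phi>) = (l, h)}) ^ 2)"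
      by (intro sum_mono nc)
    also have "\<dots> = (\<Sum>z\<in>Lab \<times> {..<N}. real (card {\<phi>\<in>?T. (\<kappa> \<phi>, power_sum s k \<phi>) = z}) ^ 2)"
      by (simp only: sum.cartesian_product split_def prod.collapse)
    also have "\<dots> = real (card {(\<phi>, \<psi>) \<in> ?T \<times> ?T. (\<kappa> \<phi>, power_sum s k \<phi>) = (\<kappa> \<psi>, power_sum s k \<psi>)})"
      by (rule sum_card_fibres_sq) (use finL G in auto)
    also have "{(\<phi>, \<psi>) \<in> ?T \<times> ?T. (\<kappa> \<phi>, power_sum s k \<phi>) = (\<kappa> \<psi>, power_sum s k \<psi>)} = vinogradov_pairs s k Y"
    proof -
      have "(\<kappa> \<phi>, power_sum s k \<phi>) = (\<kappa> \<psi>, power_sum s k \<psi>) \<longleftrightarrow> (\<forall>j\<in>{1..k}. power_sum s j \<phi> = power_sum s j \<psi>)" for \<phi> \<psi>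
      proof
        assume L: "(\<kappa> \<phi>, power_sum s k \<phi>) = (\<kappa> \<psi>, power_sum s k \<psi>)"
        show "\<forall>j\<in>{1..k}. power_sum s j \<phi> = power_sum s j \<psi>"
        proof
          fix j assume j: "j \<in> {1..k}"
          from L have "\<kappa> \<phi> j = \<kappa> \<psi> j" by simp
          then show "power_sum s j \<phi> = power_sum s j \<psi>"
            using L j by (cases "j = k") (auto simp: \<kappa>_def)
        qed
      next
        assume "\<forall>j\<in>{1..k}. power_sum s j \<phi> = power_sum s j \<psi>"
        then show "(\<kappa> \<phi>, power_sum s k \<phi>) = (\<kappa> \<psi>, power_sum s k \<psi>)"
          using k by (auto simp: \<kappa>_def restrict_def fun_eq_iff)
      qed
      then show ?thesis unfolding vinogradov_pairs_def by simp
    qed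
    finally show "(\<Sum>l\<in>Lab. \<Sum>h<N. norm (c l h) ^ 2) \<le> real (card (vinogradov_pairs s k Y))" .
    obtain x' where "x' \<in> \<Omega>" using ne by blast
    have "0 \<le> (\<Sum>x\<in>\<Omega>. peak (real N) (\<mu> x - \<mu> x'))" by (intro sum_nonneg peak_nonneg) (simp add: N_def add_pos_nonneg)
    then have "0 \<le> \<Delta>" using \<Delta>[OF \<open>x' \<in> \<Omega>\<close>] by linarith
    then show "0 \<le> real (card Lab) * \<Delta>" by simp
  qed
  finally show ?thesis unfolding V_def cardL .
qed

section \<open>Completion of incomplete sums by Fourier inversion modulo \<open>Y\<close>\<close>

lemma sum_inverse_mod_expand:
  fixes c :: "nat \<Rightarrow> complex"
  assumes Y: "Y \<ge> 1" and I: "I \<subseteq> {..<Y}"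
  shows "(\<Sum>y\<in>I. c y) = (\<Sum>h<Y. ((\<Sum>y\<in>I. e (- (real y * (real h / real Y)))) / of_nat Y) * (\<Sum>y<Y. c y * e (real y * (real h / real Y))))"
proof -
  have orth: "(\<Sum>h<Y. e (real h * ((real z - real y) / real Y))) = (if z = y then of_nat Y else 0)"
    if "y < Y" "z < Y" for y z
  proof (cases "z = y")
    case True
    then show ?thesis by simp
  next
    case False
    define w where "w = (real z - real y) / real Y"
    have "e w \<noteq> 1"
    proof
      assume "e w = 1"
      then obtain n :: int where "w = of_int n" by (rule e_eq_1_imp_Ints)
      then have "real_of_int (int z - int y) = real_of_int (n * int Y)" unfolding w_def using Y by (simp add: field_simps)
      then have "int z - int y = n * int Y" by (simp only: of_int_eq_iff)
      then have "int Y dvd int z - int y" by simp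
      then have "int z mod int Y = int y mod int Y" by (simp only: mod_eq_dvd_iff)
      then show False using that False by simp
    qed
    moreover have "e w ^ Y = 1"
    proof -
      have "e w ^ Y = e (real Y * w)" by (rule e_mult_nat[symmetric])
      also have "real Y * w = of_int (int z - int y)" unfolding w_def using Y by simp
      finally show ?thesis by (simp only: e_int)
    qed
    ultimately have "(\<Sum>h<Y. e w ^ h) = 0" by (simp add: geometric_sum)
    then show ?thesis using False unfolding e_mult_nat w_def by simp
  qed
  have "(\<Sum>h<Y. ((\<Sum>y\<in>I. e (- (real y * (real h / real Y)))) / of_nat Y) * (\<Sum>y<Y. c y * e (real y * (real h / real Y))))
    = (\<Sum>h<Y. \<Sum>y\<in>I. \<Sum>z<Y. c z / of_nat Y * e (real h * ((real z - real y) / real Y)))"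
  proof (intro sum.cong refl)
    fix h
    have "e (- (real y * (real h / real Y))) / of_nat Y * (c z * e (real z * (real h / real Y))) =
      c z / of_nat Y * e (real h * ((real z - real y) / real Y))" for y z
    proof -
      have "e (real h * ((real z - real y) / real Y)) = e (- (real y * (real h / real Y))) * e (real z * (real h / real Y))"
        unfolding e_add[symmetric] by (rule arg_cong[where f = e]) (simp add: right_diff_distrib diff_divide_distrib mult.commute)
      then show ?thesis by simp
    qed
    then show "((\<Sum>y\<in>I. e (- (real y * (real h / real Y)))) / of_nat Y) * (\<Sum>y<Y. c y * e (real y * (real h / real Y))) =
      (\<Sum>y\<in>I. \<Sum>z<Y. c z / of_nat Y * e (real h * ((real z - real y) / real Y)))"
      unfolding sum_divide_distrib sum_product by (simp only:)
  qed
  also have "\<dots> = (\<Sum>y\<in>I. \<Sum>z<Y. c z / of_nat Y * (\<Sum>h<Y. e (real h * ((real z - real y) / real Y))))"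
    unfolding sum_distrib_left by (subst sum.swap, intro sum.cong refl sum.swap)
  also have "\<dots> = (\<Sum>y\<in>I. \<Sum>z<Y. if z = y then c z else 0)"
  proof (intro sum.cong refl)
    fix y z assume "y \<in> I" "z \<in> {..<Y}"
    then have "y < Y" "z < Y" using I by auto
    from orth[OF this] show "c z / of_nat Y * (\<Sum>h<Y. e (real h * ((real z - real y) / real Y))) = (if z = y then c z else 0)"
      using Y by simp
  qed
  also have "\<dots> = (\<Sum>y\<in>I. c y)" using I by (intro sum.cong refl) (auto simp: subset_iff)
  finally show ?thesis by simp
qed

lemma nat_interval_cases:
  fixes I :: "nat set"
  assumes "finite I" and "\<And>x y z. x \<in> I \<Longrightarrow> z \<in> I \<Longrightarrow> x \<le> y \<Longrightarrow> y \<le> z \<Longrightarrow> y \<in> I"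
  obtains u v where "I = {u..<v}"
proof (cases "I = {}")
  case True
  then show ?thesis using that[of 0 0] by simp
next
  case False
  have m: "Min I \<in> I" "Max I \<in> I" using assms(1) False by auto
  have "I = {Min I..<Suc (Max I)}"
  proof (intro equalityI subsetI)
    fix y assume "y \<in> {Min I..<Suc (Max I)}"
    then show "y \<in> I" using assms(2)[OF m, of y] by simp
  qed (use assms(1) in \<open>auto simp: less_Suc_eq_le\<close>)
  then show ?thesis using that by blast
qed

lemma norm_interval_sum_le_peak:
  assumes Y: "Y \<ge> 1" and I: "{u..<v} \<subseteq> {..<Y}"
  shows "norm (\<Sum>y\<in>{u..<v}. e (- (real y * x))) \<le> peak (real Y) x"
proof (cases "u < v")
  case False
  then show ?thesis using peak_nonneg[of "real Y" x] Y by simp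
next
  case True
  have "v - 1 \<in> {u..<v}" using True by auto
  then have "v - 1 < Y" using I by blast
  then have vY: "v \<le> Y" by linarith
  have "(\<Sum>y\<in>{u..<v}. e (- (real y * x))) = (\<Sum>n<v - u. e (real n * (- x)) * e (- (real u * x)))"
  proof (rule sum.reindex_bij_witness[where i = "\<lambda>n. n + u" and j = "\<lambda>y. y - u"])
    fix y assume y: "y \<in> {u..<v}"
    then have "real (y - u) * (- x) + (- (real u * x)) = - (real y * x)"
      by (simp add: of_nat_diff left_diff_distrib)
    then show "e (real (y - u) * (- x)) * e (- (real u * x)) = e (- (real y * x))"
      by (simp only: e_add[symmetric])
  qed (use True in auto)
  also have "\<dots> = (\<Sum>n<v - u. e (real n * (- x))) * e (- (real u * x))" by (simp add: sum_distrib_right)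
  finally have "norm (\<Sum>y\<in>{u..<v}. e (- (real y * x))) = norm (\<Sum>n<v - u. e (real n * (- x)))"
    by (simp only: norm_mult norm_e mult_1_right)
  also have "\<dots> \<le> peak (real (v - u)) (- x)" by (rule norm_geometric_le_peak) (use True in simp)
  also have "\<dots> \<le> peak (real Y) x" unfolding peak_minus by (rule peak_mono) (use True vY in auto)
  finally show ?thesis .
qed

lemma sum_peak_fractions:
  assumes Y: "Y \<ge> 1"
  shows "(\<Sum>h<Y. peak (real Y) (real h / real Y)) \<le> real Y * (4 + 2 * ln (real Y))"
proof -
  have "(\<Sum>h<Y. peak (real Y) (real h / real Y)) \<le> 2 * real Y + 2 / (1 / real Y) * (1 + ln (1 / (1 / real Y)))"
  proof (rule sum_peak_spaced)
    fix i j assume ij: "i \<in> {..<Y}" "j \<in> {..<Y}" "i \<noteq> j"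
    have "\<not> int Y dvd int i - int j"
    proof
      assume "int Y dvd int i - int j"
      then have "int i mod int Y = int j mod int Y" by (simp only: mod_eq_dvd_iff)
      then show False using ij by simp
    qed
    then have "1 / real_of_int (int Y) \<le> idist (real_of_int (int i - int j) / real_of_int (int Y))"
      using Y by (intro idist_fraction_ge) auto
    then show "1 / real Y \<le> idist (real i / real Y - real j / real Y)" by (simp add: diff_divide_distrib)
  qed (use Y in auto)
  then show ?thesis by (simp add: algebra_simps)
qed

text \<open>The bound no longer involves \<open>u\<close> and \<open>v\<close>, so windows that vary
  with an outer variable can be treated uniformly. By \<open>sum_peak_fractions\<close> the weights
  sum to at most \<open>4 + 2 * ln (real Y)\<close>: the price is a logarithm.\<close>

lemma norm_interval_sum_completion:
  fixes c :: "nat \<Rightarrow> complex"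
  assumes Y: "Y \<ge> 1" and I: "{u..<v} \<subseteq> {..<Y}"
  shows "norm (\<Sum>y\<in>{u..<v}. c y) \<le>
    (\<Sum>h<Y. peak (real Y) (real h / real Y) / real Y * norm (\<Sum>y<Y. c y * e (real y * (real h / real Y))))"
proof -
  have "norm (\<Sum>y\<in>{u..<v}. c y) \<le> (\<Sum>h<Y. norm (((\<Sum>y\<in>{u..<v}. e (- (real y * (real h / real Y)))) / of_nat Y) *
      (\<Sum>y<Y. c y * e (real y * (real h / real Y)))))"
    unfolding sum_inverse_mod_expand[OF Y I, of c] by (rule norm_sum)
  also have "\<dots> \<le> (\<Sum>h<Y. peak (real Y) (real h / real Y) / real Y * norm (\<Sum>y<Y. c y * e (real y * (real h / real Y))))"
    unfolding norm_mult norm_divide norm_of_nat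
    by (intro sum_mono mult_right_mono divide_right_mono norm_interval_sum_le_peak[OF Y I]) auto
  finally show ?thesis .
qed

section \<open>Weyl sums\<close>

text \<open>The coefficient of \<open>y ^ (k + 1)\<close> is free of \<open>x\<close>, and that of
  \<open>y ^ k\<close> is linear in \<open>x\<close>; \<open>A\<close> collects the parts free of
  \<open>x\<close>. A sum of degree \<open>k + 1\<close> therefore needs only the mean value theorem
  in degree \<open>k\<close>, and the slope in \<open>x\<close> provides the frequencies for the
  sieve.\<close>

lemma poly_shift_expand:
  fixes c :: "nat \<Rightarrow> real" and g :: real
  shows "\<exists>A B. \<forall>x y. (\<Sum>i\<le>k + 1. c i * (x + g * y) ^ i) =
    A y + (\<Sum>j<k. B j x * y ^ j) + real (k + 1) * c (k + 1) * g ^ k * x * y ^ k"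
proof -
  define B where "B = (\<lambda>j x. \<Sum>i\<le>k + 1. c i * real (i choose j) * x ^ (i - j) * g ^ j)"
  define A where "A = (\<lambda>y. c k * g ^ k * y ^ k + c (k + 1) * g ^ (k + 1) * y ^ (k + 1))"
  have "(\<Sum>i\<le>k + 1. c i * (x + g * y) ^ i) =
    A y + (\<Sum>j<k. B j x * y ^ j) + real (k + 1) * c (k + 1) * g ^ k * x * y ^ k" for x y
  proof -
    have bin: "(x + g * y) ^ i = (\<Sum>j\<le>k + 1. real (i choose j) * x ^ (i - j) * (g * y) ^ j)" if "i \<le> k + 1" for i
    proof -
      have "(x + g * y) ^ i = (g * y + x) ^ i" by (simp add: add.commute)
      also have "\<dots> = (\<Sum>j\<le>i. real (i choose j) * (g * y) ^ j * x ^ (i - j))" by (rule binomial_ring)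
      also have "\<dots> = (\<Sum>j\<le>k + 1. real (i choose j) * (g * y) ^ j * x ^ (i - j))"
        by (rule sum.mono_neutral_left) (use that in \<open>auto simp: binomial_eq_0\<close>)
      finally show ?thesis by (simp add: mult_ac)
    qed
    have "(\<Sum>i\<le>k + 1. c i * (x + g * y) ^ i) = (\<Sum>i\<le>k + 1. \<Sum>j\<le>k + 1. c i * real (i choose j) * x ^ (i - j) * g ^ j * y ^ j)"
      by (intro sum.cong refl) (simp only: bin atMost_iff sum_distrib_left power_mult_distrib mult_ac)
    also have "\<dots> = (\<Sum>j\<le>k + 1. B j x * y ^ j)" unfolding B_def sum_distrib_right by (rule sum.swap)
    also have "\<dots> = (\<Sum>j<k. B j x * y ^ j) + B k x * y ^ k + B (k + 1) x * y ^ (k + 1)"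
      by (simp add: lessThan_Suc_atMost[symmetric])
    also have "B k x = c k * g ^ k + real (k + 1) * c (k + 1) * x * g ^ k"
    proof -
      have "B k x = (\<Sum>i\<in>{k, k + 1}. c i * real (i choose k) * x ^ (i - k) * g ^ k)"
        unfolding B_def by (rule sum.mono_neutral_right) (auto simp: binomial_eq_0)
      also have "\<dots> = c k * g ^ k + real (k + 1) * c (k + 1) * x * g ^ k" by (simp add: binomial_Suc_n algebra_simps)
      finally show ?thesis .
    qed
    also have "B (k + 1) x = c (k + 1) * g ^ (k + 1)"
    proof -
      have "B (k + 1) x = (\<Sum>i\<in>{k + 1}. c i * real (i choose (k + 1)) * x ^ (i - (k + 1)) * g ^ (k + 1))"
        unfolding B_def by (rule sum.mono_neutral_right) (auto simp: binomial_eq_0)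
      then show ?thesis by simp
    qed
    finally show ?thesis unfolding A_def by (simp add: algebra_simps)
  qed
  then show ?thesis by blast
qed

lemma power_sum_le_card:
  fixes a :: "'a \<Rightarrow> real"
  assumes "finite \<Omega>" "n \<ge> 1" "\<And>x. x \<in> \<Omega> \<Longrightarrow> a x \<ge> 0"
  shows "(\<Sum>x\<in>\<Omega>. a x) ^ n \<le> real (card \<Omega>) ^ (n - 1) * (\<Sum>x\<in>\<Omega>. a x ^ n)"
proof -
  have "(\<Sum>x\<in>\<Omega>. a x) ^ (1 + (n - 1)) \<le> (\<Sum>x\<in>\<Omega>. a x ^ n) ^ 1 * (\<Sum>x\<in>\<Omega>. 1) ^ (n - 1)"
    by (rule holder_pow) (use assms in auto)
  then show ?thesis using assms(2) by (simp add: mult.commute)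
qed

text \<open>Every \<open>y\<close> shifts the summation range by \<open>g * y\<close>, and
  \<open>g * Y \<le> X\<close> confines the shifted variable to the interval from \<open>-X\<close>
  to \<open>X\<close>.\<close>

lemma sum_shifted_windows:
  fixes F :: "int \<Rightarrow> complex"
  assumes g: "g * Y \<le> X"
  shows "of_nat Y * (\<Sum>x<X. F (int x)) =
    (\<Sum>x\<in>{- int X<..<int X}. \<Sum>y\<in>{y. y < Y \<and> 0 \<le> x + int (g * y) \<and> x + int (g * y) < int X}. F (x + int (g * y)))"
proof -
  have "(\<Sum>x<X. F (int x)) = (\<Sum>x\<in>{x\<in>{- int X<..<int X}. 0 \<le> x + int (g * y) \<and> x + int (g * y) < int X}. F (x + int (g * y)))"
    if y: "y < Y" for y
  proof -
    have "g * y < X \<or> X = 0 \<or> g = 0"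
    proof (cases "g = 0")
      case False
      then have "g * y < g * Y" using y by simp
      then have "g * y < X" using g by (rule less_le_trans)
      then show ?thesis by simp
    qed simp
    then have gy: "X = 0 \<or> g * y < X" by auto
    define t where "t = int (g * y)"
    have t: "X = 0 \<or> t < int X" "0 \<le> t" using gy unfolding t_def of_nat_less_iff by auto
    show ?thesis unfolding t_def[symmetric]
      by (rule sum.reindex_bij_witness[where i = "\<lambda>x. nat (x + t)" and j = "\<lambda>z. int z - t"])
         (use t in auto)
  qed
  note window = this
  have "of_nat Y * (\<Sum>x<X. F (int x)) = (\<Sum>y<Y. \<Sum>x<X. F (int x))" by simp
  also have "\<dots> = (\<Sum>y<Y. \<Sum>x\<in>{x\<in>{- int X<..<int X}. 0 \<le> x + int (g * y) \<and> x + int (g * y) < int X}. F (x + int (g * y)))"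
    by (rule sum.cong[OF refl], rule window) simp
  also have "\<dots> = (\<Sum>y<Y. \<Sum>x\<in>{- int X<..<int X}. if 0 \<le> x + int (g * y) \<and> x + int (g * y) < int X then F (x + int (g * y)) else 0)"
    by (intro sum.cong refl sum.inter_filter) auto
  also have "\<dots> = (\<Sum>x\<in>{- int X<..<int X}. \<Sum>y<Y. if 0 \<le> x + int (g * y) \<and> x + int (g * y) < int X then F (x + int (g * y)) else 0)"
    by (rule sum.swap)
  also have "\<dots> = (\<Sum>x\<in>{- int X<..<int X}. \<Sum>y\<in>{y\<in>{..<Y}. 0 \<le> x + int (g * y) \<and> x + int (g * y) < int X}. F (x + int (g * y)))"
    by (intro sum.cong refl sum.inter_filter[symmetric]) auto
  finally show ?thesis by simp
qed

text \<open>Averaging over the shifts \<open>g * y\<close> makes the \<open>x\<close> into points of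
  a sieve with frequencies \<open>\<mu> * x\<close>; completion frees the windows from
  \<open>x\<close>, and Hoelder's inequality produces the power \<open>2 * s\<close>. Differences of
  two points lie between \<open>-2 X\<close> and \<open>2 X\<close>, which is the range in the
  hypothesis on \<open>\<Delta>\<close>.\<close>

lemma weyl_shift:
  fixes G :: "real \<Rightarrow> real"
  assumes k: "k \<ge> 1" and s: "s \<ge> 1" and X: "X \<ge> 1" and Y: "Y \<ge> 1" and gY: "g * Y \<le> X"
    and G: "\<And>x y. G (x + real g * y) = A y + (\<Sum>j<k. B j x * y ^ j) + \<mu> * x * y ^ k"
    and \<Delta>: "(\<Sum>n\<in>{- (2 * int X)<..<2 * int X}. peak (real (s * Y ^ k + 1)) (\<mu> * of_int n)) \<le> \<Delta>"
  shows "(real Y * norm (\<Sum>x<X. e (G (real x)))) ^ (2 * s) \<le>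
    (4 + 2 * ln (real Y)) ^ (2 * s) * (real (2 * X) ^ (2 * s - 1) *
      (real (\<Prod>i\<in>{1..<k}. s * Y ^ i + 1) * \<Delta> * real (card (vinogradov_pairs s k Y))))"
proof -
  let ?\<Omega> = "{- int X<..<int X}"
  let ?N = "real (s * Y ^ k + 1)"
  define F where "F = (\<lambda>x::int. e (G (of_int x)))"
  define I where "I = (\<lambda>x. {y. y < Y \<and> 0 \<le> x + int (g * y) \<and> x + int (g * y) < int X})"
  define V where "V = (\<lambda>h x. \<Sum>y<Y. F (x + int (g * y)) * e (real y * (real h / real Y)))"
  define W where "W = real (2 * X) ^ (2 * s - 1) *
      (real (\<Prod>i\<in>{1..<k}. s * Y ^ i + 1) * \<Delta> * real (card (vinogradov_pairs s k Y)))"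
  have "0 \<in> ?\<Omega>" using X by simp
  then have ne: "?\<Omega> \<noteq> {}" by blast
  have \<Delta>': "(\<Sum>x\<in>?\<Omega>. peak ?N (\<mu> * of_int x - \<mu> * of_int x')) \<le> \<Delta>" if x': "x' \<in> ?\<Omega>" for x'
  proof -
    have "(\<Sum>x\<in>?\<Omega>. peak ?N (\<mu> * of_int x - \<mu> * of_int x')) = (\<Sum>n\<in>(\<lambda>x. x - x') ` ?\<Omega>. peak ?N (\<mu> * of_int n))"
      by (subst sum.reindex) (auto simp: inj_on_def right_diff_distrib)
    also have "\<dots> \<le> (\<Sum>n\<in>{- (2 * int X)<..<2 * int X}. peak ?N (\<mu> * of_int n))"
      by (rule sum_mono2) (use x' in \<open>auto intro!: peak_nonneg simp: add_pos_nonneg\<close>)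
    finally show ?thesis using \<Delta> by linarith
  qed
  have W: "(\<Sum>x\<in>?\<Omega>. norm (V h x)) ^ (2 * s) \<le> W" for h
  proof -
    define b where "b = (\<lambda>y. e (A (real y) + real y * (real h / real Y)))"
    have nV: "norm (V h x) = norm (\<Sum>y<Y. b y * e ((\<Sum>i\<in>{1..<k}. B i (of_int x) * real y ^ i) + \<mu> * of_int x * real y ^ k))" for x
    proof -
      have "F (x + int (g * y)) * e (real y * (real h / real Y)) =
        e (B 0 (of_int x)) * (b y * e ((\<Sum>i\<in>{1..<k}. B i (of_int x) * real y ^ i) + \<mu> * of_int x * real y ^ k))" for y
      proof -
        have "{..<k} = insert 0 {1..<k}" using k by auto
        then have "(\<Sum>j<k. B j (of_int x) * real y ^ j) = B 0 (of_int x) + (\<Sum>i\<in>{1..<k}. B i (of_int x) * real y ^ i)" by simp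
        then have "G (of_int (x + int (g * y))) + real y * (real h / real Y) = B 0 (of_int x) + ((A (real y) + real y * (real h / real Y)) +
          ((\<Sum>i\<in>{1..<k}. B i (of_int x) * real y ^ i) + \<mu> * of_int x * real y ^ k))"
          using G[of "of_int x" "real y"] by simp
        then show ?thesis unfolding F_def b_def e_add[symmetric] by (simp only:)
      qed
      then show ?thesis unfolding V_def by (simp only: sum_distrib_left[symmetric] norm_mult norm_e mult_1)
    qed
    have "(\<Sum>x\<in>?\<Omega>. norm (V h x)) ^ (2 * s) \<le> real (card ?\<Omega>) ^ (2 * s - 1) * (\<Sum>x\<in>?\<Omega>. norm (V h x) ^ (2 * s))"
      by (rule power_sum_le_card) (use s in auto)
    also have "\<dots> \<le> real (2 * X) ^ (2 * s - 1) * (\<Sum>x\<in>?\<Omega>. norm (V h x) ^ (2 * s))"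
      by (intro mult_right_mono power_mono sum_nonneg) auto
    also have "\<dots> \<le> W" unfolding W_def nV
      by (intro mult_left_mono mean_value_large_sieve ne k \<Delta>') (auto simp: b_def)
    finally show ?thesis .
  qed
  have W0: "W \<ge> 0" using order_trans[OF _ W[of 0]] by (simp add: sum_nonneg)
  have Wr: "(\<Sum>x\<in>?\<Omega>. norm (V h x)) \<le> root (2 * s) W" for h
  proof -
    have "(\<Sum>x\<in>?\<Omega>. norm (V h x)) ^ (2 * s) \<le> root (2 * s) W ^ (2 * s)" using W[of h] W0 s by simp
    then show ?thesis using s W0 by (subst (asm) power_mono_iff) (auto intro: sum_nonneg)
  qed
  have "real Y * norm (\<Sum>x<X. e (G (real x))) = norm (of_nat Y * (\<Sum>x<X. F (int x)))"
    by (simp add: norm_mult F_def)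
  also have "\<dots> = norm (\<Sum>x\<in>?\<Omega>. \<Sum>y\<in>I x. F (x + int (g * y)))"
    unfolding sum_shifted_windows[OF gY] I_def ..
  also have "\<dots> \<le> (\<Sum>x\<in>?\<Omega>. norm (\<Sum>y\<in>I x. F (x + int (g * y))))" by (rule norm_sum)
  also have "\<dots> \<le> (\<Sum>x\<in>?\<Omega>. \<Sum>h<Y. peak (real Y) (real h / real Y) / real Y * norm (V h x))"
  proof (rule sum_mono)
    fix x
    have "finite (I x)" unfolding I_def by simp
    moreover have "y \<in> I x" if "y1 \<in> I x" "y2 \<in> I x" "y1 \<le> y" "y \<le> y2" for y y1 y2
    proof -
      have "int (g * y1) \<le> int (g * y)" "int (g * y) \<le> int (g * y2)" using that by (auto intro!: mult_left_mono)
      then show ?thesis using that unfolding I_def by auto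
    qed
    ultimately obtain u v where uv: "I x = {u..<v}" by (rule nat_interval_cases)
    have "I x \<subseteq> {..<Y}" unfolding I_def by auto
    then show "norm (\<Sum>y\<in>I x. F (x + int (g * y))) \<le> (\<Sum>h<Y. peak (real Y) (real h / real Y) / real Y * norm (V h x))"
      unfolding uv V_def by (rule norm_interval_sum_completion[OF Y])
  qed
  also have "\<dots> = (\<Sum>h<Y. peak (real Y) (real h / real Y) / real Y * (\<Sum>x\<in>?\<Omega>. norm (V h x)))"
    unfolding sum_distrib_left by (rule sum.swap)
  also have "\<dots> \<le> (\<Sum>h<Y. peak (real Y) (real h / real Y) / real Y * root (2 * s) W)"
    using Y by (intro sum_mono mult_left_mono Wr divide_nonneg_nonneg peak_nonneg) auto
  also have "\<dots> = (\<Sum>h<Y. peak (real Y) (real h / real Y)) / real Y * root (2 * s) W"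
    by (simp only: sum_distrib_right sum_divide_distrib)
  also have "\<dots> \<le> (4 + 2 * ln (real Y)) * root (2 * s) W"
  proof (rule mult_right_mono)
    show "(\<Sum>h<Y. peak (real Y) (real h / real Y)) / real Y \<le> 4 + 2 * ln (real Y)"
      using sum_peak_fractions[OF Y] Y by (simp add: divide_le_eq mult.commute)
  qed (use W0 s in simp)
  finally have "(real Y * norm (\<Sum>x<X. e (G (real x)))) ^ (2 * s) \<le> ((4 + 2 * ln (real Y)) * root (2 * s) W) ^ (2 * s)"
    by (intro power_mono) auto
  also have "\<dots> = (4 + 2 * ln (real Y)) ^ (2 * s) * W"
    using W0 s by (simp add: power_mult_distrib)
  finally show ?thesis unfolding W_def .
qed

text \<open>The lower power sums and the mean value together contribute the power k^2 of
  \<open>Y\<close>. Against \<open>2 * sK k\<close>, which is k^2 + k, this leaves a saving of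
  \<open>Y ^ k\<close>.\<close>

lemma sum_lessThan_sK: "1 \<le> k \<Longrightarrow> (\<Sum>i\<in>{1..<k}. i) + sK k = k ^ 2"
proof (induction k rule: dec_induct)
  case base
  show ?case by (simp add: sK_def)
next
  case (step k)
  have "sK (Suc k) = sK k + (k + 1)"
  proof -
    have "2 * sK (Suc k) = 2 * (sK k + (k + 1))" using two_sK[of k] two_sK[of "Suc k"] by (simp add: algebra_simps)
    then show ?thesis by simp
  qed
  moreover have "(\<Sum>i\<in>{1..<Suc k}. i) = (\<Sum>i\<in>{1..<k}. i) + k" using step by simp
  ultimately show ?case using step by (simp add: power2_eq_square)
qed

text \<open>The trivial size of \<open>\<Delta>\<close> is of order \<open>X * Y ^ k\<close>, so the
  last factor measures what the spacing of the frequencies saves.\<close>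

theorem weyl_bound_window:
  assumes k: "k \<ge> 1" and \<epsilon>: "\<epsilon> > 0"
  shows "\<exists>C\<ge>1. \<forall>X Y g (c :: nat \<Rightarrow> real) \<Delta>. X \<ge> 1 \<longrightarrow> Y \<ge> 1 \<longrightarrow> g * Y \<le> X \<longrightarrow>
    (\<Sum>n\<in>{- (2 * int X)<..<2 * int X}. peak (real (sK k * Y ^ k + 1)) (real (k + 1) * c (k + 1) * real g ^ k * of_int n)) \<le> \<Delta> \<longrightarrow>
    norm (\<Sum>x<X. e (\<Sum>i\<le>k + 1. c i * real x ^ i)) ^ (2 * sK k) \<le>
      C * real X ^ (2 * sK k) * real Y powr \<epsilon> * (\<Delta> / (real X * real Y ^ k))"
proof -
  define s where "s = sK k"
  have s: "s \<ge> 1" using sK_pos[of k] k by (simp add: s_def)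
  \<comment> \<open>With this \<open>\<delta>\<close> the power \<open>2 * s\<close> of the
    logarithm costs \<open>Y\<close> to the power \<open>\<epsilon> / 2\<close>; the other half goes
    to the mean value theorem.\<close>
  define \<delta> where "\<delta> = \<epsilon> / (4 * real s)"
  have \<delta>: "\<delta> > 0" unfolding \<delta>_def using \<epsilon> s by simp
  obtain C0 where C0: "C0 \<ge> 1" "\<And>N. N \<ge> 1 \<Longrightarrow> real (card (vinogradov_pairs s k N)) \<le> C0 * real N powr (real s + \<epsilon> / 2)"
    using vinogradov_mean_value[OF k, of "\<epsilon> / 2"] \<epsilon> unfolding s_def by auto
  define C where "C = (4 + 2 / \<delta>) ^ (2 * s) * 2 ^ (2 * s - 1) * real (2 * s) ^ (k - 1) * C0"
  have C1: "C \<ge> 1"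
  proof -
    have "1 * 1 * 1 * 1 \<le> C" unfolding C_def using \<delta> s C0(1)
      by (intro mult_mono one_le_power mult_nonneg_nonneg) auto
    then show ?thesis by simp
  qed
  show ?thesis
  proof (rule exI[of _ C], intro conjI allI impI C1)
    fix X Y g :: nat and c :: "nat \<Rightarrow> real" and \<Delta>
    assume X: "X \<ge> 1" and Y: "Y \<ge> 1" and gY: "g * Y \<le> X"
      and \<Delta>: "(\<Sum>n\<in>{- (2 * int X)<..<2 * int X}. peak (real (sK k * Y ^ k + 1)) (real (k + 1) * c (k + 1) * real g ^ k * of_int n)) \<le> \<Delta>"
    define S where "S = norm (\<Sum>x<X. e (\<Sum>i\<le>k + 1. c i * real x ^ i))"
    define y where "y = real Y"
    have y: "y \<ge> 1" using Y by (simp add: y_def)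
    have \<Delta>0: "\<Delta> \<ge> 0"
    proof -
      have "0 \<le> (\<Sum>n\<in>{- (2 * int X)<..<2 * int X}. peak (real (sK k * Y ^ k + 1)) (real (k + 1) * c (k + 1) * real g ^ k * of_int n))"
        by (intro sum_nonneg peak_nonneg) (simp add: add_pos_nonneg)
      then show ?thesis using \<Delta> by linarith
    qed
    obtain A B where AB: "\<And>x y. (\<Sum>i\<le>k + 1. c i * (x + real g * y) ^ i) =
      A y + (\<Sum>j<k. B j x * y ^ j) + real (k + 1) * c (k + 1) * real g ^ k * x * y ^ k"
      using poly_shift_expand[where k = k and c = c and g = "real g"] by blast
    have main: "(y * S) ^ (2 * s) \<le> (4 + 2 * ln y) ^ (2 * s) * (real (2 * X) ^ (2 * s - 1) *
      (real (\<Prod>i\<in>{1..<k}. s * Y ^ i + 1) * \<Delta> * real (card (vinogradov_pairs s k Y))))"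
      unfolding y_def S_def by (rule weyl_shift[OF k s X Y gY AB]) (use \<Delta> in \<open>simp add: s_def\<close>)
    have l1: "(4 + 2 * ln y) ^ (2 * s) \<le> (4 + 2 / \<delta>) ^ (2 * s) * y powr (\<epsilon> / 2)"
    proof -
      have "ln y \<le> y powr \<delta> / \<delta>" using ln_powr_bound[OF y \<delta>] .
      moreover have "1 \<le> y powr \<delta>" using y \<delta> by (simp add: ge_one_powr_ge_zero)
      ultimately have "4 + 2 * ln y \<le> (4 + 2 / \<delta>) * y powr \<delta>" by (simp add: algebra_simps)
      then have "(4 + 2 * ln y) ^ (2 * s) \<le> ((4 + 2 / \<delta>) * y powr \<delta>) ^ (2 * s)"
        using y by (intro power_mono) auto
      also have "\<dots> = (4 + 2 / \<delta>) ^ (2 * s) * y powr (\<delta> * real (2 * s))"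
        using y by (simp add: power_mult_distrib powr_realpow[symmetric] powr_powr del: powr_realpow')
      also have "\<delta> * real (2 * s) = \<epsilon> / 2" unfolding \<delta>_def using s by simp
      finally show ?thesis .
    qed
    have l2: "real (\<Prod>i\<in>{1..<k}. s * Y ^ i + 1) \<le> real (2 * s) ^ (k - 1) * y ^ (\<Sum>i\<in>{1..<k}. i)"
    proof -
      have "real (\<Prod>i\<in>{1..<k}. s * Y ^ i + 1) = (\<Prod>i\<in>{1..<k}. real s * y ^ i + 1)" by (simp add: y_def add.commute)
      also have "\<dots> \<le> (\<Prod>i\<in>{1..<k}. real (2 * s) * y ^ i)"
      proof (rule prod_mono)
        fix i assume "i \<in> {1..<k}"
        have "1 * 1 \<le> real s * y ^ i" using s y by (intro mult_mono) auto
        then show "0 \<le> real s * y ^ i + 1 \<and> real s * y ^ i + 1 \<le> real (2 * s) * y ^ i" by simp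
      qed
      also have "\<dots> = real (2 * s) ^ (k - 1) * y ^ (\<Sum>i\<in>{1..<k}. i)" by (simp add: prod.distrib power_sum)
      finally show ?thesis .
    qed
    have l3: "real (card (vinogradov_pairs s k Y)) \<le> C0 * (y ^ s * y powr (\<epsilon> / 2))"
      using C0(2)[OF Y] y unfolding y_def by (simp add: powr_add powr_realpow)
    have "(y * S) ^ (2 * s) \<le> ((4 + 2 / \<delta>) ^ (2 * s) * y powr (\<epsilon> / 2)) * (real (2 * X) ^ (2 * s - 1) *
      ((real (2 * s) ^ (k - 1) * y ^ (\<Sum>i\<in>{1..<k}. i)) * \<Delta> * (C0 * (y ^ s * y powr (\<epsilon> / 2)))))"
      using main \<Delta>0 \<delta> y C0(1)
      by (elim order_trans) (intro mult_mono l1 l2 l3 mult_nonneg_nonneg zero_le_power add_nonneg_nonneg of_nat_0_le_iff; simp)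
    also have "\<dots> = C * real X ^ (2 * s - 1) * (y ^ ((\<Sum>i\<in>{1..<k}. i) + s)) * (y powr (\<epsilon> / 2) * y powr (\<epsilon> / 2)) * \<Delta>"
      unfolding C_def power_add by (simp add: power_mult_distrib)
    also have "y powr (\<epsilon> / 2) * y powr (\<epsilon> / 2) = y powr \<epsilon>" by (simp add: powr_add[symmetric])
    also have "(\<Sum>i\<in>{1..<k}. i) + s = k ^ 2" unfolding s_def by (rule sum_lessThan_sK[OF k])
    finally have f: "(y * S) ^ (2 * s) \<le> C * real X ^ (2 * s - 1) * y ^ k ^ 2 * y powr \<epsilon> * \<Delta>" .
    have ys: "y ^ (2 * s) = y ^ k ^ 2 * y ^ k"
    proof -
      have "2 * s = k ^ 2 + k" unfolding s_def two_sK by (simp add: power2_eq_square)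
      then show ?thesis by (simp add: power_add)
    qed
    have yp: "y ^ k ^ 2 > 0" "y ^ k > 0" using y by auto
    have "y ^ k ^ 2 * (y ^ k * S ^ (2 * s)) \<le> y ^ k ^ 2 * (C * real X ^ (2 * s - 1) * y powr \<epsilon> * \<Delta>)"
      using f unfolding power_mult_distrib ys by (simp only: mult_ac)
    then have "y ^ k * S ^ (2 * s) \<le> C * real X ^ (2 * s - 1) * y powr \<epsilon> * \<Delta>"
      using yp(1) by (rule mult_left_le_imp_le)
    then have "S ^ (2 * s) \<le> C * real X ^ (2 * s - 1) * y powr \<epsilon> * \<Delta> / y ^ k"
      using yp(2) by (simp add: pos_le_divide_eq mult.commute)
    also have "real X ^ (2 * s - 1) = real X ^ (2 * s) / real X"
      using X s by (simp add: power_diff)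
    finally show "norm (\<Sum>x<X. e (\<Sum>i\<le>k + 1. c i * real x ^ i)) ^ (2 * sK k) \<le>
      C * real X ^ (2 * sK k) * real Y powr \<epsilon> * (\<Delta> / (real X * real Y ^ k))"
      unfolding S_def s_def y_def by simp
  qed
qed

text \<open>The range is cut into blocks of length \<open>M\<close>. Two points of one block differ
  by \<open>\<mu> * of_int m\<close> with \<open>\<bar>m\<bar> < int M\<close>, so that
  \<open>sum_peak_spaced\<close> applies to each block.\<close>

lemma sum_peak_multiples:
  assumes M: "M \<ge> 1" and \<delta>: "0 < \<delta>" "\<delta> \<le> 1" and N: "N > 0"
    and sp: "\<And>m :: int. m \<noteq> 0 \<Longrightarrow> \<bar>m\<bar> < int M \<Longrightarrow> \<delta> \<le> idist (\<mu> * of_int m)"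
  shows "(\<Sum>n\<in>{- (2 * int X)<..<2 * int X}. peak N (\<mu> * of_int n)) \<le>
    (4 * real X / real M + 1) * (2 * N + 2 / \<delta> * (1 + ln (1 / \<delta>)))"
proof -
  let ?A = "{- (2 * int X)<..<2 * int X}"
  define h where "h = (\<lambda>n. (n + 2 * int X) div int M)"
  have M0: "int M > 0" using M by simp
  have "(\<Sum>n\<in>?A. peak N (\<mu> * of_int n)) = (\<Sum>b\<in>{0..int (4 * X div M)}. \<Sum>n\<in>{n\<in>?A. h n = b}. peak N (\<mu> * of_int n))"
  proof (rule sum.group[symmetric])
    show "h ` ?A \<subseteq> {0..int (4 * X div M)}"
    proof
      fix b assume "b \<in> h ` ?A"
      then obtain n where n: "b = (n + 2 * int X) div int M" "0 \<le> n + 2 * int X" "n + 2 * int X \<le> 4 * int X"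
        unfolding h_def by auto
      have "b \<le> (4 * int X) div int M" unfolding n(1) using n(3) M0 by (intro zdiv_mono1) auto
      moreover have "0 \<le> b" unfolding n(1) using n(2) M0 by (simp add: pos_imp_zdiv_nonneg_iff)
      ultimately show "b \<in> {0..int (4 * X div M)}" by (simp add: zdiv_int)
    qed
  qed auto
  also have "\<dots> \<le> (\<Sum>b\<in>{0..int (4 * X div M)}. 2 * N + 2 / \<delta> * (1 + ln (1 / \<delta>)))"
  proof (rule sum_mono)
    fix b
    have fin: "finite {n\<in>?A. h n = b}" by (rule finite_subset[of _ ?A]) auto
    show "(\<Sum>n\<in>{n\<in>?A. h n = b}. peak N (\<mu> * of_int n)) \<le> 2 * N + 2 / \<delta> * (1 + ln (1 / \<delta>))"
    proof (rule sum_peak_spaced[OF fin \<delta> _ N])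
      fix i j assume i: "i \<in> {n\<in>?A. h n = b}" and j: "j \<in> {n\<in>?A. h n = b}" and ij: "i \<noteq> j"
      have "i + 2 * int X = int M * b + (i + 2 * int X) mod int M" "j + 2 * int X = int M * b + (j + 2 * int X) mod int M"
      proof -
        have "(i + 2 * int X) div int M = b" "(j + 2 * int X) div int M = b" using i j unfolding h_def by auto
        then show "i + 2 * int X = int M * b + (i + 2 * int X) mod int M" "j + 2 * int X = int M * b + (j + 2 * int X) mod int M"
          using mult_div_mod_eq[of "int M" "i + 2 * int X"] mult_div_mod_eq[of "int M" "j + 2 * int X"] by simp_all
      qed
      moreover have "0 \<le> (i + 2 * int X) mod int M" "(i + 2 * int X) mod int M < int M"
        "0 \<le> (j + 2 * int X) mod int M" "(j + 2 * int X) mod int M < int M" using M0 by auto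
      ultimately have "\<bar>i - j\<bar> < int M" by linarith
      then show "\<delta> \<le> idist (\<mu> * of_int i - \<mu> * of_int j)"
        using sp[of "i - j"] ij by (simp add: right_diff_distrib)
    qed
  qed
  also have "\<dots> = (real (4 * X div M) + 1) * (2 * N + 2 / \<delta> * (1 + ln (1 / \<delta>)))"
    by simp
  also have "\<dots> \<le> (4 * real X / real M + 1) * (2 * N + 2 / \<delta> * (1 + ln (1 / \<delta>)))"
  proof (rule mult_right_mono)
    have "real (4 * X div M) \<le> real (4 * X) / real M" by (rule of_nat_div_le_of_nat)
    then show "real (4 * X div M) + 1 \<le> 4 * real X / real M + 1" by simp
    have "ln (1 / \<delta>) \<ge> 0" using \<delta> by simp
    then show "0 \<le> 2 * N + 2 / \<delta> * (1 + ln (1 / \<delta>))" using N \<delta> by (intro add_nonneg_nonneg mult_nonneg_nonneg) auto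
  qed
  finally show ?thesis .
qed

lemma idist_eq_abs: "\<bar>x\<bar> \<le> 1 / 2 \<Longrightarrow> idist x = \<bar>x\<bar>"
proof (rule antisym)
  show "idist x \<le> \<bar>x\<bar>" using idist_le[of x 0] by simp
  assume x: "\<bar>x\<bar> \<le> 1 / 2"
  show "\<bar>x\<bar> \<le> idist x"
  proof (cases "round x = 0")
    case True
    then show ?thesis by (simp add: idist_def)
  next
    case False
    then have "1 \<le> \<bar>of_int (round x) :: real\<bar>" by (metis of_int_1_le_iff of_int_abs zero_less_abs_iff int_one_le_iff_zero_less)
    then show ?thesis unfolding idist_def using x by linarith
  qed
qed

lemma idist_multiple_near_fraction:
  fixes b t m :: int
  assumes t: "t \<ge> 1" and b: "coprime b t" and m: "\<not> t dvd m" and l: "\<bar>\<xi> * of_int m\<bar> \<le> 1 / (2 * of_int t)"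
  shows "1 / (2 * of_int t) \<le> idist ((of_int b / of_int t + \<xi>) * of_int m)"
proof -
  have "\<not> t dvd b * m" using b m by (simp add: coprime_commute coprime_dvd_mult_right_iff)
  then have "1 / of_int t \<le> idist (of_int (b * m) / of_int t)" using t by (intro idist_fraction_ge) auto
  also have "\<dots> \<le> idist (of_int (b * m) / of_int t + \<xi> * of_int m) + \<bar>\<xi> * of_int m\<bar>" by (rule idist_triangle)
  also have "of_int (b * m) / of_int t + \<xi> * of_int m = (of_int b / of_int t + \<xi>) * of_int m" by (simp add: distrib_right)
  finally have "1 / of_int t \<le> idist ((of_int b / of_int t + \<xi>) * of_int m) + 1 / (2 * of_int t)" using l by linarith
  moreover have "1 / of_int t = 1 / (2 * of_int t) + 1 / (2 * of_int t :: real)" using t by (simp add: field_simps)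
  ultimately show ?thesis by linarith
qed

text \<open>The lower bound \<open>Z\<close> for the combined size \<open>t max(1, X\<^bsup>k+1\<^esup> |\<beta> - b/t|)\<close> of all rational
  approximations measures how far the sum is from a major arc. The windows are kept as short as a power of
  that size, so that the loss \<open>Y\<^bsup>\<epsilon>\<^esup>\<close> of the mean value theorem is absorbed by passing from
  the exponent \<open>1 / (2 s)\<close> to \<open>1 / (2 s + 2)\<close>.\<close>

theorem weyl_bound:
  assumes k: "k \<ge> 1"
  shows "\<exists>C\<ge>1. \<forall>(X::nat) (c :: nat \<Rightarrow> real) (Z::real). 1 \<le> Z \<longrightarrow> Z \<le> real X \<longrightarrow>
    (\<forall>b t :: int. t \<ge> 1 \<longrightarrow> coprime b t \<longrightarrow> Z \<le> of_int t \<or>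
      Z \<le> of_int t * real X ^ (k + 1) * \<bar>real (k + 1) * c (k + 1) - of_int b / of_int t\<bar>) \<longrightarrow>
    norm (\<Sum>x<X. e (\<Sum>i\<le>k + 1. c i * real x ^ i)) \<le> C * real X * (1 + ln (real X)) * Z powr (- 1 / real (2 * sK k + 2))"
proof -
  define s where "s = sK k"
  have s: "s \<ge> 1" using sK_pos[of k] k by (simp add: s_def)
  \<comment> \<open>The loss is \<open>Y powr \<epsilon>\<close> with \<open>Y\<close> at most
    \<open>18 * T ^ 2\<close>, hence of order T^(2 \<epsilon>). Taking \<epsilon> = 1/E gives (1 - 2
    \<epsilon>)/(2s) = 1/E exactly when E = 2s + 2.\<close>
  define E where "E = real (2 * s + 2)"
  have E: "E > 2" unfolding E_def using s by simp
  define \<epsilon> where "\<epsilon> = 1 / E"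
  have \<epsilon>: "\<epsilon> > 0" "\<epsilon> \<le> 1" unfolding \<epsilon>_def using E by auto
  have \<epsilon>s: "1 - 2 * \<epsilon> = real (2 * s) / E" unfolding \<epsilon>_def using E by (simp add: E_def field_simps)
  obtain C0 where C0: "C0 \<ge> 1" "\<And>X Y g (c :: nat \<Rightarrow> real) \<Delta>. X \<ge> 1 \<Longrightarrow> Y \<ge> 1 \<Longrightarrow> g * Y \<le> X \<Longrightarrow>
    (\<Sum>n\<in>{- (2 * int X)<..<2 * int X}. peak (real (s * Y ^ k + 1)) (real (k + 1) * c (k + 1) * real g ^ k * of_int n)) \<le> \<Delta> \<Longrightarrow>
    norm (\<Sum>x<X. e (\<Sum>i\<le>k + 1. c i * real x ^ i)) ^ (2 * s) \<le>
      C0 * real X ^ (2 * s) * real Y powr \<epsilon> * (\<Delta> / (real X * real Y ^ k))"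
    using weyl_bound_window[OF k \<epsilon>(1)] unfolding s_def by blast
  \<comment> \<open>The sum of the constants that arise in the two cases \<open>Z \<le> t\<close>
    and \<open>t < Z\<close> below.\<close>
  define K where "K = 9 * (4 * real s + 32 * (16 + real k)) + 2 * (4 * real s + 2 * (2 + 4 ^ k) * (1 + ln (2 + 4 ^ k) + real (k + 1)))"
  define C where "C = 18 * C0 * K"
  have Kpos: "9 * (4 * real s + 32 * (16 + real k)) \<le> K" "2 * (4 * real s + 2 * (2 + 4 ^ k) * (1 + ln (2 + 4 ^ k) + real (k + 1))) \<le> K"
  proof -
    have "ln (2 + 4 ^ k :: real) \<ge> 0" by (intro ln_ge_zero) (simp add: add_increasing2)
    then show "9 * (4 * real s + 32 * (16 + real k)) \<le> K" unfolding K_def by (simp add: add_nonneg_nonneg mult_nonneg_nonneg)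
    show "2 * (4 * real s + 2 * (2 + 4 ^ k) * (1 + ln (2 + 4 ^ k) + real (k + 1))) \<le> K" unfolding K_def by simp
  qed
  have K1: "K \<ge> 1" using Kpos(1) s by simp
  have C1: "C \<ge> 1"
  proof -
    have "1 * 1 * 1 \<le> 18 * C0 * K" using C0(1) K1 by (intro mult_mono) auto
    then show ?thesis unfolding C_def by simp
  qed
  have conclude: "norm (\<Sum>x<X. e (\<Sum>i\<le>k + 1. c i * real x ^ i)) \<le> C * real X * (1 + ln (real X)) * Z powr (- 1 / E)"
    if X: "X \<ge> 1" and Z: "1 \<le> Z" "Z \<le> T" and Y: "Y \<ge> 1" "real Y \<le> 18 * T ^ 2" and g: "g * Y \<le> X"
      and \<Delta>: "(\<Sum>n\<in>{- (2 * int X)<..<2 * int X}. peak (real (s * Y ^ k + 1)) (real (k + 1) * c (k + 1) * real g ^ k * of_int n))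
         \<le> K * (1 + ln (real X)) * (real X * real Y ^ k / T)"
    for X Y g :: nat and Z T :: real and c :: "nat \<Rightarrow> real"
  proof -
    let ?S = "norm (\<Sum>x<X. e (\<Sum>i\<le>k + 1. c i * real x ^ i))"
    define L where "L = 1 + ln (real X)"
    have L: "L \<ge> 1" unfolding L_def using X by simp
    have T: "T \<ge> 1" using Z by simp
    have XY: "real X * real Y ^ k > 0" using X Y by simp
    have "?S ^ (2 * s) \<le> C0 * real X ^ (2 * s) * real Y powr \<epsilon> * (K * L * (real X * real Y ^ k / T) / (real X * real Y ^ k))"
      unfolding L_def by (rule C0(2)[where c = c, OF X Y(1) g \<Delta>])
    also have "\<dots> = C0 * real X ^ (2 * s) * real Y powr \<epsilon> * (K * L / T)" using X Y by simp
    also have "\<dots> \<le> C0 * real X ^ (2 * s) * (18 * T powr (2 * \<epsilon>)) * (K * L / T)"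
    proof (intro mult_right_mono mult_left_mono)
      have "real Y powr \<epsilon> \<le> (18 * T ^ 2) powr \<epsilon>" using Y \<epsilon> by (intro powr_mono2) auto
      also have "T ^ 2 = T powr 2" using T by simp
      also have "(18 * T powr 2) powr \<epsilon> = 18 powr \<epsilon> * T powr (2 * \<epsilon>)" by (simp add: powr_mult powr_powr)
      also have "\<dots> \<le> 18 powr 1 * T powr (2 * \<epsilon>)" using \<epsilon> by (intro mult_right_mono powr_mono) auto
      finally show "real Y powr \<epsilon> \<le> 18 * T powr (2 * \<epsilon>)" by simp
    qed (use C0(1) K1 L T in auto)
    also have "\<dots> = C * L * real X ^ (2 * s) * (T powr (2 * \<epsilon>) / T)" unfolding C_def by simp
    also have "T powr (2 * \<epsilon>) / T = T powr (- (real (2 * s) / E))"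
      using T unfolding \<epsilon>s[symmetric] by (simp add: powr_diff)
    also have "\<dots> \<le> Z powr (- (real (2 * s) / E))"
      using Z E by (intro powr_mono2') auto
    also have "Z powr (- (real (2 * s) / E)) = (Z powr (- 1 / E)) ^ (2 * s)"
      using Z by (simp add: powr_realpow[symmetric] powr_powr del: powr_realpow')
    finally have "?S ^ (2 * s) \<le> C * L * real X ^ (2 * s) * (Z powr (- 1 / E)) ^ (2 * s)"
      using C1 L by (simp add: mult_left_mono)
    also have "\<dots> \<le> (C * L) ^ (2 * s) * real X ^ (2 * s) * (Z powr (- 1 / E)) ^ (2 * s)"
    proof (intro mult_right_mono)
      have "1 * 1 \<le> C * L" using C1 L by (intro mult_mono) auto
      then show "C * L \<le> (C * L) ^ (2 * s)" using s by (intro self_le_power) auto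
    qed auto
    also have "\<dots> = (C * real X * L * Z powr (- 1 / E)) ^ (2 * s)" by (simp add: power_mult_distrib)
    finally have "?S ^ (2 * s) \<le> (C * real X * L * Z powr (- 1 / E)) ^ (2 * s)" .
    then show ?thesis using s C1 L unfolding L_def by (subst (asm) power_mono_iff) auto
  qed
  show ?thesis
  proof (rule exI[of _ C], intro conjI allI impI C1)
    fix X :: nat and c :: "nat \<Rightarrow> real" and Z :: real
    assume Z1: "1 \<le> Z" and ZX: "Z \<le> real X"
      and app: "\<forall>b t :: int. t \<ge> 1 \<longrightarrow> coprime b t \<longrightarrow> Z \<le> of_int t \<or>
      Z \<le> of_int t * real X ^ (k + 1) * \<bar>real (k + 1) * c (k + 1) - of_int b / of_int t\<bar>"
    define \<beta> where "\<beta> = real (k + 1) * c (k + 1)"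
    have X: "X \<ge> 1" using Z1 ZX by linarith
    define L where "L = 1 + ln (real X)"
    have L: "L \<ge> 1" unfolding L_def using X by simp
    have xk: "real X ^ k \<ge> 1" using X by simp
    \<comment> \<open>The factor 8 yields \<open>8 * T \<le> real X\<close> in the case of a small
      denominator, so that a window of length about \<open>8 * T\<close> fits.\<close>
    obtain b ti where bt: "coprime b ti" "0 < ti" "ti \<le> int (8 * X ^ k)" "\<bar>of_int ti * \<beta> - of_int b\<bar> < 1 / real (8 * X ^ k)"
      using Dirichlet_approx_coprime[of "8 * X ^ k" \<beta>] X by auto
    define t where "t = real_of_int ti"
    have t: "t \<ge> 1" "t \<le> 8 * real X ^ k" 
    proof -
      show "t \<ge> 1" unfolding t_def using bt(2) by simp
      have "real_of_int ti \<le> real_of_int (int (8 * X ^ k))" using bt(3) by (simp only: of_int_le_iff)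
      then show "t \<le> 8 * real X ^ k" unfolding t_def by simp
    qed
    define \<xi> where "\<xi> = \<beta> - of_int b / t"
    have \<beta>: "\<beta> = of_int b / of_int ti + \<xi>" unfolding \<xi>_def t_def by simp
    have tl: "t * \<bar>\<xi>\<bar> < 1 / (8 * real X ^ k)"
    proof -
      have "of_int ti * \<beta> - of_int b = t * \<xi>"
        unfolding \<xi>_def t_def using bt(2) by (simp add: right_diff_distrib)
      then have "\<bar>of_int ti * \<beta> - of_int b\<bar> = t * \<bar>\<xi>\<bar>" using t(1) by (simp add: abs_mult)
      then show ?thesis using bt(4) by simp
    qed
    have ti1: "ti \<ge> 1" using bt(2) by simp
    show "norm (\<Sum>x<X. e (\<Sum>i\<le>k + 1. c i * real x ^ i)) \<le> C * real X * (1 + ln (real X)) * Z powr (- 1 / real (2 * sK k + 2))"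
    proof (cases "Z \<le> t")
      case True
      define T where "T = min t (real X)"
      have T: "Z \<le> T" "T \<ge> 1" "T \<le> t" "T \<le> real X" unfolding T_def using True ZX Z1 by auto
      define Y where "Y = min X (nat ti ^ 2)"
      have rt: "real (nat ti) = t" unfolding t_def using ti1 by simp
      have rY: "real Y = min (real X) (t ^ 2)"
        unfolding Y_def of_nat_min by (simp add: rt)
      have Y: "Y \<ge> 1" unfolding Y_def using X ti1 by (simp add: Suc_le_eq)
      have YT: "real Y \<le> 18 * T ^ 2"
      proof -
        have "real Y \<le> T ^ 2"
        proof (cases "t \<le> real X")
          case True
          then show ?thesis unfolding rY T_def by simp
        next
          case False
          have "real X * 1 \<le> real X * real X" using X by (intro mult_left_mono) auto
          then show ?thesis unfolding rY T_def using False by (simp add: power2_eq_square)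
        qed
        then show ?thesis by (simp add: add_increasing2)
      qed
      have tY: "t \<le> 8 * real Y ^ k"
      proof (cases "real X \<le> t ^ 2")
        case True
        then show ?thesis unfolding rY using t by simp
      next
        case False
        have "t ^ 1 \<le> t ^ (2 * k)" using t(1) k by (intro power_increasing) auto
        then have "t \<le> 8 * t ^ (2 * k)" using t(1) by simp
        then show ?thesis unfolding rY using False by (simp add: power_mult)
      qed
      have Yk: "real Y ^ k \<ge> 1" using Y by simp
      \<comment> \<open>Half of the denominator, rounded up: for
        \<open>\<bar>m\<bar> < int M\<close> the perturbation \<open>\<xi> * of_int m\<close> is at
        most 1/(2t), half the distance between fractions with denominator \<open>t\<close>.\<close>
      define M where "M = nat ((ti + 1) div 2)"
      have M: "M \<ge> 1" "int M = (ti + 1) div 2" unfolding M_def using ti1 by auto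
      have Mt: "t / 2 \<le> real M"
      proof -
        have "ti \<le> 2 * int M" unfolding M(2) by linarith
        then have "of_int ti \<le> (of_int (2 * int M) :: real)" by (simp only: of_int_le_iff)
        then show ?thesis unfolding t_def by simp
      qed
      have sp: "1 / (2 * t) \<le> idist (\<beta> * of_int m)" if m: "m \<noteq> 0" "\<bar>m\<bar> < int M" for m :: int
      proof -
        have "2 * \<bar>m\<bar> \<le> ti" "\<bar>m\<bar> < ti" using m M(2) ti1 by linarith+
        then have nd: "\<not> ti dvd m" using dvd_imp_le_int[OF m(1), of ti] by linarith
        have m2: "2 * \<bar>of_int m :: real\<bar> \<le> t" unfolding t_def using \<open>2 * \<bar>m\<bar> \<le> ti\<close> by linarith
        have "\<bar>\<xi>\<bar> * t * t \<le> 1"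
        proof -
          have "t * \<bar>\<xi>\<bar> * t \<le> 1 / (8 * real X ^ k) * (8 * real X ^ k)" using tl t by (intro mult_mono) auto
          also have "\<dots> = 1" using X by simp
          finally show ?thesis by (simp add: mult_ac)
        qed
        then have "\<bar>\<xi>\<bar> * t * (2 * \<bar>of_int m\<bar>) \<le> 1" using m2 t(1) by (elim order_trans[rotated]) (intro mult_left_mono, auto)
        then have "\<bar>\<xi> * of_int m\<bar> \<le> 1 / (2 * of_int ti)" using t(1) unfolding t_def[symmetric] by (simp add: abs_mult field_simps)
        from idist_multiple_near_fraction[OF ti1 bt(1) nd this] show ?thesis unfolding \<beta> t_def .
      qed
      have NY: "real (s * Y ^ k + 1) \<le> 2 * real s * real Y ^ k"
      proof -
        have "1 * 1 \<le> real s * real Y ^ k" using s Yk by (intro mult_mono) auto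
        then show ?thesis by simp
      qed
      have "(\<Sum>n\<in>{- (2 * int X)<..<2 * int X}. peak (real (s * Y ^ k + 1)) (\<beta> * of_int n)) \<le>
        (4 * real X / real M + 1) * (2 * real (s * Y ^ k + 1) + 2 / (1 / (2 * t)) * (1 + ln (1 / (1 / (2 * t)))))"
        by (rule sum_peak_multiples[OF M(1) _ _ _ sp]) (use t(1) in \<open>auto simp: add_pos_nonneg\<close>)
      also have "\<dots> \<le> (9 * (real X / T)) * ((4 * real s + 32 * (16 + real k)) * L * real Y ^ k)"
      proof (rule mult_mono)
        have "4 * real X / real M \<le> 4 * real X / (t / 2)" using Mt t(1) X by (intro divide_left_mono) auto
        also have "\<dots> \<le> 8 * (real X / T)" using T t(1) by (simp add: frac_le)
        finally have "4 * real X / real M \<le> 8 * (real X / T)" .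
        moreover have "1 \<le> real X / T" using T by simp
        ultimately show "4 * real X / real M + 1 \<le> 9 * (real X / T)" by linarith
        have lnt: "1 + ln (2 * t) \<le> (16 + real k) * L"
        proof -
          have "ln (2 * t) \<le> ln (16 * real X ^ k)" using t by (intro ln_mono) auto
          also have "\<dots> = ln 16 + real k * ln (real X)" using X by (simp add: ln_mult ln_realpow)
          also have "ln (16::real) \<le> 15" using ln_le_minus_one[of "16::real"] by simp
          finally have "1 + ln (2 * t) \<le> 16 + real k * ln (real X)" by linarith
          also have "\<dots> \<le> (16 + real k) * L" unfolding L_def using X by (simp add: algebra_simps)
          finally show ?thesis .
        qed
        have lnt0: "0 \<le> 1 + ln (2 * t)" using t(1) by (simp add: add_nonneg_nonneg)
        have "2 / (1 / (2 * t)) * (1 + ln (1 / (1 / (2 * t)))) = 4 * t * (1 + ln (2 * t))" by simp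
        also have "\<dots> \<le> 4 * (8 * real Y ^ k) * ((16 + real k) * L)"
          using tY lnt lnt0 Yk t(1) by (intro mult_mono) auto
        also have "\<dots> = 32 * (16 + real k) * L * real Y ^ k" by (simp add: algebra_simps)
        finally have A: "2 / (1 / (2 * t)) * (1 + ln (1 / (1 / (2 * t)))) \<le> 32 * (16 + real k) * L * real Y ^ k" .
        have "2 * real (s * Y ^ k + 1) \<le> 4 * real s * real Y ^ k" using NY by simp
        also have "\<dots> \<le> 4 * real s * real Y ^ k * L"
          using mult_left_mono[OF L, of "4 * real s * real Y ^ k"] by simp
        finally have "2 * real (s * Y ^ k + 1) \<le> 4 * real s * L * real Y ^ k" by (simp add: mult_ac)
        with A show "2 * real (s * Y ^ k + 1) + 2 / (1 / (2 * t)) * (1 + ln (1 / (1 / (2 * t)))) \<le>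
          (4 * real s + 32 * (16 + real k)) * L * real Y ^ k" by (simp add: algebra_simps)
        show "0 \<le> 2 * real (s * Y ^ k + 1) + 2 / (1 / (2 * t)) * (1 + ln (1 / (1 / (2 * t))))"
          using lnt0 t(1) by (simp add: add_nonneg_nonneg mult_nonneg_nonneg)
      qed (use T X in auto)
      also have "\<dots> = (9 * (4 * real s + 32 * (16 + real k))) * L * (real X * real Y ^ k / T)" by simp
      also have "\<dots> \<le> K * L * (real X * real Y ^ k / T)"
        using Kpos(1) L T X by (intro mult_right_mono) auto
      finally have fin: "(\<Sum>n\<in>{- (2 * int X)<..<2 * int X}. peak (real (s * Y ^ k + 1)) (real (k + 1) * c (k + 1) * real 1 ^ k * of_int n))
         \<le> K * (1 + ln (real X)) * (real X * real Y ^ k / T)" unfolding \<beta>_def L_def by simp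
      have "1 * Y \<le> X" unfolding Y_def by simp
      from conclude[where c = c, OF X Z1 T(1) Y YT this fin] show ?thesis unfolding E_def s_def .
    next
      case False
      \<comment> \<open>Small denominator: now the hypothesis forces \<open>\<xi>\<close> to be
        large, and \<open>T\<close> is the resulting saving. Multiples that differ by a multiple of
        \<open>t\<close> are separated by \<open>\<xi>\<close> alone.\<close>
      define T where "T = t * real X ^ (k + 1) * \<bar>\<xi>\<bar>"
      have ZT: "Z \<le> T"
        using app ti1 bt(1) False unfolding T_def \<xi>_def \<beta>_def t_def by blast
      have T1: "T \<ge> 1" using ZT Z1 by simp
      have tT: "t \<le> T" using False ZT by simp
      have \<xi>0: "\<bar>\<xi>\<bar> > 0" using T1 unfolding T_def by (cases "\<xi> = 0") auto
      have TX: "8 * T \<le> real X"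
      proof -
        have "T = (t * \<bar>\<xi>\<bar>) * real X ^ (k + 1)" unfolding T_def by simp
        also have "\<dots> \<le> 1 / (8 * real X ^ k) * real X ^ (k + 1)" using tl by (intro mult_right_mono) auto
        also have "\<dots> = real X / 8" using X by simp
        finally show ?thesis by simp
      qed
      define Y0 where "Y0 = nat \<lceil>8 * T\<rceil>"
      have Y0: "8 * T \<le> real Y0" "real Y0 \<le> 9 * T" unfolding Y0_def using T1 by linarith+
      have Y01: "Y0 \<ge> 1" using Y0 T1 by linarith
      have tn: "real (nat ti) = t" unfolding t_def using ti1 by simp
      \<comment> \<open>Dilating by \<open>g\<close> with \<open>g * Y\<close> comparable to
        \<open>X\<close> enlarges \<open>\<xi>\<close> to \<open>\<xi> * g ^ k\<close>, while the
        window stays of length about \<open>8 * T\<close>. The congruence \<open>g = 1\<close>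
        modulo \<open>t\<close> keeps \<open>b * g ^ k\<close> coprime to \<open>t\<close>. If
        \<open>X\<close> is too short for such a \<open>g\<close>, then
        \<open>X \<le> 18 * T ^ 2\<close>, and \<open>Y = X\<close> with \<open>g = 1\<close> will
        do.\<close>
      obtain Y g where Y: "Y \<ge> 1" "g * Y \<le> X" "real X \<le> 4 * (real g * real Y)" "8 * T \<le> real Y" "real Y \<le> 18 * T ^ 2"
        "ti dvd int g - 1" "g \<ge> 1"
      proof (cases "2 * nat ti * Y0 \<le> X")
        case True
        define Q where "Q = X div Y0"
        have Q: "2 * nat ti \<le> Q" unfolding Q_def using True Y01 by (simp add: less_eq_div_iff_mult_less_eq)
        have QX: "Q * Y0 \<le> X" unfolding Q_def by simp
        have "X < Q * Y0 + Y0" unfolding Q_def using Y01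
          by (metis add.commute div_mult_mod_eq mod_less_divisor nat_add_left_cancel_less less_le_trans zero_less_one)
        moreover have "Q \<ge> 1" using Q ti1 by linarith
        then have "1 * Y0 \<le> Q * Y0" by (intro mult_le_mono1)
        ultimately have XQ: "X \<le> 2 * (Q * Y0)" by linarith
        define g where "g = 1 + nat ti * ((Q - 1) div nat ti)"
        have nt: "nat ti \<ge> 1" using ti1 by simp
        have gQ: "g \<le> Q" unfolding g_def using \<open>Q \<ge> 1\<close> times_div_less_eq_dividend[of "nat ti" "Q - 1"] by linarith
        have Qg: "Q \<le> 2 * g"
        proof -
          have "Q - 1 < nat ti * ((Q - 1) div nat ti) + nat ti" using nt
            by (metis add_strict_left_mono less_le_trans mod_less_divisor mult_div_mod_eq zero_less_one)
          moreover have "q \<le> 2 * (1 + r)" if "q - 1 < r + n" "2 * n \<le> q" for q r n :: nat using that by presburger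
          ultimately show ?thesis unfolding g_def using Q by blast
        qed
        show ?thesis
        proof (rule that[of Y0 g])
          show "g * Y0 \<le> X" using mult_le_mono1[OF gQ, of Y0] QX by linarith
          have "X \<le> 4 * (g * Y0)" using XQ mult_le_mono1[OF Qg, of Y0] by linarith
          then have "real X \<le> real (4 * (g * Y0))" by (simp only: of_nat_le_iff)
          then show "real X \<le> 4 * (real g * real Y0)" by simp
          have "T * 1 \<le> T * T" using T1 by (intro mult_left_mono) auto
          then show "real Y0 \<le> 18 * T ^ 2" unfolding power2_eq_square using Y0(2) T1 by linarith
          show "ti dvd int g - 1" unfolding g_def using ti1 by simp
        qed (use Y0 Y01 in \<open>auto simp: g_def\<close>)
      next
        case False
        have "real X \<le> 2 * t * real Y0"
        proof -
          have "real X \<le> real (2 * nat ti * Y0)" using False by (simp only: of_nat_le_iff)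
          then show ?thesis using tn by simp
        qed
        also have "\<dots> \<le> 2 * T * (9 * T)" using tT Y0(2) T1 t(1) by (intro mult_mono) auto
        finally have "real X \<le> 18 * T ^ 2" by (simp add: power2_eq_square)
        then show ?thesis using that[of X 1] X TX by simp
      qed
      define y where "y = real Y"
      define G where "G = real g"
      have y1: "y \<ge> 1" unfolding y_def using Y by simp
      have G1: "G \<ge> 1" unfolding G_def using Y by simp
      have Gy: "G * y \<le> real X" unfolding G_def y_def using Y(2) by (metis of_nat_le_iff of_nat_mult)
      have yk: "8 * T \<le> y ^ k" 
      proof -
        have "y ^ 1 \<le> y ^ k" using y1 k by (intro power_increasing) auto
        then have "y \<le> y ^ k" by (simp only: power_one_right)
        then show ?thesis using Y(4) unfolding y_def by linarith
      qed
      have yk0: "y ^ k > 0" using y1 by simp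
      \<comment> \<open>The separation of two points whose indices differ by \<open>t\<close>. The
        bound \<open>w * X \<le> 1 / 8\<close> makes the perturbation at most 1/(2t) for all
        \<open>\<bar>m\<bar> < 4 * X\<close>, so one block covers the whole range; the bound on
        \<open>1 / w\<close> controls the size of \<open>1 / \<delta>\<close>.\<close>
      define w where "w = \<bar>\<xi>\<bar> * G ^ k * t"
      have wX: "w * real X ^ (k + 1) = T * G ^ k" unfolding w_def T_def by (simp only: mult_ac)
      have w0: "w > 0" unfolding w_def using \<xi>0 G1 t by simp
      have GX: "(G * y) ^ k \<le> real X ^ k" using Gy G1 y1 by (intro power_mono) auto
      have wle: "w * real X \<le> 1 / 8"
      proof -
        have "w * real X * (real X ^ k) = T * G ^ k" using wX by (simp only: mult.assoc power_Suc[symmetric] Suc_eq_plus1)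
        then have "w * real X * (real X ^ k) * y ^ k = T * (G * y) ^ k" by (simp only: power_mult_distrib mult.assoc)
        also have "\<dots> \<le> T * real X ^ k" using GX T1 by (intro mult_left_mono) auto
        finally have "real X ^ k * (w * real X * y ^ k) \<le> real X ^ k * T" by (simp only: mult_ac)
        then have "w * real X * y ^ k \<le> T" by (rule mult_left_le_imp_le) (use X in simp)
        moreover have "w * real X * (8 * T) \<le> w * real X * y ^ k" using yk w0 by (intro mult_left_mono) auto
        ultimately have "T * (w * real X * 8) \<le> T * 1" by (simp only: mult_ac mult_1_right)
        then have "w * real X * 8 \<le> 1" by (rule mult_left_le_imp_le) (use T1 in simp)
        then show ?thesis by simp
      qed
      have wge: "1 / w \<le> 4 ^ k * (real X * y ^ k / T)"
      proof -
        have "real X ^ k \<le> (4 * (G * y)) ^ k" using Y(3) unfolding G_def y_def by (intro power_mono) auto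
        then have "real X ^ k * real X \<le> (4 ^ k * (G ^ k * y ^ k)) * real X"
          unfolding power_mult_distrib by (intro mult_right_mono) auto
        then have "real X ^ (k + 1) \<le> (4 ^ k * (G ^ k * y ^ k)) * real X" by (simp only: power_add power_one_right)
        then have "w * real X ^ (k + 1) \<le> w * ((4 ^ k * (G ^ k * y ^ k)) * real X)" using w0 by (intro mult_left_mono) auto
        then have "G ^ k * T \<le> G ^ k * (w * (4 ^ k * y ^ k * real X))" unfolding wX by (simp only: mult_ac)
        then have "T \<le> w * (4 ^ k * y ^ k * real X)" by (rule mult_left_le_imp_le) (use G1 in simp)
        then show ?thesis using w0 T1 by (simp add: field_simps)
      qed
      define \<delta> where "\<delta> = min (1 / (2 * t)) w"
      have \<delta>: "0 < \<delta>" "\<delta> \<le> 1" unfolding \<delta>_def using w0 t by (auto simp: min_le_iff_disj)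
      have XyT: "1 \<le> real X * y ^ k / T" "T \<le> real X * y ^ k / T" "y ^ k \<le> real X * y ^ k / T"
      proof -
        have "T \<le> real X" "T \<le> y ^ k" using TX yk T1 by linarith+
        then have "T * T \<le> real X * y ^ k" using T1 by (intro mult_mono) auto
        then show 1: "T \<le> real X * y ^ k / T" using T1 by (simp add: pos_le_divide_eq)
        then show "1 \<le> real X * y ^ k / T" using T1 by linarith
        show "y ^ k \<le> real X * y ^ k / T" using \<open>T \<le> real X\<close> T1 yk0 by (simp add: pos_le_divide_eq mult.commute)
      qed
      have d1: "1 / \<delta> \<le> (2 + 4 ^ k) * (real X * y ^ k / T)"
      proof -
        have "1 / \<delta> \<le> 2 * t + 1 / w" unfolding \<delta>_def using t(1) w0 by (auto simp: min_def)
        also have "\<dots> \<le> 2 * (real X * y ^ k / T) + 4 ^ k * (real X * y ^ k / T)"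
          using wge tT XyT(2) by linarith
        finally show ?thesis by (simp only: distrib_right)
      qed
      have ld: "1 + ln (1 / \<delta>) \<le> (1 + ln (2 + 4 ^ k) + real (k + 1)) * L"
      proof -
        have "real X * y ^ k / T \<le> real X * y ^ k / 1" using T1 yk0 X by (intro divide_left_mono) auto
        also have "\<dots> \<le> real X * real X ^ k"
        proof -
          have "1 * y \<le> G * y" using G1 y1 by (intro mult_right_mono) auto
          then have "y \<le> real X" using Gy by linarith
          then show ?thesis using y1 by (simp add: mult_left_mono power_mono)
        qed
        finally have "1 / \<delta> \<le> (2 + 4 ^ k) * real X ^ (k + 1)"
          by (intro order_trans[OF d1] mult_left_mono) (auto simp: add_nonneg_nonneg)
        then have "ln (1 / \<delta>) \<le> ln ((2 + 4 ^ k) * real X ^ (k + 1))" using \<delta> by (intro ln_mono) auto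
        also have "\<dots> = ln (2 + 4 ^ k) + ln (real X ^ (k + 1))" using X by (intro ln_mult_pos) (auto simp: add_pos_pos)
        also have "ln (real X ^ (k + 1)) = real (k + 1) * ln (real X)" by (rule ln_realpow)
        finally have "1 + ln (1 / \<delta>) \<le> 1 + ln (2 + 4 ^ k) + real (k + 1) * ln (real X)" by simp
        also have "\<dots> \<le> (1 + ln (2 + 4 ^ k)) * L + real (k + 1) * L"
        proof (rule add_mono)
          have "0 \<le> 1 + ln (2 + 4 ^ k :: real)" by (intro add_nonneg_nonneg ln_ge_zero) (auto simp: add_increasing2)
          from mult_left_mono[OF L this]
          show "1 + ln (2 + 4 ^ k) \<le> (1 + ln (2 + 4 ^ k)) * L" by (simp only: mult_1_right)
          show "real (k + 1) * ln (real X) \<le> real (k + 1) * L" unfolding L_def by (intro mult_left_mono) auto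
        qed
        finally show ?thesis by (simp only: distrib_right)
      qed
      have ld0: "0 \<le> 1 + ln (1 / \<delta>)" using \<delta> by (simp add: add_nonneg_nonneg)
      have sp: "\<delta> \<le> idist (\<beta> * G ^ k * of_int m)" if m: "m \<noteq> 0" "\<bar>m\<bar> < int (4 * X)" for m :: int
      proof -
        define \<xi>' where "\<xi>' = \<xi> * G ^ k"
        have al: "\<bar>\<xi>'\<bar> * t = w" unfolding \<xi>'_def w_def using G1 by (simp add: abs_mult)
        have mX: "\<bar>of_int m :: real\<bar> \<le> 4 * real X" using m(2) by linarith
        have "\<bar>\<xi>' * of_int m\<bar> * t = w * \<bar>of_int m\<bar>" unfolding al[symmetric] by (simp add: abs_mult)
        also have "\<dots> \<le> w * (4 * real X)" using mX w0 by (intro mult_left_mono) auto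
        also have "\<dots> \<le> 1 / 2" using wle by simp
        finally have lm: "\<bar>\<xi>' * of_int m\<bar> \<le> 1 / (2 * of_int ti)" using t(1) unfolding t_def[symmetric] by (simp add: field_simps)
        define b' where "b' = b * int g ^ k"
        have "coprime (int g) ti"
        proof -
          have "is_unit d" if "d dvd int g" "d dvd ti" for d
          proof -
            have "d dvd int g - 1" using that(2) Y(6) by (rule dvd_trans)
            then have "d dvd int g - (int g - 1)" using that(1) by (rule dvd_diff[rotated])
            then show ?thesis by simp
          qed
          then show ?thesis by (rule coprimeI)
        qed
        then have cop: "coprime b' ti" unfolding b'_def using bt(1) by simp
        have eq: "\<beta> * G ^ k = of_int b' / of_int ti + \<xi>'"
          unfolding \<beta> b'_def \<xi>'_def G_def by (simp add: distrib_right)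
        show ?thesis
        proof (cases "ti dvd m")
          case False
          have "1 / (2 * of_int ti) \<le> idist (\<beta> * G ^ k * of_int m)"
            unfolding eq by (rule idist_multiple_near_fraction[OF ti1 cop False lm])
          then show ?thesis unfolding \<delta>_def t_def by linarith
        next
          case True
          then obtain n where n: "m = ti * n" by blast
          have "\<beta> * G ^ k * of_int m = \<xi>' * of_int m + of_int (b' * n)"
            unfolding eq n using ti1 by (simp add: distrib_right)
          then have "idist (\<beta> * G ^ k * of_int m) = idist (\<xi>' * of_int m)" by (simp only: idist_add_int)
          also have "\<dots> = \<bar>\<xi>' * of_int m\<bar>"
          proof (rule idist_eq_abs)
            have "1 / (2 * of_int ti) \<le> (1 / 2 :: real)" using ti1 by (simp add: frac_le)
            then show "\<bar>\<xi>' * of_int m\<bar> \<le> 1 / 2" using lm by linarith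
          qed
          also have "\<dots> \<ge> w"
          proof -
            have "n \<noteq> 0" using m(1) n by auto
            then have "t * 1 \<le> t * \<bar>of_int n\<bar>" using t(1) by (intro mult_left_mono) auto
            then have "t \<le> \<bar>of_int m\<bar>" unfolding n t_def using ti1 by (simp add: abs_mult)
            then have "\<bar>\<xi>'\<bar> * t \<le> \<bar>\<xi>'\<bar> * \<bar>of_int m\<bar>" by (intro mult_left_mono) auto
            then show ?thesis unfolding al by (simp add: abs_mult)
          qed
          finally show ?thesis unfolding \<delta>_def by linarith
        qed
      qed
      have X4: "4 * X \<ge> 1" using X by simp
      have "(\<Sum>n\<in>{- (2 * int X)<..<2 * int X}. peak (real (s * Y ^ k + 1)) (\<beta> * G ^ k * of_int n)) \<le>
        (4 * real X / real (4 * X) + 1) * (2 * real (s * Y ^ k + 1) + 2 / \<delta> * (1 + ln (1 / \<delta>)))"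
        by (rule sum_peak_multiples[OF X4 \<delta> _ sp]) (auto simp: add_pos_nonneg)
      also have "\<dots> = 2 * (2 * real (s * Y ^ k + 1) + 2 * (1 / \<delta>) * (1 + ln (1 / \<delta>)))" using X by simp
      also have "\<dots> \<le> 2 * ((4 * real s + 2 * (2 + 4 ^ k) * (1 + ln (2 + 4 ^ k) + real (k + 1))) * L * (real X * y ^ k / T))"
      proof (intro mult_left_mono)
        have q0: "0 \<le> 4 * real s * (real X * y ^ k / T)"
          by (rule mult_nonneg_nonneg) (use XyT(1) in \<open>auto intro: order_trans[OF zero_le_one]\<close>)
        have "1 * 1 \<le> real s * y ^ k" using s y1 by (intro mult_mono) auto
        then have "2 * real (s * Y ^ k + 1) \<le> 4 * real s * y ^ k" unfolding y_def by simp
        also have "\<dots> \<le> 4 * real s * (real X * y ^ k / T)" using XyT(3) by (intro mult_left_mono) auto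
        also have "\<dots> \<le> 4 * real s * (real X * y ^ k / T) * L"
          using mult_left_mono[OF L q0] by (simp only: mult_1_right)
        finally have A: "2 * real (s * Y ^ k + 1) \<le> 4 * real s * L * (real X * y ^ k / T)" by (simp only: mult_ac)
        have "2 * (1 / \<delta>) * (1 + ln (1 / \<delta>)) \<le> 2 * ((2 + 4 ^ k) * (real X * y ^ k / T)) * ((1 + ln (2 + 4 ^ k) + real (k + 1)) * L)"
        proof (rule mult_mono)
          show "2 * (1 / \<delta>) \<le> 2 * ((2 + 4 ^ k) * (real X * y ^ k / T))" using d1 by (intro mult_left_mono) auto
          have "0 \<le> real X * y ^ k / T" using XyT(1) by linarith
          then show "0 \<le> 2 * ((2 + 4 ^ k) * (real X * y ^ k / T))" by (intro mult_nonneg_nonneg add_nonneg_nonneg) auto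
        qed (use ld ld0 in auto)
        also have "\<dots> = 2 * (2 + 4 ^ k) * (1 + ln (2 + 4 ^ k) + real (k + 1)) * L * (real X * y ^ k / T)" by (simp only: mult_ac)
        finally show "2 * real (s * Y ^ k + 1) + 2 * (1 / \<delta>) * (1 + ln (1 / \<delta>)) \<le>
          (4 * real s + 2 * (2 + 4 ^ k) * (1 + ln (2 + 4 ^ k) + real (k + 1))) * L * (real X * y ^ k / T)"
          using A unfolding distrib_right[of "4 * real s"] distrib_right[of "4 * real s * L"] by linarith
      qed simp
      also have "\<dots> = (2 * (4 * real s + 2 * (2 + 4 ^ k) * (1 + ln (2 + 4 ^ k) + real (k + 1)))) * L * (real X * y ^ k / T)"
        by (simp only: mult_ac)
      also have "\<dots> \<le> K * L * (real X * y ^ k / T)"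
        using Kpos(2) L XyT(1) by (intro mult_right_mono) auto
      finally have fin: "(\<Sum>n\<in>{- (2 * int X)<..<2 * int X}. peak (real (s * Y ^ k + 1)) (real (k + 1) * c (k + 1) * real g ^ k * of_int n))
         \<le> K * (1 + ln (real X)) * (real X * real Y ^ k / T)" unfolding \<beta>_def L_def y_def G_def .
      from conclude[where c = c, OF X Z1 ZT Y(1,5,2) fin] show ?thesis unfolding E_def s_def .
    qed
  qed
qed

section \<open>Digit classes\<close>

text \<open>If \<open>t < Z\<close>, then \<open>2 * t * \<bar>B\<bar> < q\<close>, so Ba/q and b/t
  are different fractions, at least 1/(qt) apart. The error of Ba/q as an approximation to B
  \<alpha> is at most |B|/q^2, hence at most half of that. So B \<alpha> stays at least 1/(2qt) away
  from b/t.\<close>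

lemma rational_approximation_dichotomy:
  fixes a q b t B :: int and \<alpha> P Z :: real
  assumes q: "q \<ge> 1" and cop: "coprime a q" and app: "\<bar>\<alpha> - of_int a / of_int q\<bar> < 1 / (of_int q)\<^sup>2"
    and B: "B \<noteq> 0" and t: "t \<ge> 1" and P: "P \<ge> 0"
    and Z: "Z \<le> of_int q / (2 * \<bar>of_int B\<bar>)" "Z \<le> P / (2 * of_int q)"
  shows "Z \<le> of_int t \<or> Z \<le> of_int t * P * \<bar>of_int B * \<alpha> - of_int b / of_int t\<bar>"
proof (cases "Z \<le> of_int t")
  case True
  then show ?thesis ..
next
  case tZ: False
  define Q where "Q = real_of_int q"
  define BB where "BB = real_of_int B"
  define TT where "TT = real_of_int t"
  have Q: "Q \<ge> 1" unfolding Q_def using q by simp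
  have TT: "TT \<ge> 1" unfolding TT_def using t by simp
  have BB: "\<bar>BB\<bar> > 0" unfolding BB_def using B by simp
  have tq: "2 * TT * \<bar>BB\<bar> < Q"
  proof -
    have "TT < Q / (2 * \<bar>BB\<bar>)" using tZ Z(1) unfolding TT_def Q_def BB_def by linarith
    then show ?thesis using BB by (simp add: field_simps)
  qed
  have ne: "B * a * t \<noteq> b * q"
  proof
    assume "B * a * t = b * q"
    then have "q dvd a * (B * t)" by (metis dvd_triv_right mult.assoc mult.commute)
    then have "q dvd B * t" using cop by (simp add: coprime_commute coprime_dvd_mult_right_iff)
    then have "\<bar>q\<bar> \<le> \<bar>B * t\<bar>" using B t by (intro dvd_imp_le_int) auto
    then have "Q \<le> \<bar>BB\<bar> * TT" unfolding Q_def BB_def TT_def using q t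
      by (simp add: abs_mult) (metis of_int_abs of_int_le_iff of_int_mult)
    moreover have "\<bar>BB\<bar> * TT > 0" using BB TT by (intro mult_pos_pos) auto
    moreover have "2 * TT * \<bar>BB\<bar> = 2 * (\<bar>BB\<bar> * TT)" by simp
    ultimately show False using tq by linarith
  qed
  have "1 \<le> \<bar>B * a * t - b * q\<bar>" using ne by simp
  then have "1 \<le> \<bar>BB * of_int a * TT - of_int b * Q\<bar>"
    unfolding BB_def TT_def Q_def by (metis of_int_1_le_iff of_int_abs of_int_diff of_int_mult)
  moreover have "BB * (of_int a / Q) - of_int b / TT = (BB * of_int a * TT - of_int b * Q) / (Q * TT)"
    using Q TT by (simp add: field_simps)
  ultimately have 1: "1 / (Q * TT) \<le> \<bar>BB * (of_int a / Q) - of_int b / TT\<bar>"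
    using Q TT by (simp add: abs_mult divide_right_mono)
  have 2: "\<bar>BB * \<alpha> - BB * (of_int a / Q)\<bar> \<le> 1 / (2 * (Q * TT))"
  proof -
    have "\<bar>BB * \<alpha> - BB * (of_int a / Q)\<bar> = \<bar>BB\<bar> * \<bar>\<alpha> - of_int a / Q\<bar>"
      by (simp add: abs_mult[symmetric] right_diff_distrib)
    also have "\<dots> \<le> \<bar>BB\<bar> * (1 / Q\<^sup>2)" using app unfolding Q_def by (intro mult_left_mono) auto
    also have "\<dots> \<le> 1 / (2 * (Q * TT))" using tq Q TT by (simp add: field_simps power2_eq_square)
    finally show ?thesis .
  qed
  have "1 / (Q * TT) = 1 / (2 * (Q * TT)) + 1 / (2 * (Q * TT))" using Q TT by (simp add: field_simps)
  then have 3: "1 / (2 * (Q * TT)) \<le> \<bar>BB * \<alpha> - of_int b / TT\<bar>" using 1 2 by linarith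
  have "Z \<le> P / (2 * Q)" using Z(2) unfolding Q_def .
  also have "\<dots> = TT * P * (1 / (2 * (Q * TT)))" using TT Q by (simp add: field_simps)
  also have "\<dots> \<le> TT * P * \<bar>BB * \<alpha> - of_int b / TT\<bar>" using 3 TT P by (intro mult_left_mono) auto
  finally show ?thesis unfolding TT_def BB_def ..
qed

lemma bin_digit_sum_rec: "bin_digit_sum n = n mod 2 + bin_digit_sum (n div 2)"
  by (cases "n = 0") (simp_all add: bin_digit_sum.simps[of n] bin_digit_sum.simps[of 0])

lemma bin_digit_sum_concat:
  "y < 2 ^ s \<Longrightarrow> bin_digit_sum (2 ^ s * x + y) = bin_digit_sum x + bin_digit_sum y"
proof (induction s arbitrary: y)
  case 0
  then show ?case by (simp add: bin_digit_sum.simps[of 0])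
next
  case (Suc s)
  have y2: "y div 2 < 2 ^ s" using Suc.prems by (simp add: less_mult_imp_div_less mult.commute)
  have e: "2 ^ Suc s * x + y = 2 * (2 ^ s * x) + y" by simp
  have "(2 ^ Suc s * x + y) mod 2 = y mod 2" "(2 ^ Suc s * x + y) div 2 = 2 ^ s * x + y div 2"
    unfolding e by simp_all
  then have "bin_digit_sum (2 ^ Suc s * x + y) = y mod 2 + bin_digit_sum (2 ^ s * x + y div 2)"
    by (subst bin_digit_sum_rec) simp
  also have "\<dots> = bin_digit_sum x + (y mod 2 + bin_digit_sum (y div 2))" using Suc.IH[OF y2] by simp
  also have "y mod 2 + bin_digit_sum (y div 2) = bin_digit_sum y" by (rule bin_digit_sum_rec[symmetric])
  finally show ?case .
qed

lemma sum_digit_class_split: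
  fixes F :: "nat \<Rightarrow> complex"
  assumes m: "m \<ge> 1" and s: "s \<le> r"
  shows "(\<Sum>n\<in>digit_class k m r. F n) =
    (\<Sum>x<2 ^ (r - s). \<Sum>y\<in>{y. y < 2 ^ s \<and> [bin_digit_sum x mod m + bin_digit_sum y = k] (mod m)}. F (2 ^ s * x + y))"
proof -
  let ?D = "\<lambda>x. {y. y < 2 ^ s \<and> [bin_digit_sum x mod m + bin_digit_sum y = k] (mod m)}"
  have r: "(2::nat) ^ r = 2 ^ s * 2 ^ (r - s)" using s by (simp add: power_add[symmetric])
  have c: "[bin_digit_sum (2 ^ s * x + y) = k] (mod m) \<longleftrightarrow> [bin_digit_sum x mod m + bin_digit_sum y = k] (mod m)"
    if "y < 2 ^ s" for x y
    by (simp add: bin_digit_sum_concat[OF that] Cong.cong_def mod_add_left_eq)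
  have "(\<Sum>x<2 ^ (r - s). \<Sum>y\<in>?D x. F (2 ^ s * x + y)) = (\<Sum>z\<in>Sigma {..<2 ^ (r - s)} ?D. F (2 ^ s * fst z + snd z))"
    by (subst sum.Sigma) (auto simp: split_def)
  also have "\<dots> = (\<Sum>n\<in>digit_class k m r. F n)"
  proof (rule sum.reindex_bij_witness[where i = "\<lambda>n. (n div 2 ^ s, n mod 2 ^ s)" and j = "\<lambda>z. 2 ^ s * fst z + snd z"])
    fix z assume z: "z \<in> Sigma {..<2 ^ (r - s)} ?D"
    then have y: "snd z < 2 ^ s" and x: "fst z + 1 \<le> 2 ^ (r - s)" by (auto simp: Suc_le_eq)
    show "((2 ^ s * fst z + snd z) div 2 ^ s, (2 ^ s * fst z + snd z) mod 2 ^ s) = z" using y by (simp add: prod_eq_iff)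
    have "2 ^ s * fst z + snd z < 2 ^ s * (fst z + 1)" using y by simp
    also have "\<dots> \<le> 2 ^ r" unfolding r using x by (rule mult_le_mono2)
    finally show "2 ^ s * fst z + snd z \<in> digit_class k m r"
      using z c[OF y] unfolding digit_class_def by auto
  next
    fix n assume n: "n \<in> digit_class k m r"
    show "2 ^ s * fst (n div 2 ^ s, n mod 2 ^ s) + snd (n div 2 ^ s, n mod 2 ^ s) = n" by simp
    have "n div 2 ^ s < 2 ^ (r - s)" using n unfolding digit_class_def r by (simp add: less_mult_imp_div_less mult.commute)
    moreover have "[bin_digit_sum (n div 2 ^ s) mod m + bin_digit_sum (n mod 2 ^ s) = k] (mod m)"
      using n c[of "n mod 2 ^ s" "n div 2 ^ s"] unfolding digit_class_def by simp
    ultimately show "(n div 2 ^ s, n mod 2 ^ s) \<in> Sigma {..<2 ^ (r - s)} ?D" by simp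
  qed simp
  finally show ?thesis by simp
qed

text \<open>Cauchy--Schwarz over \<open>x\<close> removes the digit condition on the high part, so that the inner sums
  of the right-hand side are complete Weyl sums.\<close>

lemma digit_class_sum_cauchy_schwarz:
  fixes F :: "nat \<Rightarrow> complex"
  assumes m: "m \<ge> 1" and s: "s \<le> r" and F: "\<And>n. norm (F n) = 1"
    and W: "\<And>y1 y2. y1 < 2 ^ s \<Longrightarrow> y2 < 2 ^ s \<Longrightarrow> y1 \<noteq> y2 \<Longrightarrow>
      norm (\<Sum>x<2 ^ (r - s). F (2 ^ s * x + y1) * cnj (F (2 ^ s * x + y2))) \<le> W"
  shows "norm (\<Sum>n\<in>digit_class k m r. F n) ^ 2 \<le> real m ^ 2 * 2 ^ (r - s) * (2 ^ s * 2 ^ (r - s) + (2 ^ s) ^ 2 * max W 0)"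
proof -
  let ?X = "2 ^ (r - s) :: nat" and ?H = "2 ^ s :: nat"
  define D where "D = (\<lambda>i. {y. y < ?H \<and> [i + bin_digit_sum y = k] (mod m)})"
  have finD: "finite (D i)" for i unfolding D_def by simp
  have Dsub: "D i \<subseteq> {..<?H}" for i unfolding D_def by auto
  have cardD: "real (card (D i)) \<le> 2 ^ s" for i
  proof -
    have "card (D i) \<le> card {..<?H}" by (intro card_mono Dsub) simp
    then have "real (card (D i)) \<le> real ?H" by simp
    then show ?thesis by simp
  qed
  define V where "V = (\<lambda>i x. \<Sum>y\<in>D i. F (?H * x + y))"
  \<comment> \<open>Only the residue of the digit sum of \<open>x\<close> matters. Adding the terms
    of all \<open>m\<close> residues makes the condition on \<open>y\<close> independent of
    \<open>x\<close>.\<close>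
  have 1: "norm (\<Sum>n\<in>digit_class k m r. F n) \<le> (\<Sum>x<?X. \<Sum>i<m. norm (V i x))"
  proof -
    have "norm (\<Sum>n\<in>digit_class k m r. F n) \<le> (\<Sum>x<?X. norm (V (bin_digit_sum x mod m) x))"
      unfolding sum_digit_class_split[OF m s] V_def D_def by (rule norm_sum)
    also have "\<dots> \<le> (\<Sum>x<?X. \<Sum>i<m. norm (V i x))"
      using m by (intro sum_mono member_le_sum[of _ "{..<m}" "\<lambda>i. norm (V i _)"]) auto
    finally show ?thesis .
  qed
  have 2: "(\<Sum>x<?X. norm (V i x) ^ 2) \<le> 2 ^ s * 2 ^ (r - s) + (2 ^ s) ^ 2 * max W 0" for i
  proof -
    define G where "G = (\<lambda>y1 y2. \<Sum>x<?X. F (?H * x + y1) * cnj (F (?H * x + y2)))"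
    have "(of_real (\<Sum>x<?X. norm (V i x) ^ 2) :: complex) = (\<Sum>x<?X. V i x * cnj (V i x))"
      by (simp only: of_real_sum complex_norm_square)
    also have "\<dots> = (\<Sum>x<?X. \<Sum>y1\<in>D i. \<Sum>y2\<in>D i. F (?H * x + y1) * cnj (F (?H * x + y2)))"
      unfolding V_def cnj_sum sum_product ..
    also have "\<dots> = (\<Sum>y1\<in>D i. \<Sum>y2\<in>D i. G y1 y2)"
      unfolding G_def by (subst sum.swap, intro sum.cong refl sum.swap)
    finally have eq: "(of_real (\<Sum>x<?X. norm (V i x) ^ 2) :: complex) = (\<Sum>y1\<in>D i. \<Sum>y2\<in>D i. G y1 y2)" .
    have "(\<Sum>x<?X. norm (V i x) ^ 2) = norm (of_real (\<Sum>x<?X. norm (V i x) ^ 2) :: complex)"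
      by (simp only: norm_of_real abs_of_nonneg sum_nonneg zero_le_power2)
    also have "\<dots> \<le> (\<Sum>y1\<in>D i. \<Sum>y2\<in>D i. norm (G y1 y2))" unfolding eq by (intro sum_norm_le order_refl)
    also have "\<dots> \<le> (\<Sum>y1\<in>D i. \<Sum>y2\<in>D i. (if y2 = y1 then 2 ^ (r - s) else 0) + max W 0)"
    proof (intro sum_mono)
      fix y1 y2 assume y: "y1 \<in> D i" "y2 \<in> D i"
      show "norm (G y1 y2) \<le> (if y2 = y1 then 2 ^ (r - s) else 0) + max W 0"
      proof (cases "y1 = y2")
        case True
        have "norm (G y1 y2) \<le> (\<Sum>x<?X. 1)" unfolding G_def
          by (intro sum_norm_le) (simp add: norm_mult F)
        then show ?thesis using True by simp
      next
        case False
        have "norm (G y1 y2) \<le> W" unfolding G_def using W[of y1 y2] y Dsub False by blast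
        then show ?thesis using False by simp
      qed
    qed
    also have "\<dots> = real (card (D i)) * 2 ^ (r - s) + real (card (D i)) ^ 2 * max W 0"
      by (simp add: sum.distrib finD power2_eq_square algebra_simps)
    also have "\<dots> \<le> 2 ^ s * 2 ^ (r - s) + (2 ^ s) ^ 2 * max W 0"
      using cardD[of i] by (intro add_mono mult_right_mono power_mono) auto
    finally show ?thesis .
  qed
  have "norm (\<Sum>n\<in>digit_class k m r. F n) ^ 2 \<le> (\<Sum>x<?X. \<Sum>i<m. norm (V i x)) ^ 2"
    using 1 by (intro power_mono) auto
  also have "\<dots> \<le> real (card {..<?X}) ^ (2 - 1) * (\<Sum>x<?X. (\<Sum>i<m. norm (V i x)) ^ 2)"
    by (rule power_sum_le_card) (auto intro: sum_nonneg)
  also have "\<dots> \<le> real (card {..<?X}) ^ (2 - 1) * (\<Sum>x<?X. real (card {..<m}) ^ (2 - 1) * (\<Sum>i<m. norm (V i x) ^ 2))"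
    by (intro mult_left_mono sum_mono power_sum_le_card) auto
  also have "\<dots> = 2 ^ (r - s) * (real m * (\<Sum>i<m. \<Sum>x<?X. norm (V i x) ^ 2))"
    unfolding sum_distrib_left[symmetric] by (subst sum.swap) simp
  also have "\<dots> \<le> 2 ^ (r - s) * (real m * (\<Sum>i<m. 2 ^ s * 2 ^ (r - s) + (2 ^ s) ^ 2 * max W 0))"
    by (intro mult_left_mono sum_mono 2) auto
  also have "\<dots> = real m ^ 2 * 2 ^ (r - s) * (2 ^ s * 2 ^ (r - s) + (2 ^ s) ^ 2 * max W 0)"
    by (simp add: power2_eq_square)
  finally show ?thesis .
qed

text \<open>\<open>poly_shift_expand\<close> is used one degree higher and with the roles of the
  variables exchanged. The parts of degree \<open>k + 1\<close> and \<open>k + 2\<close> in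
  \<open>x\<close> that do not depend on the shift cancel in the difference, so the leading
  coefficient is linear in \<open>y1 - y2\<close>.\<close>

lemma poly_difference_expand:
  fixes f :: "real poly" and h y1 y2 l :: real
  assumes d: "degree f = k + 2"
  obtains c where "\<And>x. l * poly f (h * x + y1) - l * poly f (h * x + y2) = (\<Sum>i\<le>k + 1. c i * x ^ i)"
    "c (k + 1) = l * real (k + 2) * h ^ (k + 1) * (y1 - y2) * coeff f (k + 2)"
proof -
  obtain A B where AB: "\<And>x y. (\<Sum>i\<le>(k + 1) + 1. coeff f i * (y + h * x) ^ i) =
    A x + (\<Sum>j<k + 1. B j y * x ^ j) + real ((k + 1) + 1) * coeff f ((k + 1) + 1) * h ^ (k + 1) * y * x ^ (k + 1)"
    using poly_shift_expand[where k = "k + 1" and c = "coeff f" and g = h] by blast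
  have pf: "poly f (h * x + y) = A x + (\<Sum>j<k + 1. B j y * x ^ j) + real (k + 2) * coeff f (k + 2) * h ^ (k + 1) * y * x ^ (k + 1)" for x y
    using AB[of y x] by (simp add: poly_altdef d add.commute)
  define c where "c = (\<lambda>j. if j = k + 1 then l * real (k + 2) * h ^ (k + 1) * (y1 - y2) * coeff f (k + 2)
    else l * (B j y1 - B j y2))"
  show ?thesis
  proof (rule that[of c])
    fix x
    have "(\<Sum>i\<le>k + 1. c i * x ^ i) = (\<Sum>j<k + 1. l * (B j y1 - B j y2) * x ^ j) + c (k + 1) * x ^ (k + 1)"
      by (simp add: lessThan_Suc_atMost[symmetric] c_def)
    also have "(\<Sum>j<k + 1. l * (B j y1 - B j y2) * x ^ j) = l * ((\<Sum>j<k + 1. B j y1 * x ^ j) - (\<Sum>j<k + 1. B j y2 * x ^ j))"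
      unfolding sum_subtractf[symmetric] sum_distrib_left by (intro sum.cong refl) (simp add: algebra_simps)
    finally show "l * poly f (h * x + y1) - l * poly f (h * x + y2) = (\<Sum>i\<le>k + 1. c i * x ^ i)"
      unfolding pf c_def by (simp add: algebra_simps)
  qed (simp add: c_def)
qed

section \<open>Choice of the parameters and conclusion\<close>

theorem theorem2p5:
  fixes d m :: nat
  assumes "d \<ge> 3" and "m \<ge> 1"
  shows "\<exists>r0::nat. \<forall>r\<ge>r0. \<forall>(f :: real poly) (a :: int) (q :: int) (l :: nat) (k :: nat).
    degree f = d \<longrightarrow> coeff f 0 = 0 \<longrightarrow>
    q \<ge> 1 \<longrightarrow> coprime a q \<longrightarrow>
    \<bar>coeff f d - real_of_int a / real_of_int q\<bar> < 1 / (real_of_int q)\<^sup>2 \<longrightarrow>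
    l \<ge> 1 \<longrightarrow> k < m \<longrightarrow>
    norm (weyl_sum f r l k m) \<le>
      real r * 2 ^ r *
        (real l powr eta1 d * real_of_int q powr (- eta1 d)
         + real l powr vartheta d * 2 powr (- zeta1 d * real r)
         + 2 powr (- zeta2 d * real r)
         + 2 powr (- zeta3 d * real r) * real_of_int q powr eta2 d) powr (1 / 2)"
proof -
  \<comment> \<open>The differences have degree \<open>d - 1\<close>, and Weyl sums of degree
    \<open>k' + 1\<close> rest on the mean value theorem in degree \<open>k'\<close>.\<close>
  define k' where "k' = d - 2"
  have k': "k' \<ge> 1" "d = k' + 2" unfolding k'_def using assms by auto
  define E where "E = real (2 * sK k' + 2)"
  have Ed: "E = real d ^ 2 - 3 * real d + 4"
  proof -
    have "E = real k' * (real k' + 1) + 2" unfolding E_def two_sK by (simp add: algebra_simps)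
    then show ?thesis unfolding k'(2) by (simp add: power2_eq_square algebra_simps)
  qed
  have E4: "E \<ge> 4"
  proof -
    have "1 * (1 + 1) \<le> real k' * (real k' + 1)" using k' by (intro mult_mono) auto
    then show ?thesis unfolding E_def two_sK by (simp add: algebra_simps)
  qed
  have eta1: "eta1 d = 1 / (E + real d)" unfolding eta1_def Ed by (simp add: algebra_simps)
  have zeta2: "zeta2 d = 1 / (E + 1)" unfolding zeta2_def Ed by (simp add: algebra_simps)
  have eta2: "eta2 d = 1 / (E + real d - 1)" unfolding eta2_def Ed by (simp add: algebra_simps)
  have zeta3: "zeta3 d = (real d - 1) / (E + real d - 1)" unfolding zeta3_def Ed by (simp add: algebra_simps)
  obtain C where C: "C \<ge> 1" "\<And>(X::nat) (c :: nat \<Rightarrow> real) (Z::real). 1 \<le> Z \<Longrightarrow> Z \<le> real X \<Longrightarrow>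
    (\<And>b t :: int. t \<ge> 1 \<Longrightarrow> coprime b t \<Longrightarrow> Z \<le> of_int t \<or>
      Z \<le> of_int t * real X ^ (k' + 1) * \<bar>real (k' + 1) * c (k' + 1) - of_int b / of_int t\<bar>) \<Longrightarrow>
    norm (\<Sum>x<X. e (\<Sum>i\<le>k' + 1. c i * real x ^ i)) \<le> C * real X * (1 + ln (real X)) * Z powr (- 1 / E)"
    using weyl_bound[OF k'(1)] unfolding E_def by blast
  \<comment> \<open>The factor 2 d^2 comes from the first entry of \<open>Z\<close> below, and 2^d
    from \<open>H \<le> 2 / T\<close> raised to the power \<open>d\<close>.\<close>
  define \<gamma> where "\<gamma> = 1 / (2 ^ (d + 1) * real d ^ 2)"
  have \<gamma>: "0 < \<gamma>" "\<gamma> \<le> 1 / 2" "\<gamma> \<le> 1 / 2 ^ d"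
  proof -
    have d2: "1 \<le> real d ^ 2" using assms by (intro one_le_power) auto
    then show "0 < \<gamma>" unfolding \<gamma>_def using assms by simp
    have "\<gamma> \<le> 1 / (2 ^ (d + 1) * 1)" unfolding \<gamma>_def using d2 assms by (intro divide_left_mono mult_left_mono) auto
    moreover have "(1::real) / 2 ^ (d + 1) \<le> 1 / 2 ^ d" by (intro divide_left_mono power_increasing) auto
    moreover have "(1::real) / 2 ^ (d + 1) \<le> 1 / 2 ^ 1" by (intro divide_left_mono power_increasing) auto
    ultimately show "\<gamma> \<le> 1 / 2" "\<gamma> \<le> 1 / 2 ^ d" unfolding power_one_right mult_1_right by linarith+
  qed
  define K where "K = C * \<gamma> powr (- 1 / E)"
  have g1: "\<gamma> powr (- 1 / E) \<ge> 1"
  proof -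
    have "1 powr (- 1 / E) \<le> \<gamma> powr (- 1 / E)" using \<gamma>(1,2) E4 by (intro powr_mono2') auto
    then show ?thesis by simp
  qed
  have K: "K \<ge> 1"
  proof -
    have "1 * 1 \<le> C * \<gamma> powr (- 1 / E)" using C(1) g1 by (intro mult_mono) auto
    then show ?thesis unfolding K_def by simp
  qed
  \<comment> \<open>The squared estimate loses the factor \<open>m^2 * (1 + K * (1 + r))\<close>, at
    most \<open>m^2 * (1 + 2 * K) * r\<close>, and this is at most \<open>r^2\<close> from
    \<open>r0\<close> on. The constant \<open>K\<close> depends on \<open>d\<close> only.\<close>
  define r0 where "r0 = nat \<lceil>real m ^ 2 * (1 + 2 * K)\<rceil> + 2"
  show ?thesis
  proof (rule exI[of _ r0], intro allI impI)
    fix r and f :: "real poly" and a q :: int and l k :: nat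
    assume r: "r \<ge> r0" and deg: "degree f = d" and q: "q \<ge> 1" and cop: "coprime a q"
      and app: "\<bar>coeff f d - real_of_int a / real_of_int q\<bar> < 1 / (real_of_int q)\<^sup>2"
      and l: "l \<ge> 1" and km: "k < m"
    define T1 where "T1 = real l powr eta1 d * real_of_int q powr (- eta1 d)"
    define T2 where "T2 = real l powr vartheta d * 2 powr (- zeta1 d * real r)"
    define T3 where "T3 = 2 powr (- zeta2 d * real r)"
    define T4 where "T4 = 2 powr (- zeta3 d * real r) * real_of_int q powr eta2 d"
    define T where "T = T1 + T2 + T3 + T4"
    have Tnn: "T1 \<ge> 0" "T2 \<ge> 0" "T3 > 0" "T4 \<ge> 0" unfolding T1_def T2_def T3_def T4_def by auto
    have T0: "T > 0" unfolding T_def using Tnn by linarith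
    have Tge: "T1 \<le> T" "T3 \<le> T" "T4 \<le> T" unfolding T_def using Tnn by linarith+
    have r2: "r \<ge> 2" using r unfolding r0_def by linarith
    have rK: "real m ^ 2 * (1 + 2 * K) \<le> real r" using r unfolding r0_def by linarith
    have "norm (weyl_sum f r l k m) \<le> real r * 2 ^ r * T powr (1 / 2)"
    proof (cases "T \<ge> 1")
      case True
      have "norm (weyl_sum f r l k m) \<le> (\<Sum>n\<in>digit_class k m r. 1)"
        unfolding weyl_sum_def by (intro sum_norm_le) simp
      also have "\<dots> \<le> 2 ^ r"
      proof -
        have "card (digit_class k m r) \<le> card {..<2 ^ r :: nat}" by (intro card_mono) (auto simp: digit_class_def)
        then have "real (card (digit_class k m r)) \<le> real (2 ^ r)" by simp
        then show ?thesis by simp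
      qed
      also have "2 ^ r * 1 * 1 \<le> real r * 2 ^ r * T powr (1 / 2)"
      proof (rule mult_mono)
        show "2 ^ r * 1 \<le> real r * (2 ^ r :: real)" using r2 by simp
        show "1 \<le> T powr (1 / 2)" using True by (simp add: ge_one_powr_ge_zero)
      qed auto
      finally show ?thesis by simp
    next
      case False
      then have T1': "T < 1" by simp
      define N where "N = (2 ^ r :: real)"
      have N0: "N > 0" by (simp add: N_def)
      have Npow: "2 powr (real r) = N" unfolding N_def by (simp add: powr_realpow)
      define Q where "Q = real_of_int q"
      have Q: "Q \<ge> 1" unfolding Q_def using q by simp
      \<comment> \<open>\<open>2 ^ s\<close> is the least power of two that is at least
        \<open>1 / T\<close>: the diagonal terms contribute \<open>1 / H\<close> and the Weyl sums
        about \<open>T\<close>, so the two balance.\<close>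
      define s where "s = nat \<lceil>log 2 (1 / T)\<rceil>"
      define H where "H = (2 ^ s :: real)"
      have H0: "H \<ge> 1" unfolding H_def by simp
      have Hp: "H = 2 powr real s" unfolding H_def by (simp add: powr_realpow)
      have lg: "log 2 (1 / T) > 0" using T0 T1' by simp
      have sl: "log 2 (1 / T) \<le> real s" "real s \<le> log 2 (1 / T) + 1" unfolding s_def using lg by linarith+
      have H1: "1 / T \<le> H"
      proof -
        have "2 powr log 2 (1 / T) \<le> H" unfolding Hp using sl(1) by (intro powr_mono) auto
        then show ?thesis using T0 by (simp add: powr_log_cancel)
      qed
      have H2: "H \<le> 2 / T"
      proof -
        have "H \<le> 2 powr (log 2 (1 / T) + 1)" unfolding Hp using sl(2) by (intro powr_mono) auto
        also have "\<dots> = 2 / T" using T0 by (simp add: powr_add powr_log_cancel)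
        finally show ?thesis .
      qed
      have NT: "T powr (- (E + 1)) \<le> N"
      proof -
        have "T3 = N powr (- 1 / (E + 1))" unfolding T3_def zeta2 Npow[symmetric] by (simp add: powr_powr)
        then have "T powr (- (E + 1)) \<le> (N powr (- 1 / (E + 1))) powr (- (E + 1))"
          using Tge(2) Tnn(3) E4 by (intro powr_mono2') auto
        also have "\<dots> = N"
        proof -
          have "- 1 / (E + 1) * - (E + 1) = 1" using E4 by (simp add: field_simps)
          then show ?thesis using N0 by (simp only: powr_powr powr_one less_imp_le)
        qed
        finally show ?thesis .
      qed
      have sr: "s \<le> r"
      proof -
        have "T powr (- 2) \<le> T powr (- (E + 1))" using T0 T1' E4 by (intro powr_mono') auto
        then have "T powr (- 2) \<le> N" using NT by linarith
        moreover have "T powr (- 2) = (1 / T) ^ 2"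
          using T0 powr_realpow[of T 2] by (simp add: powr_minus_divide power_one_over)
        ultimately have "(1 / T) ^ 2 \<le> N" by simp
        then have "(2 / T) ^ 2 \<le> 4 * N" by (simp add: power2_eq_square)
        also have "4 * N \<le> N * N"
        proof (rule mult_right_mono)
          have "(2::real) ^ 2 \<le> 2 ^ r" using r2 by (intro power_increasing) auto
          then show "4 \<le> N" unfolding N_def by simp
        qed (use N0 in simp)
        finally have "(2 / T) ^ 2 \<le> N ^ 2" by (simp add: power2_eq_square)
        then have "2 / T \<le> N" using N0 by (rule power2_le_imp_le[OF _ less_imp_le])
        then have "(2::real) ^ s \<le> 2 ^ r" using H2 unfolding H_def N_def by linarith
        then show ?thesis by (simp add: power_increasing_iff)
      qed
      define X where "X = (2 ^ (r - s) :: nat)"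
      have HX: "H * real X = N" unfolding H_def X_def N_def using sr by (simp add: power_add[symmetric])
      have X1: "X \<ge> 1" unfolding X_def by simp
      have XN: "real X = N / H" using HX H0 by (simp add: field_simps)
      have X2: "N * T / 2 \<le> real X"
      proof -
        have "N / (2 / T) \<le> N / H" using H2 H0 N0 T0 by (intro divide_left_mono) auto
        then show ?thesis unfolding XN by simp
      qed
      \<comment> \<open>The first two entries are what
        \<open>rational_approximation_dichotomy\<close> requires for the multiplier \<open>B\<close>
        below and \<open>P\<close> a power of \<open>X\<close>; the third is the range in which
        \<open>weyl_bound\<close> holds.\<close>
      define Z where "Z = min (min (Q / (2 * (real d ^ 2 * real l * H ^ d))) (real X ^ (d - 1) / (2 * Q))) (real X)"
      have ZT: "\<gamma> * T powr (- E) \<le> Z"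
        unfolding Z_def
      proof (intro min.boundedI)
        have l0: "real l > 0" using l by simp
        have d0: "real d > 0" using assms by simp
        \<comment> \<open>\<open>T1 \<le> T\<close> says that l/q is at most T^(E+d). The factor T^d
          in it compensates \<open>H ^ d\<close>, which leaves T^E.\<close>
        show "\<gamma> * T powr (- E) \<le> Q / (2 * (real d ^ 2 * real l * H ^ d))"
        proof -
          have "T1 = (real l / Q) powr (1 / (E + real d))"
            unfolding T1_def eta1 Q_def[symmetric] using Q l0 by (simp add: powr_divide powr_minus field_simps)
          then have "(real l / Q) powr (1 / (E + real d)) \<le> T" using Tge(1) by simp
          then have "((real l / Q) powr (1 / (E + real d))) powr (E + real d) \<le> T powr (E + real d)"
            using E4 by (intro powr_mono2) auto
          then have lq: "real l / Q \<le> T powr (E + real d)" using E4 l0 Q by (simp add: powr_powr)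
          have Td: "T powr (E + real d) = T powr E * T ^ d" using T0 by (simp add: powr_add powr_realpow)
          have "real l * H ^ d \<le> (Q * (T powr E * T ^ d)) * (2 / T) ^ d"
          proof (rule mult_mono)
            show "real l \<le> Q * (T powr E * T ^ d)" using lq Q unfolding Td by (simp add: field_simps)
            show "H ^ d \<le> (2 / T) ^ d" using H2 H0 by (intro power_mono) auto
          qed (use Q T0 H0 in auto)
          also have "\<dots> = 2 ^ d * Q * T powr E" using T0 by (simp add: power_divide)
          finally have lH: "real l * H ^ d \<le> 2 ^ d * Q * T powr E" .
          have "\<gamma> * T powr (- E) = Q / (2 * (real d ^ 2 * (2 ^ d * Q * T powr E)))"
            unfolding \<gamma>_def using Q T0 by (simp add: powr_minus field_simps)
          also have "\<dots> \<le> Q / (2 * (real d ^ 2 * (real l * H ^ d)))"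
            using lH Q H0 d0 l0 T0 by (intro divide_left_mono mult_left_mono mult_pos_pos) auto
          finally show ?thesis by (simp add: mult.assoc)
        qed
        \<comment> \<open>\<open>T4 \<le> T\<close> says that \<open>Q\<close> is at most (NT)^(d-1)
          T^E, and \<open>X\<close> is at least NT/2.\<close>
        show "\<gamma> * T powr (- E) \<le> real X ^ (d - 1) / (2 * Q)"
        proof -
          define D where "D = E + real d - 1"
          have D: "D > 0" unfolding D_def using E4 by simp
          have Nd: "2 powr ((real d - 1) * real r) = N ^ (d - 1)"
          proof -
            have "2 powr ((real d - 1) * real r) = (2 powr real r) powr real (d - 1)"
              using assms by (simp add: powr_powr of_nat_diff mult.commute)
            then show ?thesis unfolding Npow using N0 by (simp add: powr_realpow)
          qed
          have "T4 = (Q / N ^ (d - 1)) powr (1 / D)"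
          proof -
            have "(N ^ (d - 1)) powr (1 / D) = 2 powr (zeta3 d * real r)"
              unfolding Nd[symmetric] zeta3 D_def by (simp add: powr_powr)
            then show ?thesis unfolding T4_def eta2 Q_def[symmetric] D_def[symmetric]
              using Q N0 by (simp add: powr_divide powr_minus field_simps)
          qed
          then have "((Q / N ^ (d - 1)) powr (1 / D)) powr D \<le> T powr D"
            using Tge(3) Tnn(4) D by (intro powr_mono2) auto
          then have qN: "Q / N ^ (d - 1) \<le> T powr D" using D Q N0 by (simp add: powr_powr)
          have TD: "T powr D = T powr E * T ^ (d - 1)"
          proof -
            have "D = E + real (d - 1)" unfolding D_def using assms by (simp add: of_nat_diff)
            then show ?thesis using T0 by (simp add: powr_add powr_realpow)
          qed
          have Q1: "Q \<le> N ^ (d - 1) * (T powr E * T ^ (d - 1))" using qN N0 unfolding TD by (simp add: field_simps)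
          have "\<gamma> * T powr (- E) * (2 * Q) \<le> (1 / 2 ^ d) * T powr (- E) * (2 * (N ^ (d - 1) * (T powr E * T ^ (d - 1))))"
            using \<gamma> Q1 Q by (intro mult_mono) auto
          also have "\<dots> = (2 / 2 ^ d) * (N * T) ^ (d - 1)" using T0 by (simp add: powr_minus power_mult_distrib)
          also have "(2 / 2 ^ d :: real) = 1 / 2 ^ (d - 1)" using assms by (cases d) auto
          also have "1 / 2 ^ (d - 1) * (N * T) ^ (d - 1) = (N * T / 2) ^ (d - 1)" by (simp add: power_divide)
          also have "\<dots> \<le> real X ^ (d - 1)" using X2 N0 T0 by (intro power_mono) auto
          finally show ?thesis using Q by (simp add: pos_le_divide_eq)
        qed
        \<comment> \<open>\<open>T3 \<le> T\<close> says that \<open>N\<close> is at least T^-(E+1),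
          so \<open>N * T\<close> is at least T^-E.\<close>
        show "\<gamma> * T powr (- E) \<le> real X"
        proof -
          have TE: "T powr (- E) = T powr (- (E + 1)) * T"
            using T0 powr_add[of T "- (E + 1)" 1] by simp
          have "\<gamma> * T powr (- E) \<le> 1 / 2 * (T powr (- (E + 1)) * T)"
            unfolding TE using \<gamma> T0 by (intro mult_right_mono) auto
          also have "1 / 2 * (T powr (- (E + 1)) * T) \<le> 1 / 2 * (N * T)"
            using NT T0 by (intro mult_left_mono mult_right_mono) auto
          also have "\<dots> \<le> real X" using X2 by simp
          finally show ?thesis .
        qed
      qed
      define L where "L = 1 + ln (real X)"
      have L1: "L \<ge> 1" unfolding L_def using X1 by simp
      have Lr: "L \<le> 1 + real r"
      proof -
        have "ln (real X) = real (r - s) * ln 2" unfolding X_def by (simp add: ln_realpow)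
        also have "\<dots> \<le> real r * 1" using ln_2_less_1 by (intro mult_mono) auto
        finally show ?thesis unfolding L_def by simp
      qed
      define F where "F = (\<lambda>n. e (real l * poly f (real n)))"
      have W: "norm (\<Sum>x<2 ^ (r - s). F (2 ^ s * x + y1) * cnj (F (2 ^ s * x + y2))) \<le> K * real X * L * T"
        if y: "y1 < 2 ^ s" "y2 < 2 ^ s" "y1 \<noteq> y2" for y1 y2
      proof -
        obtain c where c: "\<And>x. real l * poly f (H * x + real y1) - real l * poly f (H * x + real y2) = (\<Sum>i\<le>k' + 1. c i * x ^ i)"
          "c (k' + 1) = real l * real (k' + 2) * H ^ (k' + 1) * (real y1 - real y2) * coeff f (k' + 2)"
          by (rule poly_difference_expand[of f k' "real l" H "real y1" "real y2"]) (use deg k'(2) in auto)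
        have "F (2 ^ s * x + y1) * cnj (F (2 ^ s * x + y2)) = e (\<Sum>i\<le>k' + 1. c i * real x ^ i)" for x
          unfolding c(1)[symmetric] F_def e_minus[symmetric] e_add[symmetric] H_def by simp
        then have eqS: "(\<Sum>x<2 ^ (r - s). F (2 ^ s * x + y1) * cnj (F (2 ^ s * x + y2))) =
          (\<Sum>x<X. e (\<Sum>i\<le>k' + 1. c i * real x ^ i))" unfolding X_def by simp
        let ?S = "norm (\<Sum>x<X. e (\<Sum>i\<le>k' + 1. c i * real x ^ i))"
        have main: "?S \<le> K * real X * L * T"
        proof (cases "1 \<le> Z")
          case True
          \<comment> \<open>The integer by which the leading coefficient of \<open>f\<close> is
            multiplied in the quantity that \<open>weyl_bound\<close> approximates by rationals; it
            is nonzero because \<open>y1\<close> and \<open>y2\<close> are distinct.\<close>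
          define B where "B = int ((k' + 1) * (l * (k' + 2) * 2 ^ (s * (k' + 1)))) * (int y1 - int y2)"
          have "(k' + 1) * (l * (k' + 2) * 2 ^ (s * (k' + 1))) \<noteq> 0" using l unfolding mult_eq_0_iff by simp
          then have B0: "B \<noteq> 0" unfolding B_def mult_eq_0_iff of_nat_eq_0_iff using y by simp
          have Hs: "H ^ (k' + 1) = 2 ^ (s * (k' + 1))" unfolding H_def by (simp only: power_mult)
          have Beq: "real (k' + 1) * c (k' + 1) = of_int B * coeff f d"
            unfolding c(2) B_def k'(2) Hs
            by (simp only: of_int_mult of_int_diff of_int_of_nat_eq of_nat_mult of_nat_power of_nat_numeral of_int_power of_int_numeral mult_ac)
          have Babs: "\<bar>real_of_int B\<bar> \<le> real d ^ 2 * real l * H ^ d"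
          proof -
            have "\<bar>real_of_int B\<bar> = real (k' + 1) * (real l * real (k' + 2) * H ^ (k' + 1)) * \<bar>real y1 - real y2\<bar>"
              unfolding B_def Hs of_int_mult of_int_diff of_int_of_nat_eq abs_mult abs_of_nat
              by (simp only: of_nat_mult of_nat_power of_nat_numeral mult_ac)
            also have "\<dots> \<le> real d * (real l * real d * H ^ (k' + 1)) * H"
            proof (intro mult_mono)
              have "real y1 < H" "real y2 < H" unfolding H_def using y by (metis of_nat_less_iff of_nat_numeral of_nat_power)+
              then show "\<bar>real y1 - real y2\<bar> \<le> H" by (auto simp: abs_if)
            qed (use k'(2) H0 in auto)
            also have "\<dots> = real d ^ 2 * real l * H ^ d" unfolding k'(2) by (simp add: power2_eq_square)
            finally show ?thesis .
          qed
          have S: "?S \<le> C * real X * (1 + ln (real X)) * Z powr (- 1 / E)"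
          proof (rule C(2)[OF True])
            show "Z \<le> real X" unfolding Z_def by simp
            fix b t :: int assume t: "t \<ge> 1" "coprime b t"
            show "Z \<le> of_int t \<or> Z \<le> of_int t * real X ^ (k' + 1) * \<bar>real (k' + 1) * c (k' + 1) - of_int b / of_int t\<bar>"
              unfolding Beq
            proof (rule rational_approximation_dichotomy[OF q cop app B0 t(1)])
              have "Z \<le> Q / (2 * (real d ^ 2 * real l * H ^ d))" unfolding Z_def by simp
              also have "\<dots> \<le> Q / (2 * \<bar>real_of_int B\<bar>)"
                using Babs Q B0 H0 l assms(1) by (intro divide_left_mono mult_pos_pos) auto
              finally show "Z \<le> of_int q / (2 * \<bar>of_int B\<bar>)" unfolding Q_def .
              have "k' + 1 = d - 1" using k'(2) by simp
              then show "Z \<le> real X ^ (k' + 1) / (2 * of_int q)" unfolding Z_def Q_def by simp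
            qed simp
          qed
          have "Z powr (- 1 / E) \<le> (\<gamma> * T powr (- E)) powr (- 1 / E)"
            using ZT E4 \<gamma>(1) T0 by (intro powr_mono2') auto
          also have "\<dots> = \<gamma> powr (- 1 / E) * T"
            using E4 T0 by (simp add: powr_mult powr_powr)
          finally have "C * real X * L * Z powr (- 1 / E) \<le> C * real X * L * (\<gamma> powr (- 1 / E) * T)"
            using C(1) L1 by (intro mult_left_mono) auto
          moreover have "C * real X * L * (\<gamma> powr (- 1 / E) * T) = K * real X * L * T"
            unfolding K_def by (simp only: mult_ac)
          ultimately show ?thesis using S unfolding L_def[symmetric] by linarith
        next
          \<comment> \<open>Here \<open>\<gamma> * T powr (- E)\<close> is at most 1, which bounds
            \<open>T\<close> below by a constant, so the trivial bound \<open>X\<close>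
            suffices.\<close>
          case False
          have "?S \<le> (\<Sum>x<X. 1)" by (intro sum_norm_le) simp
          then have SX: "?S \<le> real X" by simp
          have "\<gamma> * T powr (- E) \<le> 1" using ZT False by linarith
          then have "1 powr (- 1 / E) \<le> (\<gamma> * T powr (- E)) powr (- 1 / E)"
            using E4 \<gamma>(1) T0 by (intro powr_mono2') auto
          also have "\<dots> = \<gamma> powr (- 1 / E) * T" using E4 T0 by (simp add: powr_mult powr_powr)
          finally have g: "1 \<le> \<gamma> powr (- 1 / E) * T" by simp
          have "1 * 1 * 1 \<le> C * (\<gamma> powr (- 1 / E) * T) * L" using C(1) L1 g by (intro mult_mono) auto
          then have "real X * 1 \<le> real X * (C * (\<gamma> powr (- 1 / E) * T) * L)" by (intro mult_left_mono) auto
          then show ?thesis using SX unfolding K_def by (simp add: mult_ac)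
        qed
        then show ?thesis unfolding eqS .
      qed
      have W0: "K * real X * L * T \<ge> 0" using K L1 T0 by simp
      have "norm (weyl_sum f r l k m) ^ 2 \<le> real m ^ 2 * 2 ^ (r - s) * (2 ^ s * 2 ^ (r - s) + (2 ^ s) ^ 2 * max (K * real X * L * T) 0)"
        unfolding weyl_sum_def F_def[symmetric]
        by (rule digit_class_sum_cauchy_schwarz[OF assms(2) sr _ W]) (auto simp: F_def)
      also have "\<dots> = real m ^ 2 * (real X * (H * real X + H ^ 2 * (K * real X * L * T)))"
        using W0 unfolding H_def X_def by (simp add: max_absorb1)
      also have "real X * (H * real X + H ^ 2 * (K * real X * L * T)) = N ^ 2 * (1 / H + K * L * T)"
        unfolding HX[symmetric] using H0 by (simp add: power2_eq_square field_simps)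
      also have "real m ^ 2 * (N ^ 2 * (1 / H + K * L * T)) \<le> real m ^ 2 * (N ^ 2 * (T + K * (1 + real r) * T))"
      proof (intro mult_left_mono add_mono mult_right_mono Lr)
        show "1 / H \<le> T" using H1 H0 T0 by (simp add: field_simps)
      qed (use K T0 in auto)
      also have "\<dots> = (real m ^ 2 * (1 + K * (1 + real r))) * (N ^ 2 * T)" by (simp add: algebra_simps)
      also have "\<dots> \<le> real r ^ 2 * (N ^ 2 * T)"
      proof (rule mult_right_mono)
        have "1 + K * (1 + real r) \<le> (1 + 2 * K) * real r"
        proof -
          have "1 \<le> real r" using r2 by simp
          moreover have "K * (1 + real r) \<le> K * (2 * real r)" using K r2 by (intro mult_left_mono) auto
          ultimately show ?thesis by (simp add: algebra_simps)
        qed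
        then have "real m ^ 2 * (1 + K * (1 + real r)) \<le> real m ^ 2 * ((1 + 2 * K) * real r)" by (intro mult_left_mono) auto
        also have "\<dots> \<le> real r * real r" using rK by (simp add: mult_right_mono flip: mult.assoc)
        finally show "real m ^ 2 * (1 + K * (1 + real r)) \<le> real r ^ 2" by (simp add: power2_eq_square)
      qed (use T0 in auto)
      also have "\<dots> = (real r * N * T powr (1 / 2)) ^ 2"
        using T0 by (simp add: power_mult_distrib powr_half_sqrt)
      finally have "norm (weyl_sum f r l k m) \<le> real r * N * T powr (1 / 2)"
        by (rule power2_le_imp_le) (use N0 in simp)
      then show ?thesis unfolding N_def .
    qed
    then show "norm (weyl_sum f r l k m) \<le>
      real r * 2 ^ r *
        (real l powr eta1 d * real_of_int q powr (- eta1 d)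
         + real l powr vartheta d * 2 powr (- zeta1 d * real r)
         + 2 powr (- zeta2 d * real r)
         + 2 powr (- zeta3 d * real r) * real_of_int q powr eta2 d) powr (1 / 2)"
      unfolding T_def T1_def T2_def T3_def T4_def .
  qed
qed

end
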